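(* Let $\ell,\tilde\ell\in\mathbb R$, and for $\alpha>0$ define $$\beta_n=\beta_c+\frac1{n^\alpha},\qquad K_n=K(\beta_c)+\frac{K'(\beta_c)}{n^\alpha}+\frac{\ell}{2n^{2\alpha}}+\frac{\tilde\ell}{6n^{3\alpha}} .$$ Let $\ell_c=K''(\beta_c)-5/(4\beta_c)$, and consider the following four cases: Case (a): $\ell>K''(\beta_c)$ and any $\tilde\ell\in\mathbb R$. Case (b): $\ell=K''(\beta_c)$ and any $\tilde\ell>K'''(\beta_c)$. Case (c): $K''(\beta_c)>\ell>\ell_c$ and any $\tilde\ell\in\mathbb R$. Case (d): $\ell=\ell_c$ and any $\tilde\ell>K_1'''(\beta_c)$. For cases (c) and (d) assume that the first three right-hand derivatives $K_1'(\beta_c),K_1''(\beta_c),K_1'''(\beta_c)$ of $K_1$ at $\beta_c$ exist and that (Conjecture 1) $K_1'(\beta_c)=K'(\beta_c)$ and (Conjecture 2) $K_1''(\beta_c)=\ell_c<0<K''(\beta_c)$ are valid. Let $$g(x)=\tfrac12\beta_c\bigl(K''(\beta_c)-\ell\bigr)x^2-4c_4x^4+c_6x^6,\qquad \tilde g(x)=c_6x^6,\qquad c_4=3/16,\quad c_6=9/40,$$ let $\bar x>0$ be the unique positive global minimum point of $g$, and let $$\bar y=\frac{\int_{\mathbb R}|x|\exp[-\tilde g(x)]\,dx}{\int_{\mathbb R}\exp[-\tilde g(x)]\,dx},\qquad \bar z=\frac{\int_{\mathbb R}|x|\exp[-g(x)]\,dx}{\int_{\mathbb R}\exp[-g(x)]\,dx}.$$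 Then: (a) In cases (a)--(d), for all $\alpha>0$, $m(\beta_n,K_n)\sim\bar x/n^{\alpha/2}=\bar x(\beta_n-\beta_c)^{1/2}$. (b) In cases (a)--(c), for all $0<\alpha<\alpha_0=1/3$, $E_{n,\beta_n,K_n}\{|S_n/n|\}\sim\bar x/n^{\alpha/2}\sim m(\beta_n,K_n)$. (c) In cases (a)--(d), for all $\alpha>\alpha_0=1/3$, $E_{n,\beta_n,K_n}\{|S_n/n|\}\sim\bar y/n^{1/6}\gg m(\beta_n,K_n)$. (d) In cases (a)--(d), for $\alpha=\alpha_0=1/3$, $E_{n,\beta_n,K_n}\{|S_n/n|\}\sim\bar z/n^{1/6}\sim\bar z\cdot m(\beta_n,K_n)/\bar x$.
   Context: Mean-field Blume--Capel model. Let $\Lambda=\{1,0,-1\}$. For $n\in\mathbb N$, $K>0$ and $\omega=(\omega_1,\dots,\omega_n)\in\Lambda^n$ put $S_n(\omega)=\sum_{j=1}^n\omega_j$ and $H_{n,K}(\omega)=\sum_{j=1}^n\omega_j^2-\frac Kn\bigl(\sum_{j=1}^n\omega_j\bigr)^2$. For $\beta>0$, $P_{n,\beta,K}$ is the probability measure on $\Lambda^n$ giving $\omega$ probability proportional to $\exp[-\beta H_{n,K}(\omega)]$; $E_{n,\beta,K}$ denotes expectation with respect to $P_{n,\beta,K}$. Free-energy functional: $c_\beta(t)=\log\frac{1+e^{-\beta}(e^t+e^{-t})}{1+2e^{-\beta}}$ and $G_{\beta,K}(x)=\beta Kx^2-c_\beta(2\beta Kx)$ for $x\in\mathbb R$.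 $\mathcal M_{\beta,K}$ is the set of global minimum points of $G_{\beta,K}$. Let $\beta_c=\log4$ and $K(\beta)=(e^\beta+2)/(4\beta)$ for $\beta>0$; $K',K'',K'''$ are derivatives of this function. The phase-coexistence region is the set of $(\beta,K)$, $\beta,K>0$, for which $\mathcal M_{\beta,K}$ has more than one element. It is known that for such $(\beta,K)$, $\mathcal M_{\beta,K}$ is $\{\pm m(\beta,K)\}$ or $\{0,\pm m(\beta,K)\}$ with $m(\beta,K)>0$; this unique positive global minimum point $m(\beta,K)$ is the thermodynamic magnetization. First-order curve: it is known that for each $\beta>\beta_c$ there is a unique number $K_1(\beta)>0$ such that $\mathcal M_{\beta,K}=\{0\}$ for $0<K<K_1(\beta)$, $\mathcal M_{\beta,K}=\{0,\pm m(\beta,K)\}$ for $K=K_1(\beta)$, and $\mathcal M_{\beta,K}=\{\pm m(\beta,K)\}$ for $K>K_1(\beta)$. Since $\lim_{\beta\to\beta_c^+}K_1(\beta)=K(\beta_c)$, one extends $K_1$ continuously by $K_1(\beta_c)=K(\beta_c)$. Notation: $a_n\sim b_n$ means $a_n/b_n\to1$ and $a_n\gg b_n$ means $a_n/b_n\to\infty$ as $n\to\infty$. All quantities are considered for $n$ large enough that $\beta_n,K_n>0$ and $(\beta_n,K_n)$ lies in the phase-coexistence region (which holds for all sufficiently large $n$ under the stated assumptions). *)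

theory Defs
  imports "HOL-Probability.Probability" "HOL-Library.Landau_Symbols"
begin

section \<open>The finite-volume model\<close>

definition configs :: "nat \<Rightarrow> (nat \<Rightarrow> real) set" where
  "configs n = {1..n} \<rightarrow>\<^sub>E {1, 0, -1}"

definition spin_sum :: "nat \<Rightarrow> (nat \<Rightarrow> real) \<Rightarrow> real" where
  "spin_sum n \<omega> = (\<Sum>j=1..n. \<omega> j)"

definition Ham :: "nat \<Rightarrow> real \<Rightarrow> (nat \<Rightarrow> real) \<Rightarrow> real" where
  "Ham n K \<omega> = (\<Sum>j=1..n. (\<omega> j)\<^sup>2) - K / real n * (\<Sum>j=1..n. \<omega> j)\<^sup>2"

definition partition_fun :: "nat \<Rightarrow> real \<Rightarrow> real \<Rightarrow> real" where
  "partition_fun n \<beta> K = (\<Sum>\<omega>\<in>configs n. exp (- \<beta> * Ham n K \<omega>))"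

definition BC_measure :: "nat \<Rightarrow> real \<Rightarrow> real \<Rightarrow> (nat \<Rightarrow> real) measure" where
  "BC_measure n \<beta> K =
     point_measure (configs n) (\<lambda>\<omega>. ennreal (exp (- \<beta> * Ham n K \<omega>) / partition_fun n \<beta> K))"

definition BC_expectation :: "nat \<Rightarrow> real \<Rightarrow> real \<Rightarrow> ((nat \<Rightarrow> real) \<Rightarrow> real) \<Rightarrow> real" where
  "BC_expectation n \<beta> K f = integral\<^sup>L (BC_measure n \<beta> K) f"

lemma finite_configs: "finite (configs n)"
  unfolding configs_def by (intro finite_PiE) auto

lemma configs_nonempty: "configs n \<noteq> {}"
  unfolding configs_def by (simp add: PiE_eq_empty_iff)

lemma partition_fun_pos: "partition_fun n \<beta> K > 0"
  unfolding partition_fun_def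
  using finite_configs configs_nonempty by (intro sum_pos) auto

lemma prob_space_BC_measure: "prob_space (BC_measure n \<beta> K)"
proof
  let ?w = "\<lambda>\<omega>. exp (- \<beta> * Ham n K \<omega>) / partition_fun n \<beta> K"
  have "emeasure (BC_measure n \<beta> K) (space (BC_measure n \<beta> K)) = (\<Sum>\<omega>\<in>configs n. ennreal (?w \<omega>))"
    unfolding BC_measure_def space_point_measure
    by (rule emeasure_point_measure_finite) (auto simp: finite_configs)
  also have "\<dots> = ennreal (\<Sum>\<omega>\<in>configs n. ?w \<omega>)"
    using partition_fun_pos[of n \<beta> K] by (intro sum_ennreal) (simp add: less_imp_le)
  also have "(\<Sum>\<omega>\<in>configs n. ?w \<omega>) = 1"
    using partition_fun_pos[of n \<beta> K]
    unfolding sum_divide_distrib[symmetric] partition_fun_def[symmetric] by simp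
  finally show "emeasure (BC_measure n \<beta> K) (space (BC_measure n \<beta> K)) = 1"
    by simp
qed

section \<open>Free-energy functional and thermodynamic magnetization\<close>

definition c_fun :: "real \<Rightarrow> real \<Rightarrow> real" where
  "c_fun \<beta> t = ln ((1 + exp (- \<beta>) * (exp t + exp (- t))) / (1 + 2 * exp (- \<beta>)))"

definition G_fun :: "real \<Rightarrow> real \<Rightarrow> real \<Rightarrow> real" where
  "G_fun \<beta> K x = \<beta> * K * x\<^sup>2 - c_fun \<beta> (2 * \<beta> * K * x)"

definition global_min_points :: "(real \<Rightarrow> real) \<Rightarrow> real set" where
  "global_min_points f = {x. \<forall>y. f x \<le> f y}"

definition M_set :: "real \<Rightarrow> real \<Rightarrow> real set" where
  "M_set \<beta> K = global_min_points (G_fun \<beta> K)"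

definition phase_coexistence :: "(real \<times> real) set" where
  "phase_coexistence =
     {(\<beta>, K). \<beta> > 0 \<and> K > 0 \<and> (\<exists>x\<in>M_set \<beta> K. \<exists>y\<in>M_set \<beta> K. x \<noteq> y)}"

text \<open>Meaningful for \<open>(\<beta>, K)\<close> in the phase-coexistence region.\<close>
definition magnetization :: "real \<Rightarrow> real \<Rightarrow> real" where
  "magnetization \<beta> K = (THE x. x > 0 \<and> x \<in> M_set \<beta> K)"

section \<open>The curves \<open>K(\<beta>)\<close> and \<open>K\<^sub>1(\<beta>)\<close>\<close>

definition beta_c :: real where
  "beta_c = ln 4"

definition K_curve :: "real \<Rightarrow> real" where
  "K_curve \<beta> = (exp \<beta> + 2) / (4 * \<beta>)"

definition first_order_point :: "real \<Rightarrow> real \<Rightarrow> bool" where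
  "first_order_point \<beta> k \<longleftrightarrow>
     k > 0 \<and>
     (\<forall>K. 0 < K \<and> K < k \<longrightarrow> M_set \<beta> K = {0}) \<and>
     (magnetization \<beta> k > 0 \<and>
        M_set \<beta> k = {0, magnetization \<beta> k, - magnetization \<beta> k}) \<and>
     (\<forall>K>k. magnetization \<beta> K > 0 \<and>
        M_set \<beta> K = {magnetization \<beta> K, - magnetization \<beta> K})"

text \<open>Only the values for \<open>\<beta> \<ge> beta_c\<close> are meaningful.\<close>
definition K1_curve :: "real \<Rightarrow> real" where
  "K1_curve \<beta> =
     (if \<beta> = beta_c then K_curve beta_c else (THE k. first_order_point \<beta> k))"

text \<open>The derivatives of \<open>K1_curve\<close> are taken within \<open>[beta_c, \<infinity>)\<close>: they are right-hand
  derivatives at \<open>beta_c\<close> and ordinary derivatives to the right of it.\<close>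
definition K1_deriv :: "nat \<Rightarrow> real \<Rightarrow> real" where
  "K1_deriv j = ((\<lambda>f x. vector_derivative f (at x within {beta_c..})) ^^ j) K1_curve"

text \<open>For the second and third derivatives at \<open>beta_c\<close> to make sense, the
  lower-order ones have to exist on a right neighbourhood of \<open>beta_c\<close>.\<close>
definition K1_three_right_derivs :: bool where
  "K1_three_right_derivs \<longleftrightarrow>
     (\<exists>\<epsilon>>0. \<forall>\<beta>\<in>{beta_c..<beta_c + \<epsilon>}.
        K1_deriv 0 differentiable (at \<beta> within {beta_c..}) \<and>
        K1_deriv 1 differentiable (at \<beta> within {beta_c..})) \<and>
     K1_deriv 2 differentiable (at beta_c within {beta_c..})"

definition l_c :: real where
  "l_c = (deriv ^^ 2) K_curve beta_c - 5 / (4 * beta_c)"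

definition conjecture1 :: bool where
  "conjecture1 \<longleftrightarrow> K1_deriv 1 beta_c = deriv K_curve beta_c"

definition conjecture2 :: bool where
  "conjecture2 \<longleftrightarrow>
     K1_deriv 2 beta_c = l_c \<and> l_c < 0 \<and> 0 < (deriv ^^ 2) K_curve beta_c"

section \<open>The sequences and the limiting polynomials\<close>

definition beta_seq :: "real \<Rightarrow> nat \<Rightarrow> real" where
  "beta_seq \<alpha> n = beta_c + 1 / real n powr \<alpha>"

definition K_seq :: "real \<Rightarrow> real \<Rightarrow> real \<Rightarrow> nat \<Rightarrow> real" where
  "K_seq l lt \<alpha> n =
     K_curve beta_c + deriv K_curve beta_c / real n powr \<alpha>
       + l / (2 * real n powr (2 * \<alpha>)) + lt / (6 * real n powr (3 * \<alpha>))"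

definition case_a :: "real \<Rightarrow> real \<Rightarrow> bool" where
  "case_a l lt \<longleftrightarrow> l > (deriv ^^ 2) K_curve beta_c"

definition case_b :: "real \<Rightarrow> real \<Rightarrow> bool" where
  "case_b l lt \<longleftrightarrow> l = (deriv ^^ 2) K_curve beta_c \<and> lt > (deriv ^^ 3) K_curve beta_c"

definition case_c :: "real \<Rightarrow> real \<Rightarrow> bool" where
  "case_c l lt \<longleftrightarrow> (deriv ^^ 2) K_curve beta_c > l \<and> l > l_c"

definition case_d :: "real \<Rightarrow> real \<Rightarrow> bool" where
  "case_d l lt \<longleftrightarrow> l = l_c \<and> lt > K1_deriv 3 beta_c"

definition c4 :: real where "c4 = 3 / 16"

definition c6 :: real where "c6 = 9 / 40"

definition g_poly :: "real \<Rightarrow> real \<Rightarrow> real" where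
  "g_poly l x =
     1/2 * beta_c * ((deriv ^^ 2) K_curve beta_c - l) * x\<^sup>2 - 4 * c4 * x ^ 4 + c6 * x ^ 6"

definition gt_poly :: "real \<Rightarrow> real" where
  "gt_poly x = c6 * x ^ 6"

definition xbar :: "real \<Rightarrow> real" where
  "xbar l = (THE x. x > 0 \<and> x \<in> global_min_points (g_poly l))"

definition ybar :: real where
  "ybar = (LINT x|lborel. \<bar>x\<bar> * exp (- gt_poly x)) / (LINT x|lborel. exp (- gt_poly x))"

definition zbar :: "real \<Rightarrow> real" where
  "zbar l = (LINT x|lborel. \<bar>x\<bar> * exp (- g_poly l x)) / (LINT x|lborel. exp (- g_poly l x))"

end

theory Submission
  imports Defs
begin

text \<open>Let \<open>v = spin_var \<beta>\<close> be the variance of one spin at \<open>K = 0\<close> and \<open>cgf v t = ln (1 + v * (cosh t - 1))\<close> its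
cumulant generating function. Then \<open>G(x) = \<beta> K x^2 - cgf v (2 \<beta> K x)\<close>. At the tricritical point \<open>v = 1/3\<close> and
\<open>2 \<beta> K = 3\<close>, so that the coefficients of \<open>x^2\<close> and \<open>x^4\<close> in the expansion of \<open>G\<close> at \<open>0\<close> vanish and that of
\<open>x^6\<close> equals \<open>9/40\<close>. On the path \<open>\<beta> = beta_c + h\<close>, \<open>K = K_path l lt h\<close> the first of these coefficients is of
order \<open>h^2\<close> (the path is tangent to the curve \<open>K_curve\<close>) and the second is about \<open>- 3/4 * h\<close>. Hence, whenever
\<open>s \<rightarrow> \<infinity>\<close> and \<open>s^2 h \<rightarrow> \<tau>\<close>, the rescaled functional \<open>s^6 * G(y / s)\<close> converges to the even sextic polynomial
\<open>limit_poly l \<tau>\<close>, which is \<open>g_poly l\<close> for \<open>\<tau> = 1\<close> and \<open>gt_poly\<close> for \<open>\<tau> = 0\<close>. The convergence is uniform on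
bounded sets (\<open>Phi_uniform\<close>), and a bound \<open>y^2 - C\<close> from below holds on the whole line, uniformly in \<open>n\<close>
(\<open>Phi_lower_bound\<close>); the limits below rest on these two facts.

The magnetization. The equation \<open>G'' = 0\<close> is quadratic in the hyperbolic cosine, so Rolle's theorem leaves room for
at most one positive minimum point (\<open>positive_minimum_unique\<close>). For \<open>s = h^(-1/2)\<close>, rescaled minimum points are
bounded and asymptotically minimize \<open>g_poly l\<close>. This polynomial satisfies
\<open>g(x) - g(xbar) = 9/40 * (x^2 - xbar^2)^2 * (x^2 - w)\<close> with \<open>w \<le> 0\<close>, so they approach \<open>\<plusminus> xbar\<close> or, when \<open>w = 0\<close>,
possibly \<open>0\<close>. If \<open>w < 0\<close> then \<open>g(xbar) < 0\<close>, and \<open>G\<close> takes negative values. The value \<open>w = 0\<close> occurs on the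
boundary \<open>l = l_c\<close> only: there a Taylor expansion of third order shows that the path lies above the first-order
curve, so \<open>G\<close> again takes negative values, while it is nonnegative near \<open>0\<close>, which keeps the minimum points away from
\<open>0\<close> (\<open>magnetization_limit\<close>).

The finite-size expectation. Adding an independent centred Gaussian variable of variance \<open>1 / (2 \<beta> K n)\<close> to
\<open>spin_sum n \<omega> / n\<close> produces the density proportional to \<open>exp (- n * G x)\<close>. The Gaussian variable is of size
\<open>n^(-1/2)\<close>, negligible at every scale in question (\<open>BC_expectation_abs_approx\<close>). The substitution \<open>x = y / s\<close> turns
\<open>n * G\<close> into \<open>(n / s^6) * Phi\<close>. For \<open>\<alpha> < 1/3\<close> and \<open>s = n^(\<alpha>/2)\<close> the factor \<open>n / s^6\<close> diverges and the mass
concentrates at \<open>\<plusminus> xbar\<close> (\<open>laplace_concentration\<close>). For \<open>\<alpha> \<ge> 1/3\<close> and \<open>s = n^(1/6)\<close> it equals \<open>1\<close>, and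
dominated convergence gives the quotients \<open>zbar\<close> (\<open>\<tau> = 1\<close>, \<open>\<alpha> = 1/3\<close>) and \<open>ybar\<close> (\<open>\<tau> = 0\<close>, \<open>\<alpha> > 1/3\<close>).\<close>

section \<open>The single-spin cumulant generating function\<close>

text \<open>The variance of a spin with weights proportional to \<open>1, exp (- \<beta>), exp (- \<beta>)\<close> on \<open>0, 1, -1\<close>. It is the natural
parameter because \<open>c_fun\<close> depends on \<open>\<beta>\<close> through it alone, and it decreases in \<open>\<beta>\<close> through the critical value
\<open>1 / 3\<close>.\<close>
definition spin_var :: "real \<Rightarrow> real" where
  "spin_var \<beta> = 2 / (exp \<beta> + 2)"

definition cgf :: "real \<Rightarrow> real \<Rightarrow> real" where
  "cgf v t = ln (1 + v * (cosh t - 1))"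

lemma spin_var_pos: "0 < spin_var \<beta>"
  unfolding spin_var_def by (intro divide_pos_pos add_pos_pos) auto

lemma spin_var_less_1: "spin_var \<beta> < 1"
  unfolding spin_var_def by (simp add: add_pos_pos)

lemma exp_beta_c [simp]: "exp beta_c = 4"
  by (simp add: beta_c_def)

lemma beta_c_pos: "beta_c > 0"
  by (simp add: beta_c_def)

lemma spin_var_less_third: "beta_c < \<beta> \<Longrightarrow> spin_var \<beta> < 1 / 3"
proof -
  assume "beta_c < \<beta>"
  then have "4 < exp \<beta>" using exp_less_cancel_iff[of beta_c \<beta>] by simp
  then show ?thesis by (simp add: spin_var_def field_simps)
qed

lemma cgf_arg_pos: "0 \<le> v \<Longrightarrow> 0 < 1 + v * (cosh t - 1)" for v t :: real
  using cosh_real_ge_1[of t] by (simp add: add_pos_nonneg)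

lemma c_fun_eq_cgf: "c_fun \<beta> t = cgf (spin_var \<beta>) t"
proof -
  define p where "p = exp (- \<beta>)"
  have p: "p > 0" by (simp add: p_def)
  have v: "spin_var \<beta> = 2 * p / (1 + 2 * p)"
    using p by (simp add: spin_var_def p_def exp_minus field_simps)
  have "(1 + p * (2 * cosh t)) / (1 + 2 * p) = 1 + 2 * p / (1 + 2 * p) * (cosh t - 1)"
    using p by (simp add: field_simps)
  moreover have "exp t + exp (- t) = 2 * cosh t" by (simp add: cosh_def)
  ultimately show ?thesis unfolding c_fun_def cgf_def v by (simp flip: p_def)
qed

lemma G_fun_eq: "G_fun \<beta> K x = \<beta> * K * x\<^sup>2 - cgf (spin_var \<beta>) (2 * \<beta> * K * x)"
  by (simp add: G_fun_def c_fun_eq_cgf)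

lemma cgf_0 [simp]: "cgf v 0 = 0" by (simp add: cgf_def)

lemma cgf_minus [simp]: "cgf v (- t) = cgf v t" by (simp add: cgf_def)

lemma cgf_abs [simp]: "cgf v \<bar>t\<bar> = cgf v t" by (simp add: abs_if)

lemma G_fun_0 [simp]: "G_fun \<beta> K 0 = 0" by (simp add: G_fun_eq)

lemma G_fun_minus [simp]: "G_fun \<beta> K (- x) = G_fun \<beta> K x" by (simp add: G_fun_eq)

lemma cgf_mono: 
  assumes "0 \<le> v" "v \<le> w"
  shows "cgf v t \<le> cgf w t"
  unfolding cgf_def using assms cgf_arg_pos[of v t] cgf_arg_pos[of w t] cosh_real_ge_1[of t]
  by (subst ln_le_cancel_iff) (auto intro!: mult_right_mono)

text \<open>By monotonicity in the variance it suffices to look at \<open>v = 1\<close>, the symmetric two-valued spin, where the claim is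
\<open>cosh t \<le> exp \<bar>t\<bar>\<close>. This linear growth is what makes \<open>G_fun\<close> coercive.\<close>
lemma cgf_le_abs:
  assumes "0 \<le> v" "v \<le> 1"
  shows "cgf v t \<le> \<bar>t\<bar>"
proof -
  have "cgf v t \<le> cgf 1 t" using assms by (rule cgf_mono)
  also have "\<dots> = ln (cosh t)" by (simp add: cgf_def)
  also have "\<dots> \<le> ln (exp \<bar>t\<bar>)"
    using cosh_real_pos[of t] by (subst ln_le_cancel_iff) (auto simp: cosh_def abs_if)
  finally show ?thesis by simp
qed

lemma cgf_DERIV [derivative_intros]:
  assumes "0 \<le> v" "(f has_real_derivative f') (at x within S)"
  shows "((\<lambda>x. cgf v (f x)) has_real_derivative
           (v * sinh (f x) / (1 + v * (cosh (f x) - 1))) * f') (at x within S)"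
  unfolding cgf_def using cgf_arg_pos[OF assms(1), of "f x"]
  by (auto intro!: derivative_eq_intros assms(2))

lemma continuous_on_cgf [continuous_intros]:
  assumes "0 \<le> v" "continuous_on S f"
  shows "continuous_on S (\<lambda>x. cgf v (f x))"
  unfolding cgf_def using cgf_arg_pos[OF assms(1)]
  by (intro continuous_intros assms(2)) (metis less_irrefl)

lemma continuous_on_G_fun [continuous_intros]:
  "continuous_on S f \<Longrightarrow> continuous_on S (\<lambda>x. G_fun \<beta> K (f x))"
  unfolding G_fun_eq using spin_var_pos[of \<beta>] by (intro continuous_intros) auto

section \<open>Sixth-order expansion of the cumulant generating function\<close>

lemma cosh_taylor6:
  fixes t :: real
  assumes "\<bar>t\<bar> \<le> 1"
  shows "\<bar>cosh t - 1 - (t\<^sup>2 / 2 + t ^ 4 / 24 + t ^ 6 / 720)\<bar> \<le> t ^ 8 / 1000"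
proof -
  obtain a where a: "\<bar>a\<bar> \<le> \<bar>t\<bar>" "exp t = (\<Sum>m<8. t ^ m / fact m) + exp a / fact 8 * t ^ 8"
    using Maclaurin_exp_le by blast
  obtain b where b: "\<bar>b\<bar> \<le> \<bar>-t\<bar>" "exp (-t) = (\<Sum>m<8. (-t) ^ m / fact m) + exp b / fact 8 * (-t) ^ 8"
    using Maclaurin_exp_le by blast
  have "exp a \<le> 3" "exp b \<le> 3"
    using a b assms exp_le by (auto intro: order_trans[OF _ exp_le] simp del: exp_le)
  then have "0 \<le> (exp a + exp b) / 80640" "(exp a + exp b) / 80640 \<le> 1 / 1000"
    by (auto intro: add_nonneg_nonneg)
  moreover have "cosh t - 1 - (t\<^sup>2 / 2 + t ^ 4 / 24 + t ^ 6 / 720) = (exp a + exp b) / 80640 * t ^ 8"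
    unfolding cosh_def a(2) b(2) by (simp add: eval_nat_numeral fact_numeral field_simps)
  moreover have "0 \<le> t ^ 8" by simp
  ultimately show ?thesis
    using mult_right_mono[of "(exp a + exp b) / 80640" "1 / 1000" "t ^ 8"] by (simp only: abs_mult) simp
qed

lemma ln_one_plus_bounds:
  fixes z :: real
  assumes "0 \<le> z"
  shows "ln (1 + z) \<le> z - z\<^sup>2 / 2 + z ^ 3 / 3"
    and "z - z\<^sup>2 / 2 + z ^ 3 / 3 - z ^ 4 / 4 \<le> ln (1 + z)"
proof -
  have "(\<lambda>z. z - z\<^sup>2 / 2 + z ^ 3 / 3 - ln (1 + z)) 0 \<le> (\<lambda>z. z - z\<^sup>2 / 2 + z ^ 3 / 3 - ln (1 + z)) z"
  proof (rule DERIV_nonneg_imp_nondecreasing[OF assms], intro exI conjI)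
    fix x :: real assume x: "0 \<le> x"
    show "((\<lambda>z. z - z\<^sup>2 / 2 + z ^ 3 / 3 - ln (1 + z)) has_real_derivative x ^ 3 / (1 + x)) (at x)"
      using x by (auto intro!: derivative_eq_intros simp: field_simps eval_nat_numeral)
  qed auto
  then show "ln (1 + z) \<le> z - z\<^sup>2 / 2 + z ^ 3 / 3" by simp
  have "(\<lambda>z. ln (1 + z) - (z - z\<^sup>2 / 2 + z ^ 3 / 3 - z ^ 4 / 4)) 0 \<le> (\<lambda>z. ln (1 + z) - (z - z\<^sup>2 / 2 + z ^ 3 / 3 - z ^ 4 / 4)) z"
  proof (rule DERIV_nonneg_imp_nondecreasing[OF assms], intro exI conjI)
    fix x :: real assume x: "0 \<le> x"
    show "((\<lambda>z. ln (1 + z) - (z - z\<^sup>2 / 2 + z ^ 3 / 3 - z ^ 4 / 4)) has_real_derivative x ^ 4 / (1 + x)) (at x)"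
      using x by (auto intro!: derivative_eq_intros simp: field_simps eval_nat_numeral)
  qed auto
  then show "z - z\<^sup>2 / 2 + z ^ 3 / 3 - z ^ 4 / 4 \<le> ln (1 + z)" by simp
qed

text \<open>The coefficients are the cumulants of order 2, 4 and 6 divided by the factorials. The point is that the constant in the
remainder is uniform in \<open>v\<close>: later \<open>v\<close> moves with \<open>n\<close>. Insert the expansion of \<open>cosh t - 1\<close> into that of the
logarithm and collect the terms of order at least \<open>t ^ 8\<close>.\<close>
lemma cgf_taylor6:
  assumes v: "0 \<le> v" "v \<le> 1" and t: "\<bar>t\<bar> \<le> 1"
  shows "\<bar>cgf v t - (v * t\<^sup>2 / 2 + (v - 3 * v\<^sup>2) * t ^ 4 / 24
            + (v - 15 * v\<^sup>2 + 30 * v ^ 3) * t ^ 6 / 720)\<bar> \<le> 10 * t ^ 8"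
proof -
  define T where "T = t\<^sup>2"
  define u where "u = cosh t - 1"
  define e where "e = u - (T / 2 + T\<^sup>2 / 24 + T ^ 3 / 720)"
  have T: "0 \<le> T" "T \<le> 1" using t by (auto simp: T_def abs_square_le_1)
  have pw: "t ^ 4 = T\<^sup>2" "t ^ 6 = T ^ 3" "t ^ 8 = T ^ 4" by (simp_all add: T_def flip: power_mult)
  have e: "\<bar>e\<bar> \<le> T ^ 4 / 1000"
    using cosh_taylor6[OF t] by (simp add: e_def u_def pw flip: T_def)
  have pT: "T ^ 2 \<le> T" "T ^ 3 \<le> T" "T ^ 4 \<le> T ^ 3" "T ^ 4 \<le> T\<^sup>2" "T ^ 4 \<le> T" "T ^ 3 \<le> T\<^sup>2"
    using T power_decreasing[of 1 2 T] power_decreasing[of 1 3 T] power_decreasing[of 3 4 T]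
      power_decreasing[of 2 4 T] power_decreasing[of 1 4 T] power_decreasing[of 2 3 T] by simp_all
  have pT0: "0 \<le> T\<^sup>2" "0 \<le> T ^ 3" "0 \<le> T ^ 4" using T by auto
  have u0: "0 \<le> u" using cosh_real_ge_1[of t] by (simp add: u_def)
  have uT: "u \<le> T" using e pT pT0 T unfolding e_def abs_le_iff by linarith
  have k: "\<bar>u - T / 2\<bar> \<le> T\<^sup>2 / 20" using e pT pT0 T unfolding e_def abs_le_iff by linarith
  have k2: "\<bar>u - T / 2 - T\<^sup>2 / 24\<bar> \<le> T ^ 3 / 300" using e pT pT0 T unfolding e_def abs_le_iff by linarith
  have u2: "\<bar>u\<^sup>2 - (T\<^sup>2 / 4 + T ^ 3 / 24)\<bar> \<le> T ^ 4"
  proof -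
    have "u\<^sup>2 - (T\<^sup>2 / 4 + T ^ 3 / 24) = (u - T / 2 - T\<^sup>2 / 24) * T + (u - T / 2)\<^sup>2"
      by (simp add: field_simps power2_eq_square power3_eq_cube)
    moreover have "\<bar>(u - T / 2 - T\<^sup>2 / 24) * T\<bar> \<le> T ^ 3 / 300 * T"
      unfolding abs_mult using k2 T by (intro mult_mono) auto
    moreover have "(u - T / 2)\<^sup>2 \<le> (T\<^sup>2 / 20)\<^sup>2"
      using k by (simp add: abs_le_square_iff[symmetric])
    ultimately show ?thesis using zero_le_power2[of "u - T/2"] pT0
      unfolding abs_le_iff by (simp add: power_divide eval_nat_numeral field_simps)
  qed
  have u3: "\<bar>u ^ 3 - T ^ 3 / 8\<bar> \<le> T ^ 4"
  proof -
    have "u ^ 3 - T ^ 3 / 8 = (u - T / 2) * (u\<^sup>2 + u * (T / 2) + T\<^sup>2 / 4)"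
      by (simp add: field_simps power2_eq_square power3_eq_cube)
    moreover have "\<bar>\<dots>\<bar> \<le> T\<^sup>2 / 20 * (T\<^sup>2 + T * (T / 2) + T\<^sup>2 / 4)"
      unfolding abs_mult
    proof (intro mult_mono k)
      have "u\<^sup>2 \<le> T\<^sup>2" "u * (T / 2) \<le> T * (T / 2)" "0 \<le> u * (T / 2)"
        using u0 uT T by (auto intro: power_mono mult_right_mono)
      then show "\<bar>u\<^sup>2 + u * (T / 2) + T\<^sup>2 / 4\<bar> \<le> T\<^sup>2 + T * (T / 2) + T\<^sup>2 / 4"
        by (simp add: abs_of_nonneg)
    qed auto
    moreover have "T\<^sup>2 / 20 * (T\<^sup>2 + T * (T / 2) + T\<^sup>2 / 4) \<le> T ^ 4"
      using pT0 by (simp add: power2_eq_square eval_nat_numeral field_simps)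
    ultimately show ?thesis by linarith
  qed
  have u4: "u ^ 4 \<le> T ^ 4" using u0 uT by (intro power_mono)
  have vp: "0 \<le> v\<^sup>2" "v\<^sup>2 \<le> 1" "0 \<le> v ^ 3" "v ^ 3 \<le> 1" "0 \<le> v ^ 4" "v ^ 4 \<le> 1"
    using v by (auto intro: power_le_one)
  define L where "L = cgf v t"
  define z where "z = v * u"
  have "L \<le> z - z\<^sup>2 / 2 + z ^ 3 / 3" "z - z\<^sup>2 / 2 + z ^ 3 / 3 - z ^ 4 / 4 \<le> L"
    using ln_one_plus_bounds[of z] v u0 by (auto simp: L_def cgf_def z_def u_def)
  moreover have "0 \<le> z ^ 4" "z ^ 4 \<le> T ^ 4"
    using u4 vp u0 v mult_mono[of "v ^ 4" 1 "u ^ 4" "T ^ 4"] pT0 by (auto simp: z_def power_mult_distrib)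
  ultimately have L: "\<bar>L - (v * u - v\<^sup>2 * u\<^sup>2 / 2 + v ^ 3 * u ^ 3 / 3)\<bar> \<le> T ^ 4 / 4"
    unfolding z_def power_mult_distrib by linarith
  have A: "\<bar>v * e\<bar> \<le> T ^ 4 / 1000" 
    using mult_mono[of "\<bar>v\<bar>" 1 "\<bar>e\<bar>" "T ^ 4 / 1000"] e v by (simp add: abs_mult)
  have B: "\<bar>v\<^sup>2 * (u\<^sup>2 - (T\<^sup>2 / 4 + T ^ 3 / 24))\<bar> \<le> T ^ 4"
    using mult_mono[of "v\<^sup>2" 1 "\<bar>u\<^sup>2 - (T\<^sup>2 / 4 + T ^ 3 / 24)\<bar>" "T ^ 4"] u2 vp by (simp add: abs_mult)
  have C: "\<bar>v ^ 3 * (u ^ 3 - T ^ 3 / 8)\<bar> \<le> T ^ 4"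
    using mult_mono[of "v ^ 3" 1 "\<bar>u ^ 3 - T ^ 3 / 8\<bar>" "T ^ 4"] u3 vp v by (simp add: abs_mult)
  have "L - (v * T / 2 + (v - 3 * v\<^sup>2) * T\<^sup>2 / 24 + (v - 15 * v\<^sup>2 + 30 * v ^ 3) * T ^ 3 / 720)
     = (L - (v * u - v\<^sup>2 * u\<^sup>2 / 2 + v ^ 3 * u ^ 3 / 3)) + v * e
        - v\<^sup>2 * (u\<^sup>2 - (T\<^sup>2 / 4 + T ^ 3 / 24)) / 2 + v ^ 3 * (u ^ 3 - T ^ 3 / 8) / 3"
    unfolding e_def by (simp add: field_simps)
  then have "\<bar>L - (v * T / 2 + (v - 3 * v\<^sup>2) * T\<^sup>2 / 24 + (v - 15 * v\<^sup>2 + 30 * v ^ 3) * T ^ 3 / 720)\<bar>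
     \<le> 10 * T ^ 4"
    using L A B C pT0 unfolding abs_le_iff by linarith
  then show ?thesis by (simp add: pw L_def flip: T_def)
qed

section \<open>Uniqueness of the positive minimum point\<close>

lemma quadratic_three_roots:
  fixes p q r :: real
  assumes "p * x\<^sup>2 + q * x + r = 0" "p * y\<^sup>2 + q * y + r = 0" "p * z\<^sup>2 + q * z + r = 0"
    and "x \<noteq> y" "y \<noteq> z" "x \<noteq> z"
  shows "p = 0"
proof -
  have "(x - y) * (p * (x + y) + q) = 0" "(y - z) * (p * (y + z) + q) = 0"
    using assms(1-3) by (simp_all add: algebra_simps power2_eq_square)
  then have "p * (x + y) + q = 0" "p * (y + z) + q = 0" using assms by auto
  then have "(p * (x + y) + q) - (p * (y + z) + q) = 0" by simp
  then have "p * (x - z) = 0" by (simp add: algebra_simps)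
  then show ?thesis using assms by simp
qed

lemma M_set_uminus: "- x \<in> M_set \<beta> K \<longleftrightarrow> x \<in> M_set \<beta> K"
  by (simp add: M_set_def global_min_points_def)

text \<open>With two positive minimum points, Rolle's theorem applied to \<open>G\<close> gives a further critical point between them, and applied
to \<open>G'\<close> on the three gaps between \<open>0\<close> and these points it gives three positive zeros of \<open>G''\<close>. Clearing
denominators in \<open>G'' = 0\<close> gives a quadratic equation for \<open>cosh (2 \<beta> K x)\<close>, which has at most two roots.\<close>
lemma positive_minimum_unique:
  assumes AK: "\<beta> > 0" "K > 0"
    and x: "x > 0" "x \<in> M_set \<beta> K" and y: "y > 0" "y \<in> M_set \<beta> K"
  shows "x = y"
proof (rule ccontr)
  define v where "v = spin_var \<beta>"
  define A where "A = 2 * \<beta> * K"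
  define D where "D = (\<lambda>x. A * x - v * sinh (A * x) / (1 + v * (cosh (A * x) - 1)) * A)"
  define D2 where "D2 = (\<lambda>x. A - A\<^sup>2 * (v * (1 - v) * cosh (A * x) + v\<^sup>2) / (1 + v * (cosh (A * x) - 1))\<^sup>2)"
  have v: "0 < v" using spin_var_pos by (simp add: v_def)
  have A: "0 < A" using AK by (simp add: A_def)
  have DG: "(G_fun \<beta> K has_real_derivative D x) (at x)" for x
    unfolding G_fun_eq[abs_def] v_def[symmetric] D_def A_def using v
    by (auto intro!: derivative_eq_intros)
  have DD: "(D has_real_derivative D2 x) (at x)" for x
  proof -
    have den: "1 + v * (cosh (A * x) - 1) > 0" using v by (intro cgf_arg_pos) auto
    have sq: "sinh (A * x) * sinh (A * x) = cosh (A * x) * cosh (A * x) - 1"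
      using sinh_square_eq[of "A * x"] by (simp add: power2_eq_square)
    have N: "((\<lambda>x. v * sinh (A * x)) has_real_derivative v * (cosh (A * x) * A)) (at x)"
      and E: "((\<lambda>x. 1 + v * (cosh (A * x) - 1)) has_real_derivative v * (sinh (A * x) * A)) (at x)"
      and L: "((\<lambda>x. A * x) has_real_derivative A) (at x)"
      by (auto intro!: derivative_eq_intros)
    have "(D has_real_derivative A - ((v * (cosh (A * x) * A)) * (1 + v * (cosh (A * x) - 1)) -
        v * sinh (A * x) * (v * (sinh (A * x) * A))) / ((1 + v * (cosh (A * x) - 1)) * (1 + v * (cosh (A * x) - 1))) * A) (at x)"
      unfolding D_def using den
      by (intro DERIV_diff[OF L] DERIV_cmult_right DERIV_divide[OF N E]) auto
    also have "A - ((v * (cosh (A * x) * A)) * (1 + v * (cosh (A * x) - 1)) -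
        v * sinh (A * x) * (v * (sinh (A * x) * A))) / ((1 + v * (cosh (A * x) - 1)) * (1 + v * (cosh (A * x) - 1))) * A = D2 x"
    proof -
      have "(v * (cosh (A * x) * A)) * (1 + v * (cosh (A * x) - 1)) - v * sinh (A * x) * (v * (sinh (A * x) * A))
          = A * (v * cosh (A * x) * (1 + v * (cosh (A * x) - 1)) - v * v * (sinh (A * x) * sinh (A * x)))"
        by (simp add: algebra_simps)
      also have "\<dots> = A * (v * (1 - v) * cosh (A * x) + v\<^sup>2)"
        unfolding sq by (simp add: algebra_simps power2_eq_square)
      finally show ?thesis unfolding D2_def by (simp add: power2_eq_square mult_ac)
    qed
    finally show ?thesis .
  qed
  have D_min: "D z = 0" if "z \<in> M_set \<beta> K" for z
    using that DERIV_local_min[OF DG[of z], of 1] by (auto simp: M_set_def global_min_points_def)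
  have cD: "continuous_on S D" "continuous_on S (G_fun \<beta> K)" for S
    using DERIV_isCont[OF DD] DERIV_isCont[OF DG] by (auto intro: continuous_at_imp_continuous_on)
  have rolleD: "\<exists>z. a < z \<and> z < b \<and> D2 z = 0" if "a < b" "D a = 0" "D b = 0" for a b
  proof -
    have "\<exists>z. a < z \<and> z < b \<and> (*) (D2 z) = (\<lambda>v. 0)"
      using that by (intro Rolle_deriv[OF _ _ cD(1)]) (auto intro: DD[unfolded has_field_derivative_def])
    then show ?thesis by (metis mult.right_neutral)
  qed
  have rolleG: "\<exists>z. a < z \<and> z < b \<and> D z = 0" if "a < b" "G_fun \<beta> K a = G_fun \<beta> K b" for a b
  proof -
    have "\<exists>z. a < z \<and> z < b \<and> (*) (D z) = (\<lambda>v. 0)"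
      using that by (intro Rolle_deriv[OF _ _ cD(2)]) (auto intro: DG[unfolded has_field_derivative_def])
    then show ?thesis by (metis mult.right_neutral)
  qed
  have *: False if ab: "0 < a" "a < b" "a \<in> M_set \<beta> K" "b \<in> M_set \<beta> K" for a b
  proof -
    have "G_fun \<beta> K a = G_fun \<beta> K b"
      using ab by (auto simp: M_set_def global_min_points_def intro: antisym)
    then obtain c where c: "a < c" "c < b" "D c = 0" using rolleG ab by blast
    have "D 0 = 0" by (simp add: D_def)
    then obtain z1 z2 z3 where z: "0 < z1" "z1 < a" "D2 z1 = 0" "a < z2" "z2 < c" "D2 z2 = 0"
       "c < z3" "z3 < b" "D2 z3 = 0"
      using rolleD[of 0 a] rolleD[of a c] rolleD[of c b] ab c D_min by blast
    have quad: "v\<^sup>2 * (cosh (A * z))\<^sup>2 + (2 * v * (1 - v) - A * v * (1 - v)) * cosh (A * z) + ((1 - v)\<^sup>2 - A * v\<^sup>2) = 0"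
      if "D2 z = 0" for z
    proof -
      define d where "d = 1 + v * (cosh (A * z) - 1)"
      have d: "d > 0" unfolding d_def using v by (intro cgf_arg_pos) auto
      define X where "X = v * (1 - v) * cosh (A * z) + v\<^sup>2"
      have "A - A\<^sup>2 * X / d\<^sup>2 = 0" using that by (simp add: D2_def d_def X_def)
      then have "A * (d\<^sup>2 - A * X) = 0" using d by (simp add: field_simps power2_eq_square)
      then have "d\<^sup>2 - A * X = 0" using A by simp
      then have "(1 + v * (cosh (A * z) - 1))\<^sup>2 = A * (v * (1 - v) * cosh (A * z) + v\<^sup>2)"
        by (simp add: d_def X_def)
      then show ?thesis by (simp add: algebra_simps power2_eq_square)
    qed
    have "cosh (A * z1) < cosh (A * z2)" "cosh (A * z2) < cosh (A * z3)"
      using z ab c A by (auto intro!: cosh_real_strict_mono)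
    then have "cosh (A * z1) \<noteq> cosh (A * z2)" "cosh (A * z2) \<noteq> cosh (A * z3)" "cosh (A * z1) \<noteq> cosh (A * z3)"
      by linarith+
    then have "v\<^sup>2 = 0"
      by (rule quadratic_three_roots[OF quad[OF z(3)] quad[OF z(6)] quad[OF z(9)]])
    then show False using v by simp
  qed
  assume "x \<noteq> y"
  then show False using *[of x y] *[of y x] x y by fastforce
qed

lemma G_fun_pos_far:
  assumes "\<beta> > 0" "K > 0" "\<bar>x\<bar> > 2"
  shows "G_fun \<beta> K x > 0"
proof -
  have "cgf (spin_var \<beta>) (2 * \<beta> * K * x) \<le> \<bar>2 * \<beta> * K * x\<bar>"
    using spin_var_pos[of \<beta>] spin_var_less_1[of \<beta>] by (intro cgf_le_abs) auto
  also have "\<dots> = \<beta> * K * (2 * \<bar>x\<bar>)" using assms by (simp add: abs_mult)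
  also have "\<dots> < \<beta> * K * (\<bar>x\<bar> * \<bar>x\<bar>)"
    using assms by (intro mult_strict_left_mono mult_strict_right_mono) auto
  finally show ?thesis by (simp add: G_fun_eq power2_eq_square)
qed

lemma M_set_nonempty:
  assumes "\<beta> > 0" "K > 0"
  shows "M_set \<beta> K \<noteq> {}"
proof -
  have "compact {-2..2::real}" "{-2..2::real} \<noteq> {}" "continuous_on {-2..2} (G_fun \<beta> K)"
    by (auto intro!: continuous_intros)
  from continuous_attains_inf[OF this] obtain x where
    x: "x \<in> {-2..2}" "\<forall>y\<in>{-2..2}. G_fun \<beta> K x \<le> G_fun \<beta> K y" by blast
  have "G_fun \<beta> K x \<le> G_fun \<beta> K y" for y
  proof (cases "y \<in> {-2..2}")
    case False
    then have "G_fun \<beta> K y > 0" by (intro G_fun_pos_far assms) auto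
    moreover have "G_fun \<beta> K x \<le> G_fun \<beta> K 0" using x(2) by (rule bspec) auto
    ultimately show ?thesis by simp
  qed (use x in auto)
  then show ?thesis by (auto simp: M_set_def global_min_points_def)
qed

lemma magnetization_eqI:
  assumes "\<beta> > 0" "K > 0" "x > 0" "x \<in> M_set \<beta> K"
  shows "magnetization \<beta> K = x"
  unfolding magnetization_def using assms positive_minimum_unique by (intro the_equality) auto

lemma M_set_subset:
  assumes "\<beta> > 0" "K > 0" "x > 0" "x \<in> M_set \<beta> K"
  shows "M_set \<beta> K \<subseteq> {0, x, - x}"
proof
  fix y assume y: "y \<in> M_set \<beta> K"
  then have "\<bar>y\<bar> \<in> M_set \<beta> K" using M_set_uminus[of y \<beta> K] by (cases "y \<ge> 0") auto
  then show "y \<in> {0, x, -x}" 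
    using positive_minimum_unique[OF assms, of "\<bar>y\<bar>"] by (cases "y = 0") auto
qed

text \<open>A negative value of \<open>G_fun\<close> excludes \<open>0\<close> as a minimum point, which is all that is needed to describe the set of
minimum points. This is the form in which the phase-coexistence region is reached below.\<close>
lemma M_set_of_negative_value:
  assumes \<beta>: "\<beta> > 0" and K: "K > 0" and neg: "G_fun \<beta> K z < 0"
  shows "magnetization \<beta> K > 0"
    and "M_set \<beta> K = {magnetization \<beta> K, - magnetization \<beta> K}"
    and "G_fun \<beta> K (magnetization \<beta> K) < 0"
    and "(\<beta>, K) \<in> phase_coexistence"
proof -
  obtain x where x: "x \<in> M_set \<beta> K" using M_set_nonempty[OF \<beta> K] by blast
  have nz: "0 \<notin> M_set \<beta> K"
    using neg by (auto simp: M_set_def global_min_points_def not_le intro!: exI[of _ z])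
  define m where "m = \<bar>x\<bar>"
  have m: "m > 0" "m \<in> M_set \<beta> K"
  proof -
    have "x \<noteq> 0" using x nz by auto
    then show "m > 0" by (simp add: m_def)
    show "m \<in> M_set \<beta> K" using x M_set_uminus[of x \<beta> K] by (simp add: m_def abs_if)
  qed
  have eq: "magnetization \<beta> K = m" using magnetization_eqI[OF \<beta> K m] .
  show "magnetization \<beta> K > 0" using m eq by simp
  show M: "M_set \<beta> K = {magnetization \<beta> K, - magnetization \<beta> K}"
    unfolding eq using M_set_subset[OF \<beta> K m] m(2) nz M_set_uminus[of m \<beta> K] by blast
  have "G_fun \<beta> K m \<le> G_fun \<beta> K z" using m by (auto simp: M_set_def global_min_points_def)
  then show "G_fun \<beta> K (magnetization \<beta> K) < 0" using neg eq by simp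
  show "(\<beta>, K) \<in> phase_coexistence"
  proof -
    have "m \<in> M_set \<beta> K" "- m \<in> M_set \<beta> K" "m \<noteq> - m" using m M_set_uminus[of m \<beta> K] by auto
    then show ?thesis using \<beta> K unfolding phase_coexistence_def by blast
  qed
qed

section \<open>Existence of the first-order curve\<close>

lemma cgf_pos: "0 < v \<Longrightarrow> t \<noteq> 0 \<Longrightarrow> 0 < cgf v t"
proof -
  assume "0 < v" "t \<noteq> 0"
  moreover have "cosh 0 < cosh \<bar>t\<bar>" using \<open>t \<noteq> 0\<close> by (intro cosh_real_strict_mono) auto
  ultimately show ?thesis unfolding cgf_def by (intro ln_gt_zero) (simp add: abs_if split: if_splits)
qed

text \<open>The quotient \<open>cgf v t / t ^ 2\<close> tends to \<open>v / 2\<close> at \<open>0\<close> and decays at infinity. For \<open>v < 1 / 3\<close> the fourth cumulant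
\<open>v - 3 * v ^ 2\<close> is positive, so the quotient exceeds \<open>v / 2\<close> near \<open>0\<close> and attains its maximum at some
\<open>t \<noteq> 0\<close>.\<close>
lemma cgf_quotient_attains_max:
  assumes v: "0 < v" "v < 1 / 3"
  shows "\<exists>t0>0. \<forall>t. cgf v t * t0\<^sup>2 \<le> cgf v t0 * t\<^sup>2"
proof -
  define r where "r = (\<lambda>t. cgf v t / t\<^sup>2)"
  define \<kappa> where "\<kappa> = (v - 3 * v\<^sup>2) / 24"
  have \<kappa>: "\<kappa> > 0" using v by (simp add: \<kappa>_def power2_eq_square)
  define \<mu> where "\<mu> = (v - 15 * v\<^sup>2 + 30 * v ^ 3) / 720"
  have tay: "\<bar>r t - (v / 2 + \<kappa> * t\<^sup>2 + \<mu> * t ^ 4)\<bar> \<le> 10 * t ^ 6" if "t \<noteq> 0" "\<bar>t\<bar> \<le> 1" for t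
  proof -
    have "\<bar>r t - (v / 2 + \<kappa> * t\<^sup>2 + \<mu> * t ^ 4)\<bar> = \<bar>cgf v t - (v * t\<^sup>2 / 2 + (v - 3 * v\<^sup>2) * t ^ 4 / 24
            + (v - 15 * v\<^sup>2 + 30 * v ^ 3) * t ^ 6 / 720)\<bar> / t\<^sup>2"
    proof -
      have "r t - (v / 2 + \<kappa> * t\<^sup>2 + \<mu> * t ^ 4) = (cgf v t - (v * t\<^sup>2 / 2 + (v - 3 * v\<^sup>2) * t ^ 4 / 24
            + (v - 15 * v\<^sup>2 + 30 * v ^ 3) * t ^ 6 / 720)) / t\<^sup>2"
      proof -
        have "t ^ 4 * t\<^sup>2 = t ^ 6" "t\<^sup>2 * t\<^sup>2 = t ^ 4"
          by (simp_all flip: power_add)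
        moreover have "cgf v t = r t * t\<^sup>2" using that(1) by (simp add: r_def)
        ultimately show ?thesis using that(1) unfolding \<kappa>_def \<mu>_def
          by (simp add: nonzero_eq_divide_eq left_diff_distrib distrib_right mult.assoc)
      qed
      then show ?thesis by simp
    qed
    also have "\<dots> \<le> 10 * t ^ 8 / t\<^sup>2"
      using v that by (intro divide_right_mono cgf_taylor6) auto
    also have "\<dots> = 10 * t ^ 6" using that by (simp add: field_simps eval_nat_numeral)
    finally show ?thesis .
  qed
  have lim: "(r \<longlongrightarrow> v / 2) (at 0)"
  proof -
    have "((\<lambda>t. r t - (v / 2 + \<kappa> * t\<^sup>2 + \<mu> * t ^ 4)) \<longlongrightarrow> 0) (at 0)"
    proof (rule Lim_null_comparison)
      show "\<forall>\<^sub>F t in at 0. norm (r t - (v / 2 + \<kappa> * t\<^sup>2 + \<mu> * t ^ 4)) \<le> 10 * t ^ 6"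
        unfolding eventually_at using tay by (intro exI[of _ 1]) auto
      show "((\<lambda>t::real. 10 * t ^ 6) \<longlongrightarrow> 0) (at 0)" by (auto intro!: tendsto_eq_intros)
    qed
    moreover have "((\<lambda>t. v / 2 + \<kappa> * t\<^sup>2 + \<mu> * t ^ 4) \<longlongrightarrow> v / 2) (at 0)"
      by (auto intro!: tendsto_eq_intros)
    ultimately show ?thesis using Lim_transform by blast
  qed
  have "\<exists>t. t > 0 \<and> r t > v / 2"
  proof -
    have "((\<lambda>t. \<kappa> + \<mu> * t\<^sup>2 - 10 * t ^ 4) \<longlongrightarrow> \<kappa>) (at_right 0)"
      by (auto intro!: tendsto_eq_intros)
    then have "\<forall>\<^sub>F t in at_right 0. 0 < \<kappa> + \<mu> * t\<^sup>2 - 10 * t ^ 4"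
      using \<kappa> by (rule order_tendstoD)
    moreover have "\<forall>\<^sub>F t in at_right (0::real). t > 0 \<and> t < 1"
      by (auto intro!: eventually_conj eventually_at_right_less simp: eventually_at_right[of 0 1] intro!: exI[of _ 1])
    ultimately have "\<forall>\<^sub>F t in at_right 0. (t > 0 \<and> t < 1) \<and> 0 < \<kappa> + \<mu> * t\<^sup>2 - 10 * t ^ 4"
      by eventually_elim auto
    then obtain t where t: "t > 0" "t < 1" "0 < \<kappa> + \<mu> * t\<^sup>2 - 10 * t ^ 4"
      using eventually_happens'[OF trivial_limit_at_right_real] by blast
    have "0 < t\<^sup>2 * (\<kappa> + \<mu> * t\<^sup>2 - 10 * t ^ 4)" using t by simp
    also have "\<dots> = \<kappa> * t\<^sup>2 + \<mu> * t ^ 4 - 10 * t ^ 6" by (simp add: algebra_simps eval_nat_numeral)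
    finally show ?thesis using t tay[of t] by (intro exI[of _ t]) auto
  qed
  then obtain s where s: "s > 0" "r s > v / 2" by blast
  \<comment> \<open>Beyond \<open>1 / r s\<close> the bound \<open>r t \<le> 1 / t\<close> keeps the quotient below \<open>r s\<close>.\<close>
  define T where "T = max s (1 / r s)"
  have rs: "r s > 0" using s v by simp
  define R where "R = (\<lambda>t. if t = 0 then v / 2 else r t)"
  have cont: "continuous_on {0..T} R"
    unfolding continuous_on_eq_continuous_within
  proof
    fix t assume "t \<in> {0..T}"
    have "isCont R t"
    proof (cases "t = 0")
      case True
      have "(R \<longlongrightarrow> v / 2) (at 0)"
        using lim by (rule Lim_transform_eventually) (auto simp: eventually_at R_def intro: exI[of _ 1])
      then show ?thesis using True by (simp add: isCont_def R_def)
    next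
      case False
      have "isCont r t"
      proof -
        have "isCont (cgf v) t" using continuous_on_cgf[of v UNIV "\<lambda>x. x"] v
          by (simp add: continuous_on_eq_continuous_at)
        then show ?thesis unfolding r_def using False by (intro continuous_intros) auto
      qed
      moreover have "\<forall>\<^sub>F x in nhds t. r x = R x"
        using t1_space_nhds[OF False] by eventually_elim (simp add: R_def)
      ultimately show ?thesis by (simp add: isCont_cong)
    qed
    then show "continuous (at t within {0..T}) R" by (rule continuous_at_imp_continuous_within)
  qed
  have "compact {0..T}" "{0..T} \<noteq> {}" using s by (auto simp: T_def)
  from continuous_attains_sup[OF this cont] obtain t0 where
    t0: "t0 \<in> {0..T}" "\<forall>t\<in>{0..T}. R t \<le> R t0" by blast
  have "s \<in> {0..T}" using s by (auto simp: T_def)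
  then have "R s \<le> R t0" using t0(2) by blast
  then have Rs: "r s \<le> R t0" using s by (simp add: R_def)
  then have "t0 \<noteq> 0" using s by (auto simp: R_def)
  then have t0p: "t0 > 0" using t0 by auto
  have "cgf v t * t0\<^sup>2 \<le> cgf v t0 * t\<^sup>2" for t
  proof (cases "t = 0")
    case False
    have "r \<bar>t\<bar> \<le> r t0"
    proof (cases "\<bar>t\<bar> \<le> T")
      case True
      then have "R \<bar>t\<bar> \<le> R t0" using t0(2) by simp
      then show ?thesis using False t0p by (simp add: R_def)
    next
      case False
      then have t: "\<bar>t\<bar> > 1 / r s" by (simp add: T_def)
      then have "\<bar>t\<bar> > 0" using rs by (meson less_trans zero_less_divide_1_iff)
      note t = t this
      have "r \<bar>t\<bar> \<le> \<bar>t\<bar> / t\<^sup>2"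
        unfolding r_def using cgf_le_abs[of v t] v by (auto intro!: divide_right_mono)
      also have "\<dots> = 1 / \<bar>t\<bar>" using t by (simp add: field_simps power2_eq_square flip: abs_mult)
      also have "\<dots> \<le> r s" using t rs by (simp add: field_simps)
      finally show ?thesis using Rs t0p by (simp add: R_def)
    qed
    then show ?thesis using False t0p by (simp add: r_def field_simps)
  qed simp
  with t0p show ?thesis by blast
qed

lemma G_fun_cgf_scaled:
  assumes "\<beta> > 0" "K > 0"
  shows "G_fun \<beta> K x = (2 * \<beta> * K * x)\<^sup>2 / (4 * \<beta> * K) - cgf (spin_var \<beta>) (2 * \<beta> * K * x)"
  using assms by (simp add: G_fun_eq power2_eq_square)

text \<open>In the variable \<open>t = 2 \<beta> K x\<close> the functional is \<open>t ^ 2 / (4 \<beta> K) - cgf v t\<close>. It is nonnegative iff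
\<open>1 / (4 \<beta> K)\<close> is at least the maximum of \<open>cgf v t / t ^ 2\<close>, and then it vanishes away from \<open>0\<close> only in the case of
equality. So the first-order point is the value of \<open>K\<close> that gives equality.\<close>
lemma first_order_point_exists:
  assumes "\<beta> > beta_c"
  shows "\<exists>k. first_order_point \<beta> k"
proof -
  define v where "v = spin_var \<beta>"
  have v: "0 < v" "v < 1 / 3" using spin_var_pos spin_var_less_third[OF assms] by (auto simp: v_def)
  have \<beta>: "\<beta> > 0" using assms beta_c_pos by linarith
  obtain t0 where t0: "t0 > 0" "\<And>t. cgf v t * t0\<^sup>2 \<le> cgf v t0 * t\<^sup>2"
    using cgf_quotient_attains_max[OF v] by blast
  have c0: "cgf v t0 > 0" using cgf_pos v t0 by auto
  define k where "k = t0\<^sup>2 / (4 * \<beta> * cgf v t0)"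
  have k: "k > 0" using c0 t0 \<beta> by (simp add: k_def)
  have key: "cgf v t \<le> t\<^sup>2 / (4 * \<beta> * k)" for t
    using t0(2)[of t] t0(1) c0 \<beta> by (simp add: k_def field_simps)
  have key0: "cgf v t0 = t0\<^sup>2 / (4 * \<beta> * k)"
    using t0(1) c0 \<beta> by (simp add: k_def field_simps)
  have below: "M_set \<beta> K = {0}" if K: "0 < K" "K < k" for K
  proof -
    have pos: "G_fun \<beta> K x > 0" if "x \<noteq> 0" for x
    proof -
      have "cgf v (2 * \<beta> * K * x) \<le> (2 * \<beta> * K * x)\<^sup>2 / (4 * \<beta> * k)" by (rule key)
      also have "\<dots> < (2 * \<beta> * K * x)\<^sup>2 / (4 * \<beta> * K)"
        using K that \<beta> by (intro divide_strict_left_mono) auto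
      finally show ?thesis using G_fun_cgf_scaled[OF \<beta> K(1)] by (simp add: v_def)
    qed
    show ?thesis
    proof (intro set_eqI iffI; clarsimp simp: M_set_def global_min_points_def)
      fix x assume "\<forall>y. G_fun \<beta> K x \<le> G_fun \<beta> K y"
      then have "G_fun \<beta> K x \<le> G_fun \<beta> K 0" by blast
      then show "x = 0" using pos[of x] by fastforce
    next
      fix y show "0 \<le> G_fun \<beta> K y" using pos[of y] by (cases "y = 0") auto
    qed
  qed
  have at: "magnetization \<beta> k > 0 \<and> M_set \<beta> k = {0, magnetization \<beta> k, - magnetization \<beta> k}"
  proof -
    define x where "x = t0 / (2 * \<beta> * k)"
    have x: "x > 0" "2 * \<beta> * k * x = t0" using t0 \<beta> k by (auto simp: x_def)
    have nn: "G_fun \<beta> k y \<ge> 0" for y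
      using G_fun_cgf_scaled[OF \<beta> k] key by (simp add: v_def)
    have "G_fun \<beta> k x = 0"
      using G_fun_cgf_scaled[OF \<beta> k, of x] key0 unfolding x(2) by (simp add: v_def)
    then have "x \<in> M_set \<beta> k" "0 \<in> M_set \<beta> k" using nn by (auto simp: M_set_def global_min_points_def)
    then show ?thesis
      using magnetization_eqI[OF \<beta> k x(1)] M_set_subset[OF \<beta> k x(1)] x(1) M_set_uminus[of x \<beta> k] by blast
  qed
  have above: "magnetization \<beta> K > 0 \<and> M_set \<beta> K = {magnetization \<beta> K, - magnetization \<beta> K}" if K: "K > k" for K
  proof -
    have K0: "K > 0" using K k by simp
    define x where "x = t0 / (2 * \<beta> * K)"
    have x: "x > 0" "2 * \<beta> * K * x = t0" using t0 \<beta> K0 by (auto simp: x_def)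
    have "t0\<^sup>2 / (4 * \<beta> * K) < t0\<^sup>2 / (4 * \<beta> * k)"
      using K k t0 \<beta> by (intro divide_strict_left_mono) auto
    then have "G_fun \<beta> K x < 0"
      using G_fun_cgf_scaled[OF \<beta> K0, of x] key0 unfolding x(2) by (simp add: v_def)
    then show ?thesis using M_set_of_negative_value[OF \<beta> K0] by blast
  qed
  show ?thesis unfolding first_order_point_def using k below at above by blast
qed

lemma first_order_point_unique:
  assumes "first_order_point \<beta> k" "first_order_point \<beta> k'"
  shows "k = k'"
proof -
  have "False" if "first_order_point \<beta> a" "first_order_point \<beta> b" "a < b" for a b
  proof -
    have "M_set \<beta> a = {0}" "magnetization \<beta> a \<in> M_set \<beta> a" "magnetization \<beta> a > 0"
      using that by (auto simp: first_order_point_def)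
    then show False by auto
  qed
  then show ?thesis using assms by (metis linorder_neqE)
qed

text \<open>Links the definite description in \<open>K1_curve\<close> to the sign criterion of \<open>M_set_of_negative_value\<close>.\<close>
lemma negative_value_above_K1:
  assumes "\<beta> > beta_c" "K > K1_curve \<beta>"
  shows "\<exists>z. G_fun \<beta> K z < 0" and "K > 0"
proof -
  obtain k where k: "first_order_point \<beta> k" using first_order_point_exists[OF assms(1)] by blast
  then have "K1_curve \<beta> = k"
    using assms(1) first_order_point_unique by (auto simp: K1_curve_def intro!: the_equality)
  then have Kk: "K > k" using assms by simp
  then show "K > 0" using k by (simp add: first_order_point_def)
  have "magnetization \<beta> K > 0" "M_set \<beta> K = {magnetization \<beta> K, - magnetization \<beta> K}"
    using k Kk by (auto simp: first_order_point_def)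
  then have "0 \<notin> M_set \<beta> K" by auto
  then show "\<exists>z. G_fun \<beta> K z < 0" by (auto simp: M_set_def global_min_points_def not_le)
qed

section \<open>The critical cumulant generating function lies strictly below its parabola\<close>

lemma pos_of_deriv_pos:
  fixes f :: "real \<Rightarrow> real"
  assumes "f 0 = 0" "0 < t" "\<And>x. 0 \<le> x \<Longrightarrow> (f has_real_derivative f' x) (at x)"
    and "\<And>x. 0 < x \<Longrightarrow> 0 < f' x"
  shows "0 < f t"
proof -
  have "f 0 < f t"
  proof (rule DERIV_pos_imp_increasing_open[OF assms(2)])
    show "continuous_on {0..t} f"
      using assms(3) by (intro continuous_at_imp_continuous_on ballI) (auto intro: DERIV_isCont)
  next
    fix x assume "0 < x" "x < t"
    then show "\<exists>y. (f has_real_derivative y) (at x) \<and> 0 < y"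
      using assms(3)[of x] assms(4)[of x] by (intro exI[of _ "f' x"]) simp
  qed
  then show ?thesis using assms by simp
qed

text \<open>Here \<open>1 / 3\<close> and \<open>t ^ 2 / 6\<close> belong to the tricritical point; \<open>third_gap\<close> is \<open>G_fun\<close> there, as a function of
\<open>t = 3 * x\<close>.\<close>
definition third_gap :: "real \<Rightarrow> real" where
  "third_gap t = t\<^sup>2 / 6 - cgf (1 / 3) t"

text \<open>The inequality \<open>3 * sinh t < t * (2 + cosh t)\<close>, obtained by integrating up from \<open>0 < x * sinh x\<close>.\<close>
lemma third_gap_DERIV_pos:
  fixes t :: real
  assumes "t > 0"
  shows "0 < t / 3 - sinh t / (2 + cosh t)"
proof -
  have h1: "0 < x * cosh x - sinh x" if "x > 0" for x :: real
    by (rule pos_of_deriv_pos[of "\<lambda>x. x * cosh x - sinh x", OF _ that, where f' = "\<lambda>x. x * sinh x"])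
       (auto intro!: derivative_eq_intros)
  have h2: "0 < 2 - 2 * cosh x + x * sinh x" if "x > 0" for x :: real
    by (rule pos_of_deriv_pos[of "\<lambda>x. 2 - 2 * cosh x + x * sinh x", OF _ that, where f' = "\<lambda>x. x * cosh x - sinh x"])
       (use h1 in \<open>auto intro!: derivative_eq_intros\<close>)
  have h3: "0 < x * (2 + cosh x) - 3 * sinh x" if "x > 0" for x :: real
    by (rule pos_of_deriv_pos[of "\<lambda>x. x * (2 + cosh x) - 3 * sinh x", OF _ that, where f' = "\<lambda>x. 2 - 2 * cosh x + x * sinh x"])
       (use h2 in \<open>auto intro!: derivative_eq_intros\<close>)
  have "2 + cosh t > 0" by (intro add_pos_pos) auto
  then show ?thesis using h3[OF assms] by (simp add: field_simps)
qed

lemma third_gap_DERIV: "(third_gap has_real_derivative (t / 3 - sinh t / (2 + cosh t))) (at t)"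
proof -
  have "2 + cosh t > 0" by (intro add_pos_pos) auto
  then have "1 / 3 * sinh t / (1 + 1 / 3 * (cosh t - 1)) = sinh t / (2 + cosh t)"
    by (simp add: field_simps)
  moreover have "(third_gap has_real_derivative (t / 3 - 1 / 3 * sinh t / (1 + 1 / 3 * (cosh t - 1)))) (at t)"
    unfolding third_gap_def[abs_def] by (auto intro!: derivative_eq_intros)
  ultimately show ?thesis by (simp only:)
qed

lemma third_gap_mono:
  assumes "0 < s" "s < t"
  shows "third_gap s < third_gap t"
proof (rule DERIV_pos_imp_increasing[OF assms(2)], intro exI conjI)
  fix x assume "s \<le> x"
  show "(third_gap has_real_derivative (x / 3 - sinh x / (2 + cosh x))) (at x)" by (rule third_gap_DERIV)
  show "0 < x / 3 - sinh x / (2 + cosh x)" using third_gap_DERIV_pos assms \<open>s \<le> x\<close> by auto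
qed

lemma third_gap_pos: "0 < t \<Longrightarrow> 0 < third_gap t"
  by (rule pos_of_deriv_pos[OF _ _ third_gap_DERIV third_gap_DERIV_pos]) (auto simp: third_gap_def)

text \<open>Away from the origin the Taylor expansion says nothing; this bound replaces it. For large \<open>t\<close> it holds by the linear
growth of \<open>cgf\<close>, in between by monotonicity; \<open>12\<close> is where \<open>t ^ 2 / 12\<close> overtakes \<open>\<bar>t\<bar>\<close>.\<close>
lemma third_gap_quadratic:
  assumes "\<delta> > 0"
  obtains c where "c > 0" "\<And>t. \<delta> \<le> \<bar>t\<bar> \<Longrightarrow> c * t\<^sup>2 \<le> third_gap t"
proof -
  define c where "c = min (1 / 12) (third_gap \<delta> / 144)"
  have g: "third_gap \<delta> > 0" using third_gap_pos assms by auto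
  have "c > 0" using g by (simp add: c_def)
  moreover have "c * t\<^sup>2 \<le> third_gap t" if "\<delta> \<le> \<bar>t\<bar>" for t
  proof (cases "\<bar>t\<bar> \<le> 12")
    case True
    have "t\<^sup>2 \<le> 12\<^sup>2" using True by (intro iffD1[OF abs_le_square_iff]) simp
    then have "c * t\<^sup>2 \<le> third_gap \<delta> / 144 * 144" 
      using g by (intro mult_mono) (auto simp: c_def)
    also have "\<dots> = third_gap \<delta>" by simp
    also have "\<dots> \<le> third_gap \<bar>t\<bar>"
      using third_gap_mono[of \<delta> "\<bar>t\<bar>"] assms that by (cases "\<delta> = \<bar>t\<bar>") auto
    finally show ?thesis by (simp add: third_gap_def)
  next
    case False
    have "c * t\<^sup>2 \<le> 1 / 12 * t\<^sup>2" by (intro mult_right_mono) (auto simp: c_def)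
    moreover have "12 * \<bar>t\<bar> \<le> \<bar>t\<bar> * \<bar>t\<bar>" using False by (intro mult_right_mono) auto
    moreover have "cgf (1 / 3) t \<le> \<bar>t\<bar>" by (rule cgf_le_abs) auto
    ultimately show ?thesis by (simp add: third_gap_def power2_eq_square)
  qed
  ultimately show ?thesis by (rule that)
qed

section \<open>One-sided Taylor expansion with Peano remainder\<close>

text \<open>The mean value theorem turns a small derivative into a small function; repeated use yields Taylor's formula when the last
derivative exists at the endpoint only.\<close>
lemma primitive_little_o:
  fixes \<phi> \<phi>' :: "real \<Rightarrow> real"
  assumes e: "\<epsilon> > 0"
    and D: "\<And>t. c \<le> t \<Longrightarrow> t < c + \<epsilon> \<Longrightarrow> (\<phi> has_real_derivative \<phi>' t) (at t within {c..})"
    and 0: "\<phi> c = 0"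
    and lim: "((\<lambda>t. \<phi>' t / (t - c) ^ k) \<longlongrightarrow> 0) (at_right c)"
  shows "((\<lambda>t. \<phi> t / (t - c) ^ Suc k) \<longlongrightarrow> 0) (at_right c)"
proof (rule tendstoI)
  fix r :: real assume r: "r > 0"
  have "\<forall>\<^sub>F t in at_right c. dist (\<phi>' t / (t - c) ^ k) 0 < r" using lim r by (rule tendstoD)
  then obtain b where b: "b > c" "\<And>t. c < t \<Longrightarrow> t < b \<Longrightarrow> dist (\<phi>' t / (t - c) ^ k) 0 < r"
    unfolding eventually_at_right_field by blast
  have "dist (\<phi> t / (t - c) ^ Suc k) 0 < r" if t: "c < t" "t < min b (c + \<epsilon>)" for t
  proof -
    have D': "(\<phi> has_real_derivative \<phi>' z) (at z)" if "c < z" "z < t" for z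
    proof -
      have "at z within {c..} = at z"
        using that by (intro at_within_open_subset[of z "{c<..}"]) auto
      then show ?thesis using D[of z] that t by simp
    qed
    have "continuous_on {c..t} \<phi>"
    proof (rule DERIV_continuous_on)
      fix x assume "x \<in> {c..t}"
      then show "(\<phi> has_real_derivative \<phi>' x) (at x within {c..t})"
        using t by (intro DERIV_subset[OF D]) auto
    qed
    moreover have "\<phi> differentiable (at x)" if "c < x" "x < t" for x
      using D'[OF that] by (auto simp: real_differentiable_def)
    ultimately obtain l z where z: "c < z" "z < t" "(\<phi> has_real_derivative l) (at z)" "\<phi> t - \<phi> c = (t - c) * l"
      using MVT[OF t(1), of \<phi>] by blast
    have l: "l = \<phi>' z" using DERIV_unique[OF z(3) D'] z by simp
    have "\<bar>\<phi>' z / (z - c) ^ k\<bar> < r" using b(2)[of z] z t by simp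
    then have "\<bar>\<phi>' z\<bar> < r * (z - c) ^ k" using z by (simp add: field_simps)
    also have "\<dots> \<le> r * (t - c) ^ k" using z r by (intro mult_left_mono power_mono) auto
    finally have "\<bar>\<phi>' z\<bar> < r * (t - c) ^ k" .
    then have "\<bar>\<phi>' z\<bar> / (t - c) ^ k < r" using t by (simp add: pos_divide_less_eq)
    moreover have "\<phi> t / (t - c) ^ Suc k = \<phi>' z / (t - c) ^ k" using z(4) t unfolding 0 l by simp
    ultimately show ?thesis using t by (simp add: abs_divide)
  qed
  then show "\<forall>\<^sub>F t in at_right c. dist (\<phi> t / (t - c) ^ Suc k) 0 < r"
    unfolding eventually_at_right_field using b e by (intro exI[of _ "min b (c + \<epsilon>)"]) auto
qed

lemma taylor_peano_2:
  fixes f f1 :: "real \<Rightarrow> real"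
  assumes e: "\<epsilon> > 0"
    and D: "\<And>t. c \<le> t \<Longrightarrow> t < c + \<epsilon> \<Longrightarrow> (f has_real_derivative f1 t) (at t within {c..})"
    and D1: "(f1 has_real_derivative d2) (at c within {c..})"
  shows "((\<lambda>t. (f t - f c - f1 c * (t - c) - d2 / 2 * (t - c)\<^sup>2) / (t - c)\<^sup>2) \<longlongrightarrow> 0) (at_right c)"
proof -
  have "((\<lambda>t. (f1 t - f1 c) / (t - c)) \<longlongrightarrow> d2) (at_right c)"
    using D1 unfolding has_field_derivative_iff by (rule tendsto_within_subset) auto
  then have "((\<lambda>t. (f1 t - f1 c) / (t - c) - d2) \<longlongrightarrow> d2 - d2) (at_right c)"
    by (intro tendsto_diff tendsto_const)
  moreover have "\<forall>\<^sub>F t in at_right c. (f1 t - f1 c) / (t - c) - d2 = (f1 t - f1 c - d2 * (t - c)) / (t - c) ^ 1"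
    unfolding eventually_at_right_field by (intro exI[of _ "c + 1"]) (auto simp: field_simps)
  ultimately have "((\<lambda>t. (f1 t - f1 c - d2 * (t - c)) / (t - c) ^ 1) \<longlongrightarrow> 0) (at_right c)"
    using Lim_transform_eventually by fastforce
  then have "((\<lambda>t. (f t - f c - f1 c * (t - c) - d2 / 2 * (t - c)\<^sup>2) / (t - c) ^ Suc 1) \<longlongrightarrow> 0) (at_right c)"
    by (intro primitive_little_o[OF e, where \<phi>' = "\<lambda>t. f1 t - f1 c - d2 * (t - c)"])
       (auto intro!: derivative_eq_intros D)
  then show ?thesis by (simp add: numeral_2_eq_2)
qed

lemma taylor_peano_3:
  fixes f f1 f2 :: "real \<Rightarrow> real"
  assumes e: "\<epsilon> > 0"
    and D: "\<And>t. c \<le> t \<Longrightarrow> t < c + \<epsilon> \<Longrightarrow> (f has_real_derivative f1 t) (at t within {c..})"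
    and D1: "\<And>t. c \<le> t \<Longrightarrow> t < c + \<epsilon> \<Longrightarrow> (f1 has_real_derivative f2 t) (at t within {c..})"
    and D2: "(f2 has_real_derivative d3) (at c within {c..})"
  shows "((\<lambda>t. (f t - f c - f1 c * (t - c) - f2 c / 2 * (t - c)\<^sup>2 - d3 / 6 * (t - c) ^ 3) / (t - c) ^ 3) \<longlongrightarrow> 0) (at_right c)"
proof -
  have "((\<lambda>t. (f t - f c - f1 c * (t - c) - f2 c / 2 * (t - c)\<^sup>2 - d3 / 6 * (t - c) ^ 3) / (t - c) ^ Suc 2) \<longlongrightarrow> 0) (at_right c)"
  proof (rule primitive_little_o[OF e])
    fix t assume t: "c \<le> t" "t < c + \<epsilon>"
    show "((\<lambda>t. f t - f c - f1 c * (t - c) - f2 c / 2 * (t - c)\<^sup>2 - d3 / 6 * (t - c) ^ 3) has_real_derivative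
       f1 t - f1 c - f2 c * (t - c) - d3 / 2 * (t - c)\<^sup>2) (at t within {c..})"
      by (auto intro!: derivative_eq_intros D t)
  qed (use taylor_peano_2[OF e D1 D2] in auto)
  then show ?thesis by (simp add: numeral_3_eq_3)
qed

section \<open>Expansions of the two curves at the tricritical point\<close>

definition K_curve' :: "real \<Rightarrow> real" where
  "K_curve' \<beta> = exp \<beta> / (4 * \<beta>) - (exp \<beta> + 2) / (4 * \<beta>\<^sup>2)"

lemma K_curve_DERIV: "\<beta> > 0 \<Longrightarrow> (K_curve has_real_derivative K_curve' \<beta>) (at \<beta>)"
  unfolding K_curve_def[abs_def] K_curve'_def
  by (auto intro!: derivative_eq_intros simp: field_simps power2_eq_square)

text \<open>\<open>deriv K_curve\<close> agrees with the explicit \<open>K_curve'\<close> near \<open>beta_c\<close>, hence is differentiable there, and then its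
derivative is the iterated one.\<close>
lemma deriv_K_curve_DERIV:
  "(deriv K_curve has_real_derivative (deriv ^^ 2) K_curve beta_c) (at beta_c)"
proof -
  have "K_curve' field_differentiable (at beta_c)"
    unfolding K_curve'_def[abs_def] field_differentiable_def using beta_c_pos
    by (intro exI) (rule derivative_eq_intros refl | simp)+
  then obtain d where d: "(K_curve' has_real_derivative d) (at beta_c)"
    by (auto simp: field_differentiable_def)
  have "(deriv K_curve has_real_derivative d) (at beta_c)"
    by (rule has_field_derivative_transform_within_open[OF d, of "{0<..}"])
       (auto simp: beta_c_pos DERIV_imp_deriv[OF K_curve_DERIV])
  then show ?thesis using DERIV_imp_deriv[of "deriv K_curve"] by (simp add: numeral_2_eq_2)
qed

lemma K_curve_taylor:
  "((\<lambda>h. (K_curve (beta_c + h) - K_curve beta_c - deriv K_curve beta_c * h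
       - (deriv ^^ 2) K_curve beta_c / 2 * h\<^sup>2) / h\<^sup>2) \<longlongrightarrow> 0) (at_right 0)"
proof -
  have "((\<lambda>t. (K_curve t - K_curve beta_c - deriv K_curve beta_c * (t - beta_c)
       - (deriv ^^ 2) K_curve beta_c / 2 * (t - beta_c)\<^sup>2) / (t - beta_c)\<^sup>2) \<longlongrightarrow> 0) (at_right beta_c)"
  proof (rule taylor_peano_2[of 1])
    fix t assume "beta_c \<le> t"
    then have "t > 0" using beta_c_pos by simp
    then show "(K_curve has_real_derivative deriv K_curve t) (at t within {beta_c..})"
      using K_curve_DERIV[of t] has_field_derivative_at_within
      by (simp add: DERIV_imp_deriv[OF K_curve_DERIV])
  qed (auto intro: has_field_derivative_at_within deriv_K_curve_DERIV)
  then show ?thesis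
    by (subst (asm) at_right_to_0) (simp add: filterlim_filtermap add.commute)
qed

text \<open>\<open>K1_deriv\<close> is defined by choice and carries information only where the derivatives exist, on a right neighbourhood of
\<open>beta_c\<close> for the first two and at \<open>beta_c\<close> for the third. This is exactly what the third-order Peano formula asks
for.\<close>
lemma K1_curve_taylor:
  assumes "K1_three_right_derivs"
  shows "((\<lambda>h. (K1_curve (beta_c + h) - K_curve beta_c - K1_deriv 1 beta_c * h
       - K1_deriv 2 beta_c / 2 * h\<^sup>2 - K1_deriv 3 beta_c / 6 * h ^ 3) / h ^ 3) \<longlongrightarrow> 0) (at_right 0)"
proof -
  have step: "(K1_deriv j has_real_derivative K1_deriv (Suc j) t) (at t within {beta_c..})"
    if "K1_deriv j differentiable (at t within {beta_c..})" for j t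
    using that unfolding has_real_derivative_iff_has_vector_derivative vector_derivative_works
    by (simp add: K1_deriv_def)
  obtain \<epsilon> where e: "\<epsilon> > 0" and d: "\<And>t. beta_c \<le> t \<Longrightarrow> t < beta_c + \<epsilon> \<Longrightarrow>
      K1_deriv 0 differentiable (at t within {beta_c..}) \<and> K1_deriv 1 differentiable (at t within {beta_c..})"
    and d2: "K1_deriv 2 differentiable (at beta_c within {beta_c..})"
    using assms unfolding K1_three_right_derivs_def by auto
  have "((\<lambda>t. (K1_deriv 0 t - K1_deriv 0 beta_c - K1_deriv 1 beta_c * (t - beta_c)
       - K1_deriv 2 beta_c / 2 * (t - beta_c)\<^sup>2 - K1_deriv 3 beta_c / 6 * (t - beta_c) ^ 3) / (t - beta_c) ^ 3) \<longlongrightarrow> 0) (at_right beta_c)"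
    using step[of 0] step[of 1] step[OF d2] d
    by (intro taylor_peano_3[OF e]) (auto simp: numeral_2_eq_2 numeral_3_eq_3)
  moreover have "K1_deriv 0 = K1_curve" "K1_curve beta_c = K_curve beta_c"
    by (simp_all add: K1_deriv_def K1_curve_def)
  ultimately show ?thesis
    by (subst (asm) at_right_to_0) (simp add: filterlim_filtermap add.commute)
qed

section \<open>Coefficients of the free-energy functional along the path\<close>

text \<open>\<open>K_seq\<close> as a function of \<open>h = \<beta> - beta_c\<close>, so that coefficients can be expanded as \<open>h\<close> tends to \<open>0\<close> from the
right.\<close>
definition K_path :: "real \<Rightarrow> real \<Rightarrow> real \<Rightarrow> real" where
  "K_path l lt h = K_curve beta_c + deriv K_curve beta_c * h + l / 2 * h\<^sup>2 + lt / 6 * h ^ 3"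

lemma K_seq_eq: "K_seq l lt \<alpha> n = K_path l lt (1 / real n powr \<alpha>)"
proof -
  have "real n powr (2 * \<alpha>) = (real n powr \<alpha>)\<^sup>2" "real n powr (3 * \<alpha>) = (real n powr \<alpha>) ^ 3"
    by (simp_all add: powr_powr mult.commute flip: powr_numeral)
  then show ?thesis by (simp add: K_seq_def K_path_def power_divide)
qed

definition path_var :: "real \<Rightarrow> real" where "path_var h = spin_var (beta_c + h)"

text \<open>The factor \<open>2 \<beta> K\<close> by which \<open>x\<close> is multiplied inside \<open>cgf\<close>.\<close>
definition path_slope :: "real \<Rightarrow> real \<Rightarrow> real \<Rightarrow> real" where
  "path_slope l lt h = 2 * (beta_c + h) * K_path l lt h"

lemma K_curve_beta_c: "2 * beta_c * K_curve beta_c = 3"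
  using beta_c_pos by (simp add: K_curve_def)

lemma path_limits:
  "(path_var \<longlongrightarrow> 1 / 3) (at_right 0)"
  "(path_slope l lt \<longlongrightarrow> 3) (at_right 0)"
  "(K_path l lt \<longlongrightarrow> K_curve beta_c) (at_right 0)"
proof -
  show "(path_var \<longlongrightarrow> 1 / 3) (at_right 0)"
    unfolding path_var_def[abs_def] spin_var_def by (auto intro!: tendsto_eq_intros)
  show "(K_path l lt \<longlongrightarrow> K_curve beta_c) (at_right 0)"
    unfolding K_path_def[abs_def] by (auto intro!: tendsto_eq_intros)
  then show "(path_slope l lt \<longlongrightarrow> 3) (at_right 0)"
    unfolding path_slope_def[abs_def] using K_curve_beta_c by (auto intro!: tendsto_eq_intros)
qed

definition quad_coeff :: "real \<Rightarrow> real" where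
  "quad_coeff l = 1 / 2 * beta_c * ((deriv ^^ 2) K_curve beta_c - l)"

text \<open>Since \<open>1 / (2 \<beta> spin_var \<beta>) = K_curve \<beta>\<close>, the coefficient of \<open>x ^ 2\<close> equals \<open>\<beta> K (C - K) / C\<close> with
\<open>C = K_curve \<beta>\<close>. It measures the distance of the path from the curve, on which it is zero; constant and
linear terms of \<open>C - K\<close> cancel because the path is tangent to the curve.\<close>
lemma quadratic_coeff_limit:
  "((\<lambda>h. path_slope l lt h / 2 * (1 - path_var h * path_slope l lt h) / h\<^sup>2)
     \<longlongrightarrow> quad_coeff l) (at_right 0)"
proof -
  define D2 where "D2 = (deriv ^^ 2) K_curve beta_c"
  define R where "R = (\<lambda>h. (K_curve (beta_c + h) - K_curve beta_c - deriv K_curve beta_c * h - D2 / 2 * h\<^sup>2) / h\<^sup>2)"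
  have K0: "K_curve beta_c > 0" using beta_c_pos by (simp add: K_curve_def)
  have Kc: "((\<lambda>h. K_curve (beta_c + h)) \<longlongrightarrow> K_curve beta_c) (at_right 0)"
    unfolding K_curve_def using beta_c_pos by (auto intro!: tendsto_eq_intros)
  have "((\<lambda>h. (beta_c + h) * K_path l lt h / K_curve (beta_c + h) * (R h + (D2 - l) / 2 - lt / 6 * h))
     \<longlongrightarrow> (beta_c + 0) * K_curve beta_c / K_curve beta_c * (0 + (D2 - l) / 2 - lt / 6 * 0)) (at_right 0)"
    using K_curve_taylor path_limits(3)[of l lt] Kc K0 unfolding R_def D2_def
    by (intro tendsto_intros) auto
  moreover have "\<forall>\<^sub>F h in at_right 0. (beta_c + h) * K_path l lt h / K_curve (beta_c + h) * (R h + (D2 - l) / 2 - lt / 6 * h)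
      = path_slope l lt h / 2 * (1 - path_var h * path_slope l lt h) / h\<^sup>2"
  proof -
    have "(beta_c + h) * K_path l lt h / K_curve (beta_c + h) * (R h + (D2 - l) / 2 - lt / 6 * h)
      = path_slope l lt h / 2 * (1 - path_var h * path_slope l lt h) / h\<^sup>2" if h: "h > 0" for h
    proof -
      define K where "K = K_path l lt h"
      define C where "C = K_curve (beta_c + h)"
      have C: "C > 0" unfolding C_def K_curve_def using beta_c_pos h by (auto intro!: divide_pos_pos add_pos_pos)
      have "R h + (D2 - l) / 2 - lt / 6 * h = (C - K) / h\<^sup>2"
        using h unfolding R_def C_def K_def K_path_def
        by (simp add: diff_divide_distrib add_divide_distrib power2_eq_square power3_eq_cube)
      moreover have "path_var h * path_slope l lt h = K / C"
        using beta_c_pos h by (simp add: path_var_def path_slope_def C_def K_def K_curve_def spin_var_def field_simps)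
      ultimately show ?thesis
        using C h by (simp add: path_slope_def flip: C_def K_def) (simp add: field_simps)
    qed
    then show ?thesis unfolding eventually_at_right_field by (intro exI[of _ 1]) auto
  qed
  ultimately show ?thesis
    using Lim_transform_eventually K0 unfolding D2_def quad_coeff_def by fastforce
qed

text \<open>The fourth cumulant is \<open>v * (1 - 3 * v)\<close>, and \<open>1 - 3 * v = (exp \<beta> - 4) / (exp \<beta> + 2)\<close> has a simple zero at
\<open>beta_c\<close>.\<close>
lemma quartic_coeff_limit:
  "((\<lambda>h. - (path_var h - 3 * (path_var h)\<^sup>2) * path_slope l lt h ^ 4 / 24 / h)
     \<longlongrightarrow> - 3 / 4) (at_right 0)"
proof -
  have "((\<lambda>h. (exp h - 1) / h) \<longlongrightarrow> (1::real)) (at_right 0)"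
    using DERIV_exp[of "0::real"] tendsto_within_subset[of _ _ 0 UNIV "{0<..}"]
    unfolding has_field_derivative_iff by simp
  then have "((\<lambda>h. - path_var h * (4 * ((exp h - 1) / h)) / (4 * exp h + 2) * path_slope l lt h ^ 4 / 24)
     \<longlongrightarrow> - (1 / 3) * (4 * 1) / (4 * exp 0 + 2) * 3 ^ 4 / 24) (at_right 0)"
    by (intro tendsto_intros path_limits) auto
  moreover have "- path_var h * (4 * ((exp h - 1) / h)) / (4 * exp h + 2) * path_slope l lt h ^ 4 / 24
     = - (path_var h - 3 * (path_var h)\<^sup>2) * path_slope l lt h ^ 4 / 24 / h" for h
  proof -
    have "4 * exp h + 2 > 0" by (simp add: add_pos_pos)
    then have "4 * (exp h - 1) / (4 * exp h + 2) = 1 - 3 * path_var h"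
      by (simp add: path_var_def spin_var_def exp_add field_simps)
    then have "path_var h * (4 * (exp h - 1) / (4 * exp h + 2)) = path_var h * (1 - 3 * path_var h)"
      by (simp only:)
    also have "\<dots> = path_var h - 3 * (path_var h)\<^sup>2" by (simp add: algebra_simps power2_eq_square)
    finally have "path_var h * (4 * (exp h - 1) / (4 * exp h + 2)) = path_var h - 3 * (path_var h)\<^sup>2" .
    moreover have "- path_var h * (4 * ((exp h - 1) / h)) / (4 * exp h + 2) * path_slope l lt h ^ 4 / 24
      = - (path_var h * (4 * (exp h - 1) / (4 * exp h + 2))) * path_slope l lt h ^ 4 / 24 / h"
      by (simp only: divide_inverse mult_ac mult_minus_left mult_minus_right)
    ultimately show ?thesis by (simp only:)
  qed
  ultimately show ?thesis by simp
qed

lemma sextic_coeff_limit: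
  "((\<lambda>h. - (path_var h - 15 * (path_var h)\<^sup>2 + 30 * path_var h ^ 3) * path_slope l lt h ^ 6 / 720)
     \<longlongrightarrow> 9 / 40) (at_right 0)"
proof -
  have "((\<lambda>h. - (path_var h - 15 * (path_var h)\<^sup>2 + 30 * path_var h ^ 3) * path_slope l lt h ^ 6 / 720)
     \<longlongrightarrow> - (1 / 3 - 15 * (1 / 3)\<^sup>2 + 30 * (1 / 3) ^ 3) * 3 ^ 6 / 720) (at_right 0)"
    by (intro tendsto_intros path_limits) auto
  then show ?thesis by (simp add: eval_nat_numeral)
qed

section \<open>Convergence of the rescaled free-energy functional\<close>

definition limit_poly :: "real \<Rightarrow> real \<Rightarrow> real \<Rightarrow> real" where
  "limit_poly l \<tau> y = \<tau>\<^sup>2 * quad_coeff l * y\<^sup>2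
     - 3 / 4 * \<tau> * y ^ 4 + 9 / 40 * y ^ 6"

text \<open>Read with \<open>z = y ^ 2\<close>: a sextic with leading coefficient \<open>7 / 40\<close> and lower coefficients at least \<open>- M\<close> dominates
\<open>y ^ 2\<close> up to a constant.\<close>
lemma cubic_coercive:
  fixes M :: real
  assumes "0 \<le> M"
  obtains C where "0 \<le> C" "\<And>z. 0 \<le> z \<Longrightarrow> z - C \<le> 7 / 40 * z ^ 3 - M * z\<^sup>2 - M * z"
proof -
  \<comment> \<open>Beyond \<open>Z\<close> the cubic term dominates; up to \<open>Z\<close> the constant \<open>C\<close> does.\<close>
  define Z where "Z = 1 + 40 / 7 * (2 * M + 1)"
  define C where "C = M * Z\<^sup>2 + (M + 1) * Z"
  have Z: "1 \<le> Z" using assms by (simp add: Z_def)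
  have C: "0 \<le> C" using assms Z by (simp add: C_def)
  have "z - C \<le> 7 / 40 * z ^ 3 - M * z\<^sup>2 - M * z" if z: "0 \<le> z" for z
  proof (cases "z \<le> Z")
    case True
    have "M * z\<^sup>2 \<le> M * Z\<^sup>2" "(M + 1) * z \<le> (M + 1) * Z"
      using True z assms by (auto intro!: mult_left_mono power_mono)
    moreover have "0 \<le> z ^ 3" using z by simp
    moreover have "z + M * z = (M + 1) * z" by (simp add: algebra_simps)
    ultimately show ?thesis unfolding C_def by linarith
  next
    case False
    then have "Z \<le> z" by simp
    then have "1 \<le> z" "40 / 7 * (2 * M + 1) \<le> z" using Z assms unfolding Z_def by linarith+
    note z1 = this
    then have "2 * M + 1 \<le> 7 / 40 * z" by simp
    then have "(2 * M + 1) * z\<^sup>2 \<le> 7 / 40 * z * z\<^sup>2" by (intro mult_right_mono) auto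
    moreover have "7 / 40 * z * z\<^sup>2 = 7 / 40 * z ^ 3" by (simp add: power2_eq_square power3_eq_cube)
    moreover have "(M + 1) * z \<le> (M + 1) * z\<^sup>2"
      using z1 assms self_le_power[of z 2] by (intro mult_left_mono) auto
    ultimately show ?thesis using C by (simp add: algebra_simps)
  qed
  with C show ?thesis by (rule that)
qed

text \<open>The inverse scale \<open>s\<close> and the displacement \<open>h\<close> are kept separate because the two choices of \<open>s\<close> used later
balance different terms: \<open>h ^ (-1/2)\<close> (\<open>\<tau> = 1\<close>) is the scale of the magnetization, and \<open>n ^ (1/6)\<close> is the scale
of the fluctuations (\<open>\<tau> = 0\<close> if these dominate).\<close>
locale tricritical_scaling =
  fixes l lt \<tau> :: real and h s :: "nat \<Rightarrow> real"
  assumes h_lim: "filterlim h (at_right 0) sequentially"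
    and s_lim: "filterlim s at_top sequentially"
    and s_h_lim: "(\<lambda>n. (s n)\<^sup>2 * h n) \<longlonglongrightarrow> \<tau>"
begin

abbreviation "v n \<equiv> path_var (h n)"
abbreviation "A n \<equiv> path_slope l lt (h n)"

definition "q2 n = A n / 2 * (1 - v n * A n) * s n ^ 4"
definition "q4 n = - (v n - 3 * (v n)\<^sup>2) * A n ^ 4 / 24 * (s n)\<^sup>2"
definition "q6 n = - (v n - 15 * (v n)\<^sup>2 + 30 * v n ^ 3) * A n ^ 6 / 720"

text \<open>The sixth power makes the sextic term independent of \<open>s\<close>; the quadratic and quartic terms then carry
\<open>(s ^ 2 * h) ^ 2\<close> and \<open>s ^ 2 * h\<close>.\<close>
definition Phi :: "nat \<Rightarrow> real \<Rightarrow> real" where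
  "Phi n y = s n ^ 6 * G_fun (beta_c + h n) (K_path l lt (h n)) (y / s n)"

lemma ev_h: "\<forall>\<^sub>F n in sequentially. 0 < h n"
  using h_lim unfolding filterlim_at by (auto elim: eventually_mono)

lemma ev_s: "\<forall>\<^sub>F n in sequentially. 0 < s n"
  using s_lim by (rule filterlim_at_top_dense[THEN iffD1, rule_format])

lemma A_lim: "A \<longlonglongrightarrow> 3"
  using filterlim_compose[OF path_limits(2) h_lim] .

lemma q2_lim: "q2 \<longlonglongrightarrow> \<tau>\<^sup>2 * quad_coeff l"
proof -
  have "(\<lambda>n. ((s n)\<^sup>2 * h n)\<^sup>2 * (A n / 2 * (1 - v n * A n) / (h n)\<^sup>2)) \<longlonglongrightarrow>
     \<tau>\<^sup>2 * quad_coeff l"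
    by (intro tendsto_intros s_h_lim filterlim_compose[OF quadratic_coeff_limit h_lim])
  moreover have "\<forall>\<^sub>F n in sequentially. ((s n)\<^sup>2 * h n)\<^sup>2 * (A n / 2 * (1 - v n * A n) / (h n)\<^sup>2) = q2 n"
    using ev_h by eventually_elim (simp add: q2_def power_mult_distrib flip: power_mult)
  ultimately show ?thesis by (rule Lim_transform_eventually)
qed

lemma q4_lim: "q4 \<longlonglongrightarrow> - 3 / 4 * \<tau>"
proof -
  have "(\<lambda>n. (- (v n - 3 * (v n)\<^sup>2) * A n ^ 4 / 24 / h n) * ((s n)\<^sup>2 * h n)) \<longlonglongrightarrow> - 3 / 4 * \<tau>"
    by (intro tendsto_intros s_h_lim filterlim_compose[OF quartic_coeff_limit h_lim])
  moreover have "\<forall>\<^sub>F n in sequentially. (- (v n - 3 * (v n)\<^sup>2) * A n ^ 4 / 24 / h n) * ((s n)\<^sup>2 * h n) = q4 n"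
    using ev_h by eventually_elim (simp add: q4_def)
  ultimately show ?thesis by (rule Lim_transform_eventually)
qed

lemma q6_lim: "q6 \<longlonglongrightarrow> 9 / 40"
  unfolding q6_def[abs_def] using filterlim_compose[OF sextic_coeff_limit h_lim] .

lemma inverse_s_lim: "(\<lambda>n. 1 / s n) \<longlonglongrightarrow> 0"
  using tendsto_inverse_0_at_top[OF s_lim] by (simp add: inverse_eq_divide)

lemma error_lim: "(\<lambda>n. 10 * A n ^ 8 * R / (s n)\<^sup>2) \<longlonglongrightarrow> 0"
proof -
  have "(\<lambda>n. 10 * A n ^ 8 * R * (1 / s n)\<^sup>2) \<longlonglongrightarrow> 10 * 3 ^ 8 * R * 0\<^sup>2"
    by (intro tendsto_intros A_lim inverse_s_lim)
  then show ?thesis by (simp add: power_divide)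
qed

lemma Phi_eq:
  "Phi n y = s n ^ 6 * (A n * (y / s n)\<^sup>2 / 2 - cgf (v n) (A n * (y / s n)))"
  by (simp add: Phi_def G_fun_eq path_var_def path_slope_def algebra_simps)

lemma Phi_taylor:
  assumes s: "0 < s n" and y: "\<bar>A n * (y / s n)\<bar> \<le> 1"
  shows "\<bar>Phi n y - (q2 n * y\<^sup>2 + q4 n * y ^ 4 + q6 n * y ^ 6)\<bar> \<le> 10 * A n ^ 8 * y ^ 8 / (s n)\<^sup>2"
proof -
  define t where "t = A n * (y / s n)"
  define P where "P = v n * t\<^sup>2 / 2 + (v n - 3 * (v n)\<^sup>2) * t ^ 4 / 24
            + (v n - 15 * (v n)\<^sup>2 + 30 * v n ^ 3) * t ^ 6 / 720"
  have v: "0 \<le> v n" "v n \<le> 1"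
    using spin_var_pos spin_var_less_1 by (auto simp: path_var_def less_imp_le)
  have T: "\<bar>cgf (v n) t - P\<bar> \<le> 10 * t ^ 8"
    unfolding P_def using v y by (intro cgf_taylor6) (auto simp: t_def)
  have e2: "s n ^ 6 * t\<^sup>2 = A n ^ 2 * s n ^ 4 * y\<^sup>2" and e4: "s n ^ 6 * t ^ 4 = A n ^ 4 * (s n)\<^sup>2 * y ^ 4"
    and e6: "s n ^ 6 * t ^ 6 = A n ^ 6 * y ^ 6" and e8: "s n ^ 6 * t ^ 8 = A n ^ 8 * y ^ 8 / (s n)\<^sup>2"
    and e0: "s n ^ 6 * (y / s n)\<^sup>2 = s n ^ 4 * y\<^sup>2"
    using s by (simp_all add: t_def power_divide power_mult_distrib field_simps flip: power_add)
  have "q2 n * y\<^sup>2 + q4 n * y ^ 4 + q6 n * y ^ 6 = s n ^ 6 * (A n * (y / s n)\<^sup>2 / 2 - P)"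
  proof -
    have eq: "s n ^ 6 * (A n * (y / s n)\<^sup>2 / 2 - P)
       = A n / 2 * (s n ^ 6 * (y / s n)\<^sup>2) - (v n / 2 * (s n ^ 6 * t\<^sup>2) + (v n - 3 * (v n)\<^sup>2) / 24 * (s n ^ 6 * t ^ 4)
          + (v n - 15 * (v n)\<^sup>2 + 30 * v n ^ 3) / 720 * (s n ^ 6 * t ^ 6))"
      unfolding P_def by (simp add: algebra_simps)
    show ?thesis
      unfolding eq e0 e2 e4 e6 q2_def q4_def q6_def
      by (simp add: algebra_simps power2_eq_square add_divide_distrib diff_divide_distrib)
  qed
  moreover have "Phi n y = s n ^ 6 * (A n * (y / s n)\<^sup>2 / 2 - P) - s n ^ 6 * (cgf (v n) t - P)"
    unfolding Phi_eq t_def by (simp add: right_diff_distrib)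
  ultimately have "Phi n y - (q2 n * y\<^sup>2 + q4 n * y ^ 4 + q6 n * y ^ 6) = - (s n ^ 6 * (cgf (v n) t - P))"
    by simp
  then have "\<bar>Phi n y - (q2 n * y\<^sup>2 + q4 n * y ^ 4 + q6 n * y ^ 6)\<bar> = s n ^ 6 * \<bar>cgf (v n) t - P\<bar>"
    using s by (simp add: abs_mult)
  also have "\<dots> \<le> s n ^ 6 * (10 * t ^ 8)" using T s by (intro mult_left_mono) auto
  also have "\<dots> = 10 * A n ^ 8 * y ^ 8 / (s n)\<^sup>2" using e8 by (simp add: mult_ac)
  finally show ?thesis .
qed

lemma ev_slope_small:
  "\<forall>\<^sub>F n in sequentially. \<forall>y. \<bar>y\<bar> \<le> R \<longrightarrow> \<bar>A n * (y / s n)\<bar> \<le> 1"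
proof -
  have "(\<lambda>n. \<bar>A n\<bar> * (1 / s n) * R) \<longlonglongrightarrow> \<bar>3\<bar> * 0 * R"
    by (intro tendsto_intros A_lim inverse_s_lim)
  then have "\<forall>\<^sub>F n in sequentially. \<bar>A n\<bar> * (1 / s n) * R < 1"
    by (rule order_tendstoD) simp
  with ev_s show ?thesis
  proof eventually_elim
    case (elim n)
    show ?case
    proof (intro allI impI)
      fix y assume "\<bar>y\<bar> \<le> R"
      then have "\<bar>A n\<bar> * (1 / s n) * \<bar>y\<bar> \<le> \<bar>A n\<bar> * (1 / s n) * R"
        using elim by (intro mult_left_mono) auto
      moreover have "\<bar>A n * (y / s n)\<bar> = \<bar>A n\<bar> * (1 / s n) * \<bar>y\<bar>" using elim by (simp add: abs_mult)
      ultimately show "\<bar>A n * (y / s n)\<bar> \<le> 1" using elim by linarith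
    qed
  qed
qed

lemma Phi_uniform:
  assumes "0 < e"
  shows "\<forall>\<^sub>F n in sequentially. \<forall>y. \<bar>y\<bar> \<le> R \<longrightarrow> \<bar>Phi n y - limit_poly l \<tau> y\<bar> < e"
proof -
  define a where "a = \<tau>\<^sup>2 * quad_coeff l"
  define E where "E = (\<lambda>n. \<bar>q2 n - a\<bar> * R\<^sup>2 + \<bar>q4 n - (- 3 / 4 * \<tau>)\<bar> * R ^ 4
     + \<bar>q6 n - 9 / 40\<bar> * R ^ 6 + 10 * A n ^ 8 * R ^ 8 / (s n)\<^sup>2)"
  have "E \<longlonglongrightarrow> \<bar>a - a\<bar> * R\<^sup>2 + \<bar>- 3 / 4 * \<tau> - (- 3 / 4 * \<tau>)\<bar> * R ^ 4 + \<bar>9 / 40 - 9 / 40\<bar> * R ^ 6 + 0"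
    unfolding E_def by (intro tendsto_add tendsto_mult tendsto_rabs tendsto_diff tendsto_const
        q2_lim[folded a_def] q4_lim q6_lim error_lim)
  then have "\<forall>\<^sub>F n in sequentially. E n < e" using assms by (intro order_tendstoD) auto
  then show ?thesis using ev_s ev_slope_small[of R]
  proof eventually_elim
    case (elim n)
    show ?case
    proof (intro allI impI)
      fix y assume y: "\<bar>y\<bar> \<le> R"
      have pw: "y ^ k \<le> R ^ k" if "even k" for k
        using y that power_mono[of "\<bar>y\<bar>" R k] by (simp add: power_even_abs)
      have T: "\<bar>Phi n y - (q2 n * y\<^sup>2 + q4 n * y ^ 4 + q6 n * y ^ 6)\<bar> \<le> 10 * A n ^ 8 * R ^ 8 / (s n)\<^sup>2"
        using elim y pw[of 8] by (intro order_trans[OF Phi_taylor] divide_right_mono mult_left_mono) auto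
      have b2: "\<bar>(q2 n - a) * y\<^sup>2\<bar> \<le> \<bar>q2 n - a\<bar> * R\<^sup>2"
        and b4: "\<bar>(q4 n - (- 3 / 4 * \<tau>)) * y ^ 4\<bar> \<le> \<bar>q4 n - (- 3 / 4 * \<tau>)\<bar> * R ^ 4"
        and b6: "\<bar>(q6 n - 9 / 40) * y ^ 6\<bar> \<le> \<bar>q6 n - 9 / 40\<bar> * R ^ 6"
        unfolding abs_mult using pw[of 2] pw[of 4] pw[of 6]
        by (auto intro!: mult_left_mono simp: power_even_abs)
      have "Phi n y - limit_poly l \<tau> y = (Phi n y - (q2 n * y\<^sup>2 + q4 n * y ^ 4 + q6 n * y ^ 6))
         + (q2 n - a) * y\<^sup>2 + (q4 n - (- 3 / 4 * \<tau>)) * y ^ 4 + (q6 n - 9 / 40) * y ^ 6"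
        unfolding limit_poly_def a_def[symmetric] by (simp add: algebra_simps)
      then have "\<bar>Phi n y - limit_poly l \<tau> y\<bar> \<le> E n" unfolding E_def using T b2 b4 b6 by linarith
      then show "\<bar>Phi n y - limit_poly l \<tau> y\<bar> < e" using elim by simp
    qed
  qed
qed

lemma Phi_pointwise: "(\<lambda>n. Phi n y) \<longlonglongrightarrow> limit_poly l \<tau> y"
proof (rule tendstoI)
  fix e :: real assume "0 < e"
  from Phi_uniform[OF this, of "\<bar>y\<bar>"]
  show "\<forall>\<^sub>F n in sequentially. dist (Phi n y) (limit_poly l \<tau> y) < e"
    by eventually_elim (auto simp: dist_real_def)
qed

text \<open>Two regions are needed. While \<open>t = 2 \<beta> K y / s\<close> is small, the Taylor remainder is absorbed by a fortieth of
\<open>y ^ 6\<close> and the remaining polynomial is coercive. For the other \<open>t\<close>, the variance is below \<open>1 / 3\<close> because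
\<open>\<beta> > beta_c\<close>, so \<open>third_gap_quadratic\<close> gives \<open>G \<ge> c / 2 * t ^ 2\<close>, and the factor \<open>s ^ 4\<close> makes this larger than
\<open>y ^ 2\<close>.\<close>
lemma Phi_lower_bound: "\<exists>C. \<forall>\<^sub>F n in sequentially. \<forall>y. y\<^sup>2 - C \<le> Phi n y"
proof -
  define a where "a = \<tau>\<^sup>2 * quad_coeff l"
  define M where "M = \<bar>a\<bar> + \<bar>\<tau>\<bar> + 1"
  \<comment> \<open>\<open>7 / 40 = 1 / 5 - 1 / 40\<close>: the sextic coefficient exceeds \<open>1 / 5\<close>
    eventually, and \<open>1 / 40\<close> pays for the Taylor remainder if \<open>\<bar>t\<bar> \<le> 1 / 2000\<close>.\<close>
  obtain C where C: "0 \<le> C" "\<And>z. 0 \<le> z \<Longrightarrow> z - C \<le> 7 / 40 * z ^ 3 - M * z\<^sup>2 - M * z"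
    using cubic_coercive[of M] by (auto simp: M_def)
  obtain c where c: "0 < c" "\<And>t. 1 / 2000 \<le> \<bar>t\<bar> \<Longrightarrow> c * t\<^sup>2 \<le> third_gap t"
    using third_gap_quadratic[of "1 / 2000"] by auto
  have "\<forall>\<^sub>F n in sequentially. - M < q2 n"
    by (rule order_tendstoD[OF q2_lim[folded a_def]]) (simp add: M_def)
  moreover have "\<forall>\<^sub>F n in sequentially. - M < q4 n"
    by (rule order_tendstoD[OF q4_lim]) (simp add: M_def)
  moreover have "\<forall>\<^sub>F n in sequentially. 1 / 5 < q6 n"
    by (rule order_tendstoD[OF q6_lim]) simp
  moreover have "\<forall>\<^sub>F n in sequentially. 2 < A n" "\<forall>\<^sub>F n in sequentially. A n < 4"
    by (rule order_tendstoD[OF A_lim]; simp)+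
  moreover have "\<forall>\<^sub>F n in sequentially. 1 / 6 - c / 2 < 1 / (2 * A n)"
  proof (rule order_tendstoD)
    show "(\<lambda>n. 1 / (2 * A n)) \<longlonglongrightarrow> 1 / (2 * 3)" by (intro tendsto_intros A_lim) auto
  qed (use c in auto)
  moreover have "\<forall>\<^sub>F n in sequentially. max 1 (1 / c) < s n"
    using s_lim by (rule filterlim_at_top_dense[THEN iffD1, rule_format])
  ultimately have "\<forall>\<^sub>F n in sequentially. \<forall>y. y\<^sup>2 - C \<le> Phi n y"
    using ev_h
  proof eventually_elim
    case (elim n)
    have s: "0 < s n" "1 < s n" "1 / c < s n" using elim by auto
    show ?case
    proof
      fix y
      define t where "t = A n * (y / s n)"
      show "y\<^sup>2 - C \<le> Phi n y"
      proof (cases "\<bar>t\<bar> \<le> 1 / 2000")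
        case True
        have "10 * A n ^ 8 * y ^ 8 / (s n)\<^sup>2 = 10 * A n ^ 6 * t\<^sup>2 * y ^ 6"
          using s by (simp add: t_def power_divide power_mult_distrib field_simps flip: power_add)
        also have "\<dots> \<le> 10 * 4 ^ 6 * (1 / 2000)\<^sup>2 * y ^ 6"
        proof (rule mult_right_mono)
          have "t\<^sup>2 \<le> (1 / 2000)\<^sup>2" using True by (intro iffD1[OF abs_le_square_iff]) simp
          moreover have "A n ^ 6 \<le> 4 ^ 6" using elim by (intro power_mono) auto
          ultimately show "10 * A n ^ 6 * t\<^sup>2 \<le> 10 * 4 ^ 6 * (1 / 2000)\<^sup>2"
            using elim by (intro mult_mono) auto
        qed simp
        also have "\<dots> \<le> 1 / 40 * y ^ 6" by (intro mult_right_mono) (auto simp: power2_eq_square)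
        finally have "Phi n y \<ge> q2 n * y\<^sup>2 + q4 n * y ^ 4 + q6 n * y ^ 6 - 1 / 40 * y ^ 6"
          using Phi_taylor[OF s(1), of y] True unfolding t_def by linarith
        moreover have "- M * y\<^sup>2 \<le> q2 n * y\<^sup>2" "- M * y ^ 4 \<le> q4 n * y ^ 4" "1 / 5 * y ^ 6 \<le> q6 n * y ^ 6"
          using elim by (intro mult_right_mono; simp)+
        moreover have "y\<^sup>2 - C \<le> 7 / 40 * y ^ 6 - M * y ^ 4 - M * y\<^sup>2"
          using C(2)[of "y\<^sup>2"] by (simp flip: power_mult)
        ultimately show ?thesis by simp
      next
        case False
        then have gap: "c * t\<^sup>2 \<le> third_gap t" using c(2)[of t] by simp
        have "cgf (v n) t \<le> cgf (1 / 3) t"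
          using spin_var_pos[of "beta_c + h n"] spin_var_less_third[of "beta_c + h n"] elim
          by (intro cgf_mono) (auto simp: path_var_def)
        then have "cgf (v n) t \<le> (1 / 6 - c) * t\<^sup>2" using gap by (simp add: third_gap_def algebra_simps)
        moreover have "A n * (y / s n)\<^sup>2 / 2 = 1 / (2 * A n) * t\<^sup>2"
          using elim by (simp add: t_def power_mult_distrib power2_eq_square mult_ac)
        moreover have "(1 / 6 - c / 2) * t\<^sup>2 \<le> 1 / (2 * A n) * t\<^sup>2"
          using elim by (intro mult_right_mono) auto
        ultimately have "c / 2 * t\<^sup>2 \<le> A n * (y / s n)\<^sup>2 / 2 - cgf (v n) t"
          by (simp add: algebra_simps)
        then have "s n ^ 6 * (c / 2 * t\<^sup>2) \<le> Phi n y"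
          unfolding Phi_eq t_def[symmetric] using s by (intro mult_left_mono) auto
        moreover have "1 * y\<^sup>2 \<le> s n ^ 6 * (c / 2 * t\<^sup>2)"
        proof -
          have "s n ^ 6 * (c / 2 * t\<^sup>2) = (c / 2 * (A n)\<^sup>2 * s n ^ 4) * y\<^sup>2"
            using s by (simp add: t_def power_divide power_mult_distrib field_simps flip: power_add)
          moreover have "1 \<le> c / 2 * (A n)\<^sup>2 * s n ^ 4"
          proof -
            have "1 \<le> c * s n" using s c by (simp add: field_simps)
            also have "\<dots> \<le> c * s n ^ 4" using s c self_le_power[of "s n" 4] by (intro mult_left_mono) auto
            also have "\<dots> = c / 2 * 2 * s n ^ 4" by simp
            also have "\<dots> \<le> c / 2 * (A n)\<^sup>2 * s n ^ 4"
              using elim c s power_mono[of 2 "A n" 2] by (intro mult_right_mono mult_left_mono) auto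
            finally show ?thesis .
          qed
          ultimately show ?thesis by (metis mult_right_mono zero_le_power2)
        qed
        ultimately show ?thesis using C(1) by simp
      qed
    qed
  qed
  then show ?thesis by blast
qed

text \<open>Near \<open>0\<close> a positive quadratic coefficient dominates the other terms of the expansion, uniformly in \<open>n\<close>. Convergence to
the limit alone would not exclude minimum points that shrink to \<open>0\<close>.\<close>
lemma Phi_nonneg_near_0:
  assumes "0 < \<tau>\<^sup>2 * quad_coeff l"
  shows "\<exists>r>0. \<forall>\<^sub>F n in sequentially. \<forall>y. \<bar>y\<bar> \<le> r \<longrightarrow> 0 \<le> Phi n y"
proof -
  define a where "a = \<tau>\<^sup>2 * quad_coeff l"
  have a: "0 < a" using assms by (simp add: a_def)
  define M where "M = \<bar>\<tau>\<bar> + 1"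
  have M: "1 \<le> M" by (simp add: M_def)
  define r where "r = min 1 (a / (8 * M))"
  have r: "0 < r" "r \<le> 1" "M * r \<le> a / 8" using a M by (auto simp: r_def min_def field_simps)
  have "\<forall>\<^sub>F n in sequentially. a / 2 < q2 n"
    using a by (intro order_tendstoD[OF q2_lim[folded a_def]]) simp
  moreover have "\<forall>\<^sub>F n in sequentially. - M < q4 n"
    by (rule order_tendstoD[OF q4_lim]) (simp add: M_def)
  moreover have "\<forall>\<^sub>F n in sequentially. 0 < q6 n"
    by (rule order_tendstoD[OF q6_lim]) simp
  moreover have "\<forall>\<^sub>F n in sequentially. 10 * A n ^ 8 * 1 / (s n)\<^sup>2 < a / 8"
    using a by (intro order_tendstoD[OF error_lim]) simp
  ultimately have "\<forall>\<^sub>F n in sequentially. \<forall>y. \<bar>y\<bar> \<le> r \<longrightarrow> 0 \<le> Phi n y"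
    using ev_s ev_slope_small[of r]
  proof eventually_elim
    case (elim n)
    show ?case
    proof (intro allI impI)
      fix y assume y: "\<bar>y\<bar> \<le> r"
      have y2: "y\<^sup>2 \<le> r"
      proof -
        have "\<bar>y\<bar> * \<bar>y\<bar> \<le> r * 1" using y r by (intro mult_mono) auto
        then show ?thesis by (simp add: power2_eq_square)
      qed
      have "y ^ 8 = (y\<^sup>2) ^ 3 * y\<^sup>2" by (simp flip: power_add power_mult)
      also have "\<dots> \<le> 1 * y\<^sup>2" using y2 r power_le_one[of "y\<^sup>2" 3] by (intro mult_right_mono) auto
      finally have y8: "y ^ 8 \<le> y\<^sup>2" by simp
      have "10 * A n ^ 8 * y ^ 8 / (s n)\<^sup>2 = 10 * A n ^ 8 * 1 / (s n)\<^sup>2 * y ^ 8" by simp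
      also have "\<dots> \<le> a / 8 * y\<^sup>2" using elim y8 a by (intro mult_mono) auto
      finally have "Phi n y \<ge> q2 n * y\<^sup>2 + q4 n * y ^ 4 + q6 n * y ^ 6 - a / 8 * y\<^sup>2"
        using Phi_taylor[of n y] elim y by fastforce
      moreover have "a / 2 * y\<^sup>2 \<le> q2 n * y\<^sup>2" "- M * y ^ 4 \<le> q4 n * y ^ 4" "0 \<le> q6 n * y ^ 6"
        using elim by (intro mult_right_mono mult_nonneg_nonneg; simp)+
      moreover have "M * y ^ 4 \<le> a / 8 * y\<^sup>2"
      proof -
        have "M * y ^ 4 = (M * y\<^sup>2) * y\<^sup>2" by (simp flip: power_add)
        also have "\<dots> \<le> (M * r) * y\<^sup>2" using y2 M by (intro mult_right_mono mult_left_mono) auto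
        also have "\<dots> \<le> a / 8 * y\<^sup>2" using r by (intro mult_right_mono) auto
        finally show ?thesis .
      qed
      moreover have "0 \<le> a / 4 * y\<^sup>2" using a by simp
      ultimately show "0 \<le> Phi n y" by simp
    qed
  qed
  with r show ?thesis by blast
qed

end

section \<open>Gaussian smoothing of the total spin\<close>

text \<open>A tilt that is linear in the total spin leaves the spins independent.\<close>
lemma config_sum_factorizes:
  "(\<Sum>\<omega>\<in>configs n. exp (- \<beta> * (\<Sum>j=1..n. (\<omega> j)\<^sup>2) + t * spin_sum n \<omega>))
     = ((1 + 2 * exp (- \<beta>)) * exp (c_fun \<beta> t)) ^ n"
proof -
  have "(\<Sum>\<omega>\<in>configs n. exp (- \<beta> * (\<Sum>j=1..n. (\<omega> j)\<^sup>2) + t * spin_sum n \<omega>))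
     = (\<Sum>\<omega>\<in>{1..n} \<rightarrow>\<^sub>E {1, 0, -1}. \<Prod>j\<in>{1..n}. exp (- \<beta> * (\<omega> j)\<^sup>2 + t * \<omega> j))"
    unfolding configs_def spin_sum_def
  proof (intro sum.cong refl)
    fix \<omega> :: "nat \<Rightarrow> real"
    have "- \<beta> * (\<Sum>j=1..n. (\<omega> j)\<^sup>2) + t * (\<Sum>j=1..n. \<omega> j) = (\<Sum>j\<in>{1..n}. - \<beta> * (\<omega> j)\<^sup>2 + t * \<omega> j)"
      unfolding sum_distrib_left sum.distrib ..
    then show "exp (- \<beta> * (\<Sum>j=1..n. (\<omega> j)\<^sup>2) + t * (\<Sum>j=1..n. \<omega> j))
       = (\<Prod>j\<in>{1..n}. exp (- \<beta> * (\<omega> j)\<^sup>2 + t * \<omega> j))"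
      by (simp only: exp_sum finite_atLeastAtMost)
  qed
  also have "\<dots> = (\<Prod>j\<in>{1..n}. \<Sum>x\<in>{1, 0, -1}. exp (- \<beta> * x\<^sup>2 + t * x))"
    by (subst prod_sum_PiE) auto
  also have "\<dots> = (1 + exp (- \<beta>) * (exp t + exp (- t))) ^ n"
  proof -
    have "exp (- \<beta>) * (exp t + exp (- t)) = exp (- \<beta> + t) + exp (- \<beta> + - t)"
      unfolding exp_add distrib_left ..
    moreover have "(\<Sum>x\<in>{1, 0, -1}. exp (- \<beta> * x\<^sup>2 + t * x)) = 1 + (exp (- \<beta> + t) + exp (- \<beta> + - t))"
      by simp
    ultimately show ?thesis by (simp only: prod_constant card_atLeastAtMost) simp
  qed
  also have "1 + exp (- \<beta>) * (exp t + exp (- t)) = (1 + 2 * exp (- \<beta>)) * exp (c_fun \<beta> t)"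
  proof -
    have "0 < 1 + 2 * exp (- \<beta>)" "0 < 1 + exp (- \<beta>) * (exp t + exp (- t))"
      by (auto intro!: add_pos_pos mult_pos_pos)
    then show ?thesis by (simp add: c_fun_def)
  qed
  finally show ?thesis .
qed

text \<open>Completing the square. A normal density centred at \<open>S / n\<close> with variance \<open>1 / (n * A)\<close> trades the quadratic
interaction for a linear one, at the price of an integration over \<open>x\<close>.\<close>
lemma gaussian_linearization:
  assumes "0 < n" "0 < A"
  shows "exp (A * S\<^sup>2 / (2 * n)) * normal_density (S / n) (1 / sqrt (n * A)) x
     = sqrt (n * A / (2 * pi)) * exp (- (n * A * x\<^sup>2 / 2) + A * x * S)"
proof -
  have "(x - S / n)\<^sup>2 / (2 * (1 / sqrt (n * A))\<^sup>2) = n * A * x\<^sup>2 / 2 - A * x * S + A * S\<^sup>2 / (2 * n)"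
    using assms by (simp add: power_divide field_simps power2_eq_square)
  then have "exp (A * S\<^sup>2 / (2 * n)) * exp (- (x - S / n)\<^sup>2 / (2 * (1 / sqrt (n * A))\<^sup>2))
       = exp (- (n * A * x\<^sup>2 / 2) + A * x * S)"
    by (simp flip: exp_add)
  moreover have "1 / sqrt (2 * pi * (1 / sqrt (n * A))\<^sup>2) = sqrt (n * A / (2 * pi))"
    using assms by (simp add: power_divide real_sqrt_divide)
  ultimately show ?thesis unfolding normal_density_def by (metis mult.left_commute)
qed

text \<open>The mixture of normal densities on the left is, up to the partition function, the density of \<open>spin_sum n \<omega> / n\<close> plus an
independent centred normal variable.\<close>
lemma weighted_gaussians:
  assumes n: "0 < n" and \<beta>: "0 < \<beta>" "0 < K"
  shows "(\<Sum>\<omega>\<in>configs n. exp (- \<beta> * Ham n K \<omega>) *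
        normal_density (spin_sum n \<omega> / n) (1 / sqrt (n * (2 * \<beta> * K))) x)
     = sqrt (n * (2 * \<beta> * K) / (2 * pi)) * (1 + 2 * exp (- \<beta>)) ^ n * exp (- (n * G_fun \<beta> K x))"
proof -
  define A where "A = 2 * \<beta> * K"
  have A: "0 < A" using \<beta> by (simp add: A_def)
  have "exp (- \<beta> * Ham n K \<omega>) * normal_density (spin_sum n \<omega> / n) (1 / sqrt (n * A)) x
     = sqrt (n * A / (2 * pi)) * exp (- (n * A * x\<^sup>2 / 2)) *
       exp (- \<beta> * (\<Sum>j=1..n. (\<omega> j)\<^sup>2) + A * x * spin_sum n \<omega>)" for \<omega>
  proof -
    have eq: "- \<beta> * Ham n K \<omega> = - \<beta> * (\<Sum>j=1..n. (\<omega> j)\<^sup>2) + A * (spin_sum n \<omega>)\<^sup>2 / (2 * real n)"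
      using n by (simp add: Ham_def A_def spin_sum_def field_simps)
    have "exp (- \<beta> * Ham n K \<omega>) * normal_density (spin_sum n \<omega> / n) (1 / sqrt (n * A)) x
      = exp (- \<beta> * (\<Sum>j=1..n. (\<omega> j)\<^sup>2)) *
        (exp (A * (spin_sum n \<omega>)\<^sup>2 / (2 * real n)) * normal_density (spin_sum n \<omega> / n) (1 / sqrt (n * A)) x)"
      unfolding eq exp_add by (simp only: mult.assoc)
    also have "\<dots> = exp (- \<beta> * (\<Sum>j=1..n. (\<omega> j)\<^sup>2)) *
        (sqrt (n * A / (2 * pi)) * exp (- (n * A * x\<^sup>2 / 2) + A * x * spin_sum n \<omega>))"
      using n A by (subst gaussian_linearization) auto
    also have "\<dots> = sqrt (n * A / (2 * pi)) * exp (- (n * A * x\<^sup>2 / 2)) *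
       exp (- \<beta> * (\<Sum>j=1..n. (\<omega> j)\<^sup>2) + A * x * spin_sum n \<omega>)"
      unfolding exp_add by (simp only: mult_ac)
    finally show ?thesis .
  qed
  then have "(\<Sum>\<omega>\<in>configs n. exp (- \<beta> * Ham n K \<omega>) * normal_density (spin_sum n \<omega> / n) (1 / sqrt (n * A)) x)
    = sqrt (n * A / (2 * pi)) * exp (- (n * A * x\<^sup>2 / 2)) *
       (\<Sum>\<omega>\<in>configs n. exp (- \<beta> * (\<Sum>j=1..n. (\<omega> j)\<^sup>2) + A * x * spin_sum n \<omega>))"
    by (simp only: sum_distrib_left)
  also have "\<dots> = sqrt (n * A / (2 * pi)) * (1 + 2 * exp (- \<beta>)) ^ n * (exp (- (n * A * x\<^sup>2 / 2)) * exp (c_fun \<beta> (A * x)) ^ n)"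
    unfolding config_sum_factorizes by (simp only: power_mult_distrib mult_ac)
  also have "exp (- (n * A * x\<^sup>2 / 2)) * exp (c_fun \<beta> (A * x)) ^ n = exp (- (n * G_fun \<beta> K x))"
    unfolding G_fun_def A_def by (simp add: algebra_simps flip: exp_of_nat_mult exp_add)
  finally show ?thesis unfolding A_def .
qed

lemma gaussian_abs_mean:
  assumes "0 < \<sigma>"
  shows "integrable lborel (\<lambda>x. normal_density \<mu> \<sigma> x * \<bar>x\<bar>)"
    and "\<bar>(LINT x|lborel. normal_density \<mu> \<sigma> x * \<bar>x\<bar>) - \<bar>\<mu>\<bar>\<bar> \<le> \<sigma>"
proof -
  have i0: "integrable lborel (normal_density \<mu> \<sigma>)" "(LINT x|lborel. normal_density \<mu> \<sigma> x) = 1"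
    using assms by (auto intro: integrable_normal_density integral_normal_density)
  have i1: "integrable lborel (\<lambda>x. normal_density \<mu> \<sigma> x * \<bar>x - \<mu>\<bar>)"
    using integrable_normal_moment_abs[OF assms, of \<mu> 1] by simp
  have m1: "(LINT x|lborel. normal_density \<mu> \<sigma> x * \<bar>x - \<mu>\<bar>) \<le> \<sigma>"
  proof -
    have "(LINT x|lborel. normal_density \<mu> \<sigma> x * \<bar>x - \<mu>\<bar>) = \<sigma> * sqrt (2 / pi)"
      using integral_normal_moment_abs_odd[OF assms, of \<mu> 0] by simp
    moreover have "sqrt (2 / pi) \<le> 1" using pi_ge_two by simp
    ultimately show ?thesis using assms by (simp add: mult_left_le)
  qed
  have "integrable lborel (\<lambda>x. normal_density \<mu> \<sigma> x * \<bar>x - \<mu>\<bar> + normal_density \<mu> \<sigma> x * \<bar>\<mu>\<bar>)"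
    using i0 i1 by (intro Bochner_Integration.integrable_add integrable_mult_left) auto
  then show ix: "integrable lborel (\<lambda>x. normal_density \<mu> \<sigma> x * \<bar>x\<bar>)"
  proof (rule Bochner_Integration.integrable_bound)
    show "AE x in lborel. norm (normal_density \<mu> \<sigma> x * \<bar>x\<bar>)
       \<le> norm (normal_density \<mu> \<sigma> x * \<bar>x - \<mu>\<bar> + normal_density \<mu> \<sigma> x * \<bar>\<mu>\<bar>)"
      by (auto simp: abs_mult simp flip: distrib_left intro!: AE_I2 mult_left_mono)
  qed auto
  have "(LINT x|lborel. normal_density \<mu> \<sigma> x * \<bar>x\<bar>) - \<bar>\<mu>\<bar>
     = (LINT x|lborel. normal_density \<mu> \<sigma> x * \<bar>x\<bar> - normal_density \<mu> \<sigma> x * \<bar>\<mu>\<bar>)"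
    using ix i0 by (subst Bochner_Integration.integral_diff) auto
  also have "\<bar>\<dots>\<bar> \<le> (LINT x|lborel. \<bar>normal_density \<mu> \<sigma> x * \<bar>x\<bar> - normal_density \<mu> \<sigma> x * \<bar>\<mu>\<bar>\<bar>)"
    using integral_norm_bound[of lborel "\<lambda>x. normal_density \<mu> \<sigma> x * \<bar>x\<bar> - normal_density \<mu> \<sigma> x * \<bar>\<mu>\<bar>"] by simp
  also have "\<dots> \<le> (LINT x|lborel. normal_density \<mu> \<sigma> x * \<bar>x - \<mu>\<bar>)"
  proof (rule integral_mono)
    show "integrable lborel (\<lambda>x. \<bar>normal_density \<mu> \<sigma> x * \<bar>x\<bar> - normal_density \<mu> \<sigma> x * \<bar>\<mu>\<bar>\<bar>)"
      using ix i0 by (intro integrable_abs Bochner_Integration.integrable_diff integrable_mult_left) auto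
    show "\<bar>normal_density \<mu> \<sigma> x * \<bar>x\<bar> - normal_density \<mu> \<sigma> x * \<bar>\<mu>\<bar>\<bar> \<le> normal_density \<mu> \<sigma> x * \<bar>x - \<mu>\<bar>" for x
      by (auto simp: abs_mult simp flip: right_diff_distrib intro!: mult_left_mono)
  qed (rule i1)
  finally show "\<bar>(LINT x|lborel. normal_density \<mu> \<sigma> x * \<bar>x\<bar>) - \<bar>\<mu>\<bar>\<bar> \<le> \<sigma>" using m1 by simp
qed

lemma BC_expectation_eq:
  "BC_expectation n \<beta> K f = (\<Sum>\<omega>\<in>configs n. exp (- \<beta> * Ham n K \<omega>) * f \<omega>) / partition_fun n \<beta> K"
  unfolding BC_expectation_def BC_measure_def
  using partition_fun_pos[of n \<beta> K]
  by (subst lebesgue_integral_point_measure_finite)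
     (auto simp: finite_configs sum_divide_distrib less_imp_le)

text \<open>The quotient of integrals is the mean absolute value of the smoothed variable from \<open>weighted_gaussians\<close>; smoothing changes
it by at most the standard deviation of the noise.\<close>
lemma BC_expectation_abs_approx:
  assumes n: "0 < n" and \<beta>: "0 < \<beta>" "0 < K"
  shows "\<bar>BC_expectation n \<beta> K (\<lambda>\<omega>. \<bar>spin_sum n \<omega> / n\<bar>)
      - (LINT x|lborel. \<bar>x\<bar> * exp (- (n * G_fun \<beta> K x))) / (LINT x|lborel. exp (- (n * G_fun \<beta> K x)))\<bar>
     \<le> 1 / sqrt (n * (2 * \<beta> * K))"
proof -
  define \<sigma> where "\<sigma> = 1 / sqrt (n * (2 * \<beta> * K))"
  define \<kappa> where "\<kappa> = sqrt (n * (2 * \<beta> * K) / (2 * pi)) * (1 + 2 * exp (- \<beta>)) ^ n"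
  define w where "w = (\<lambda>\<omega>. exp (- \<beta> * Ham n K \<omega>))"
  define \<mu> where "\<mu> = (\<lambda>\<omega>. spin_sum n \<omega> / n)"
  define Z where "Z = partition_fun n \<beta> K"
  have \<sigma>: "0 < \<sigma>" using n \<beta> by (simp add: \<sigma>_def)
  have \<kappa>: "0 < \<kappa>" using n \<beta> by (auto simp: \<kappa>_def intro!: mult_pos_pos zero_less_power add_pos_pos)
  have Z: "0 < Z" using partition_fun_pos by (simp add: Z_def)
  have mix: "\<kappa> * exp (- (n * G_fun \<beta> K x)) = (\<Sum>\<omega>\<in>configs n. w \<omega> * normal_density (\<mu> \<omega>) \<sigma> x)" for x
    using weighted_gaussians[OF assms, of x] by (simp add: w_def \<mu>_def \<sigma>_def \<kappa>_def)
  have "\<kappa> * (LINT x|lborel. exp (- (n * G_fun \<beta> K x))) = (LINT x|lborel. (\<Sum>\<omega>\<in>configs n. w \<omega> * normal_density (\<mu> \<omega>) \<sigma> x))"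
    unfolding mix[symmetric] by simp
  also have "\<dots> = (\<Sum>\<omega>\<in>configs n. w \<omega> * 1)"
    using \<sigma> by (subst Bochner_Integration.integral_sum) (auto intro: integrable_normal_density)
  finally have I0: "\<kappa> * (LINT x|lborel. exp (- (n * G_fun \<beta> K x))) = Z"
    by (simp add: Z_def partition_fun_def w_def)
  have "\<kappa> * (LINT x|lborel. \<bar>x\<bar> * exp (- (n * G_fun \<beta> K x))) =
      (LINT x|lborel. (\<Sum>\<omega>\<in>configs n. w \<omega> * (normal_density (\<mu> \<omega>) \<sigma> x * \<bar>x\<bar>)))"
  proof -
    have "(\<Sum>\<omega>\<in>configs n. w \<omega> * (normal_density (\<mu> \<omega>) \<sigma> x * \<bar>x\<bar>)) = \<kappa> * (\<bar>x\<bar> * exp (- (n * G_fun \<beta> K x)))" for x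
    proof -
      have "(\<Sum>\<omega>\<in>configs n. w \<omega> * (normal_density (\<mu> \<omega>) \<sigma> x * \<bar>x\<bar>))
         = (\<Sum>\<omega>\<in>configs n. w \<omega> * normal_density (\<mu> \<omega>) \<sigma> x) * \<bar>x\<bar>"
        unfolding sum_distrib_right by (simp only: mult.assoc)
      then show ?thesis unfolding mix[symmetric] by simp
    qed
    then show ?thesis by simp
  qed
  also have "\<dots> = (\<Sum>\<omega>\<in>configs n. w \<omega> * (LINT x|lborel. normal_density (\<mu> \<omega>) \<sigma> x * \<bar>x\<bar>))"
    using \<sigma> by (subst Bochner_Integration.integral_sum) (auto intro!: gaussian_abs_mean)
  finally have I1: "\<kappa> * (LINT x|lborel. \<bar>x\<bar> * exp (- (n * G_fun \<beta> K x))) =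
    (\<Sum>\<omega>\<in>configs n. w \<omega> * (LINT x|lborel. normal_density (\<mu> \<omega>) \<sigma> x * \<bar>x\<bar>))" .
  have quot: "(LINT x|lborel. \<bar>x\<bar> * exp (- (n * G_fun \<beta> K x))) / (LINT x|lborel. exp (- (n * G_fun \<beta> K x)))
     = (\<Sum>\<omega>\<in>configs n. w \<omega> * (LINT x|lborel. normal_density (\<mu> \<omega>) \<sigma> x * \<bar>x\<bar>)) / Z"
    using \<kappa> I0[symmetric] I1[symmetric] by simp
  have E: "BC_expectation n \<beta> K (\<lambda>\<omega>. \<bar>spin_sum n \<omega> / n\<bar>) = (\<Sum>\<omega>\<in>configs n. w \<omega> * \<bar>\<mu> \<omega>\<bar>) / Z"
    unfolding BC_expectation_eq by (simp add: w_def \<mu>_def Z_def)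
  have "\<bar>(\<Sum>\<omega>\<in>configs n. w \<omega> * \<bar>\<mu> \<omega>\<bar>) - (\<Sum>\<omega>\<in>configs n. w \<omega> * (LINT x|lborel. normal_density (\<mu> \<omega>) \<sigma> x * \<bar>x\<bar>))\<bar>
     \<le> (\<Sum>\<omega>\<in>configs n. \<bar>w \<omega> * \<bar>\<mu> \<omega>\<bar> - w \<omega> * (LINT x|lborel. normal_density (\<mu> \<omega>) \<sigma> x * \<bar>x\<bar>)\<bar>)"
    unfolding sum_subtractf[symmetric] by (rule sum_abs)
  also have "\<dots> \<le> (\<Sum>\<omega>\<in>configs n. w \<omega> * \<sigma>)"
  proof (rule sum_mono)
    fix \<omega>
    have "\<bar>w \<omega> * \<bar>\<mu> \<omega>\<bar> - w \<omega> * (LINT x|lborel. normal_density (\<mu> \<omega>) \<sigma> x * \<bar>x\<bar>)\<bar>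
       = w \<omega> * \<bar>(LINT x|lborel. normal_density (\<mu> \<omega>) \<sigma> x * \<bar>x\<bar>) - \<bar>\<mu> \<omega>\<bar>\<bar>"
      unfolding right_diff_distrib[symmetric] abs_mult by (simp add: w_def abs_minus_commute)
    also have "\<dots> \<le> w \<omega> * \<sigma>"
      using gaussian_abs_mean(2)[OF \<sigma>] by (intro mult_left_mono) (auto simp: w_def)
    finally show "\<bar>w \<omega> * \<bar>\<mu> \<omega>\<bar> - w \<omega> * (LINT x|lborel. normal_density (\<mu> \<omega>) \<sigma> x * \<bar>x\<bar>)\<bar> \<le> w \<omega> * \<sigma>" .
  qed
  also have "\<dots> = Z * \<sigma>" by (simp add: Z_def partition_fun_def w_def sum_distrib_right)
  finally have "\<bar>(\<Sum>\<omega>\<in>configs n. w \<omega> * \<bar>\<mu> \<omega>\<bar>) - (\<Sum>\<omega>\<in>configs n. w \<omega> * (LINT x|lborel. normal_density (\<mu> \<omega>) \<sigma> x * \<bar>x\<bar>))\<bar> \<le> Z * \<sigma>" .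
  then show ?thesis
    unfolding E quot \<sigma>_def[symmetric] diff_divide_distrib[symmetric]
    using Z by (simp add: abs_divide pos_divide_le_eq mult.commute)
qed

section \<open>Limits of exponential integrals\<close>

lemma integrable_gaussian_moment:
  "integrable lborel (\<lambda>y::real. \<bar>y\<bar> ^ k * exp (- y\<^sup>2))"
proof -
  have "integrable lborel (\<lambda>y. sqrt pi * (normal_density 0 (1 / sqrt 2) y * \<bar>y - 0\<bar> ^ k))"
    by (intro integrable_mult_right integrable_normal_moment_abs) auto
  then show ?thesis by (simp add: normal_density_def power_divide mult_ac)
qed

text \<open>The exception at \<open>0\<close> is there for the integrands with a factor \<open>\<bar>y\<bar>\<close>.\<close>
lemma integral_pos_of_pos_off_0:
  fixes f :: "real \<Rightarrow> real"
  assumes "integrable lborel f" "\<And>y. 0 \<le> f y" "\<And>y. y \<noteq> 0 \<Longrightarrow> 0 < f y"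
  shows "0 < (LINT y|lborel. f y)"
proof (rule ccontr)
  assume "\<not> 0 < (LINT y|lborel. f y)"
  moreover have "0 \<le> (LINT y|lborel. f y)" using assms by (intro Bochner_Integration.integral_nonneg) auto
  ultimately have "(LINT y|lborel. f y) = 0" by simp
  then have "AE y in lborel. f y = 0"
    using integral_nonneg_eq_0_iff_AE[OF assms(1)] assms(2) by simp
  moreover have "AE y in lborel. y \<noteq> (0::real)" by (rule AE_lborel_singleton)
  ultimately have "AE y in (lborel :: real measure). False"
  proof eventually_elim
    case (elim y)
    then show False using assms(3)[of y] by simp
  qed
  then have "ae_filter (lborel :: real measure) = bot" unfolding eventually_False .
  then show False by (simp add: ae_filter_eq_bot_iff)
qed

definition gibbs_moment :: "nat \<Rightarrow> (real \<Rightarrow> real) \<Rightarrow> real" where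
  "gibbs_moment k F = (LINT y|lborel. \<bar>y\<bar> ^ k * exp (- F y))"

lemma integrable_gibbs:
  fixes F :: "real \<Rightarrow> real"
  assumes "continuous_on UNIV F" "\<And>y. y\<^sup>2 - C \<le> F y"
  shows "integrable lborel (\<lambda>y. \<bar>y\<bar> ^ k * exp (- F y))"
proof (rule Bochner_Integration.integrable_bound)
  show "integrable lborel (\<lambda>y::real. exp C * (\<bar>y\<bar> ^ k * exp (- y\<^sup>2)))"
    by (intro integrable_mult_right integrable_gaussian_moment)
  have "continuous_on UNIV (\<lambda>y. \<bar>y\<bar> ^ k * exp (- F y))" by (intro continuous_intros assms(1))
  then show "(\<lambda>y. \<bar>y\<bar> ^ k * exp (- F y)) \<in> borel_measurable lborel"
    by (simp add: borel_measurable_continuous_onI)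
  have "\<bar>y\<bar> ^ k * exp (- F y) \<le> exp C * (\<bar>y\<bar> ^ k * exp (- y\<^sup>2))" for y
  proof -
    have "exp (- F y) \<le> exp (C - y\<^sup>2)" using assms(2)[of y] by simp
    then have "\<bar>y\<bar> ^ k * exp (- F y) \<le> \<bar>y\<bar> ^ k * exp (C - y\<^sup>2)" by (intro mult_left_mono) auto
    then show ?thesis by (simp add: exp_diff exp_minus field_simps)
  qed
  then show "AE y in lborel. norm (\<bar>y\<bar> ^ k * exp (- F y)) \<le> norm (exp C * (\<bar>y\<bar> ^ k * exp (- y\<^sup>2)))"
    by (auto simp: abs_mult)
qed

lemma gibbs_moment_pos:
  assumes "continuous_on UNIV F" "\<And>y. y\<^sup>2 - C \<le> F y"
  shows "0 < gibbs_moment k F"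
  unfolding gibbs_moment_def using integrable_gibbs[OF assms]
  by (intro integral_pos_of_pos_off_0) auto

lemma gibbs_moment_tendsto:
  fixes F :: "nat \<Rightarrow> real \<Rightarrow> real"
  assumes cont: "\<And>n. continuous_on UNIV (F n)" "continuous_on UNIV g"
    and lim: "\<And>y. (\<lambda>n. F n y) \<longlonglongrightarrow> g y"
    and lower: "\<forall>\<^sub>F n in sequentially. \<forall>y. y\<^sup>2 - C \<le> F n y"
  shows "(\<lambda>n. gibbs_moment k (F n)) \<longlonglongrightarrow> gibbs_moment k g"
proof -
  obtain N where N: "\<And>n y. N \<le> n \<Longrightarrow> y\<^sup>2 - C \<le> F n y"
    using lower by (auto simp: eventually_sequentially)
  have meas: "(\<lambda>y. \<bar>y\<bar> ^ k * exp (- f y)) \<in> borel_measurable lborel" if "continuous_on UNIV f" for f :: "real \<Rightarrow> real"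
  proof -
    have "continuous_on UNIV (\<lambda>y. \<bar>y\<bar> ^ k * exp (- f y))" by (intro continuous_intros that)
    then show ?thesis by (simp add: borel_measurable_continuous_onI)
  qed
  have "(\<lambda>n. gibbs_moment k (F (n + N))) \<longlonglongrightarrow> gibbs_moment k g"
    unfolding gibbs_moment_def
  proof (rule integral_dominated_convergence[where w = "\<lambda>y. exp C * (\<bar>y\<bar> ^ k * exp (- y\<^sup>2))"])
    show "integrable lborel (\<lambda>y::real. exp C * (\<bar>y\<bar> ^ k * exp (- y\<^sup>2)))"
      by (intro integrable_mult_right integrable_gaussian_moment)
    show "AE y in lborel. (\<lambda>n. \<bar>y\<bar> ^ k * exp (- F (n + N) y)) \<longlonglongrightarrow> \<bar>y\<bar> ^ k * exp (- g y)"
      by (intro AE_I2 tendsto_intros LIMSEQ_ignore_initial_segment lim)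
    fix n
    have "\<bar>y\<bar> ^ k * exp (- F (n + N) y) \<le> exp C * (\<bar>y\<bar> ^ k * exp (- y\<^sup>2))" for y
    proof -
      have "exp (- F (n + N) y) \<le> exp (C - y\<^sup>2)" using N[of "n + N" y] by simp
      then have "\<bar>y\<bar> ^ k * exp (- F (n + N) y) \<le> \<bar>y\<bar> ^ k * exp (C - y\<^sup>2)" by (intro mult_left_mono) auto
      then show ?thesis by (simp add: exp_diff exp_minus field_simps)
    qed
    then show "AE y in lborel. norm (\<bar>y\<bar> ^ k * exp (- F (n + N) y)) \<le> exp C * (\<bar>y\<bar> ^ k * exp (- y\<^sup>2))"
      by (auto simp: abs_mult)
  qed (use meas cont in auto)
  then show ?thesis by (rule LIMSEQ_offset)
qed

text \<open>Split the integrals at \<open>\<bar>\<bar>y\<bar> - b\<bar> = e\<close>. Outside, one unit of \<open>F\<close> is spent on the integrable bound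
\<open>exp (C - y ^ 2)\<close> and the other \<open>L - 1\<close> units give the exponential factor with \<open>\<mu> + 2 * \<eta>\<close>; the normalization is
at least its part over an interval of length \<open>2 * \<rho>\<close>, where \<open>F \<le> \<mu> + \<eta>\<close>. Only the interval around \<open>+ b\<close> is
used, which suffices for a lower bound.\<close>
lemma laplace_estimate:
  fixes F :: "real \<Rightarrow> real"
  assumes cont: "continuous_on UNIV F" and lower: "\<And>y. y\<^sup>2 - C \<le> F y" and L: "1 \<le> L"
    and e: "0 < e" and far: "\<And>y. e \<le> \<bar>\<bar>y\<bar> - b\<bar> \<Longrightarrow> \<mu> + 2 * \<eta> \<le> F y"
    and \<rho>: "0 < \<rho>" and near: "\<And>y. \<bar>y - b\<bar> \<le> \<rho> \<Longrightarrow> F y \<le> \<mu> + \<eta>"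
  shows "\<bar>gibbs_moment 1 (\<lambda>y. L * F y) / gibbs_moment 0 (\<lambda>y. L * F y) - b\<bar>
     \<le> e + exp C * (gibbs_moment 1 power2 + \<bar>b\<bar> * gibbs_moment 0 power2) / (2 * \<rho>) * exp (\<mu> + 2 * \<eta> - L * \<eta>)"
proof -
  define D where "D = gibbs_moment 0 (\<lambda>y. L * F y)"
  define w where "w = (\<lambda>y. exp (- (L * F y)))"
  define J where "J = gibbs_moment 1 power2 + \<bar>b\<bar> * gibbs_moment 0 power2"
  define M where "M = exp (- (L - 1) * (\<mu> + 2 * \<eta>))"
  have cont': "continuous_on UNIV (\<lambda>y. L * F y)" by (intro continuous_intros cont)
  have lower': "y\<^sup>2 - L * C \<le> L * F y" for y
  proof -
    have "y\<^sup>2 \<le> L * y\<^sup>2" using L by (simp add: mult_le_cancel_right1)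
    moreover have "L * (y\<^sup>2 - C) \<le> L * F y" using L lower by (intro mult_left_mono) auto
    ultimately show ?thesis by (simp add: algebra_simps)
  qed
  have int: "integrable lborel (\<lambda>y. \<bar>y\<bar> ^ k * w y)" for k
    unfolding w_def by (rule integrable_gibbs[OF cont' lower'])
  have int0: "integrable lborel w" and int1: "integrable lborel (\<lambda>y. \<bar>y\<bar> * w y)"
    using int[of 0] int[of 1] by simp_all
  have D_eq: "D = (LINT y|lborel. w y)" by (simp add: D_def gibbs_moment_def w_def)
  have D: "0 < D" unfolding D_def by (rule gibbs_moment_pos[OF cont' lower'])
  have N_eq: "gibbs_moment 1 (\<lambda>y. L * F y) = (LINT y|lborel. \<bar>y\<bar> * w y)" by (simp add: gibbs_moment_def w_def)
  have J_int: "integrable lborel (\<lambda>y::real. \<bar>y\<bar> * exp (- y\<^sup>2))" "integrable lborel (\<lambda>y::real. exp (- y\<^sup>2))"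
    using integrable_gaussian_moment[of 1] integrable_gaussian_moment[of 0] by simp_all
  have J_int': "integrable lborel (\<lambda>y. (\<bar>y\<bar> + \<bar>b\<bar>) * exp (- y\<^sup>2))"
    unfolding distrib_right by (intro Bochner_Integration.integrable_add integrable_mult_right J_int)
  have J_eq: "J = (LINT y|lborel. (\<bar>y\<bar> + \<bar>b\<bar>) * exp (- y\<^sup>2))"
    unfolding distrib_right J_def gibbs_moment_def
    by (subst Bochner_Integration.integral_add) (auto intro!: J_int)
  have J0: "0 \<le> J" unfolding J_eq by (intro Bochner_Integration.integral_nonneg) auto

  have "\<bar>(LINT y|lborel. \<bar>y\<bar> * w y) - b * D\<bar> = \<bar>LINT y|lborel. \<bar>y\<bar> * w y - b * w y\<bar>"
    unfolding D_eq by (subst Bochner_Integration.integral_diff) (auto intro!: int0 int1)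
  also have "\<dots> \<le> (LINT y|lborel. \<bar>\<bar>y\<bar> * w y - b * w y\<bar>)"
    using integral_norm_bound[of lborel "\<lambda>y. \<bar>y\<bar> * w y - b * w y"] by simp
  also have "\<dots> \<le> (LINT y|lborel. e * w y + exp C * M * ((\<bar>y\<bar> + \<bar>b\<bar>) * exp (- y\<^sup>2)))"
  proof (rule integral_mono)
    show "integrable lborel (\<lambda>y. \<bar>\<bar>y\<bar> * w y - b * w y\<bar>)"
      by (intro integrable_abs Bochner_Integration.integrable_diff int1 integrable_mult_right int0)
    show "integrable lborel (\<lambda>y. e * w y + exp C * M * ((\<bar>y\<bar> + \<bar>b\<bar>) * exp (- y\<^sup>2)))"
      by (intro Bochner_Integration.integrable_add integrable_mult_right int0 J_int')
    fix y
    have w0: "0 \<le> w y" by (simp add: w_def)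
    have split: "\<bar>\<bar>y\<bar> * w y - b * w y\<bar> = \<bar>\<bar>y\<bar> - b\<bar> * w y"
      unfolding left_diff_distrib[symmetric] abs_mult using w0 by simp
    have M0: "0 \<le> exp C * M * ((\<bar>y\<bar> + \<bar>b\<bar>) * exp (- y\<^sup>2))" by (simp add: M_def)
    show "\<bar>\<bar>y\<bar> * w y - b * w y\<bar> \<le> e * w y + exp C * M * ((\<bar>y\<bar> + \<bar>b\<bar>) * exp (- y\<^sup>2))"
    proof (cases "e \<le> \<bar>\<bar>y\<bar> - b\<bar>")
      case False
      then have "\<bar>\<bar>y\<bar> - b\<bar> * w y \<le> e * w y" using w0 by (intro mult_right_mono) auto
      then show ?thesis using split M0 by linarith
    next
      case True
      have "(L - 1) * (\<mu> + 2 * \<eta>) \<le> (L - 1) * F y"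
        using far[OF True] L by (intro mult_left_mono) auto
      then have "- (L * F y) \<le> C - (L - 1) * (\<mu> + 2 * \<eta>) - y\<^sup>2"
        using lower[of y] by (simp add: left_diff_distrib)
      then have "- (L * F y) \<le> C + - (L - 1) * (\<mu> + 2 * \<eta>) + - y\<^sup>2" by (simp add: algebra_simps)
      then have "w y \<le> exp (C + - (L - 1) * (\<mu> + 2 * \<eta>) + - y\<^sup>2)" unfolding w_def exp_le_cancel_iff .
      also have "\<dots> = exp C * M * exp (- y\<^sup>2)" unfolding exp_add M_def ..
      finally have "\<bar>\<bar>y\<bar> - b\<bar> * w y \<le> (\<bar>y\<bar> + \<bar>b\<bar>) * (exp C * M * exp (- y\<^sup>2))"
        using w0 by (intro mult_mono) auto
      then have "\<bar>\<bar>y\<bar> - b\<bar> * w y \<le> exp C * M * ((\<bar>y\<bar> + \<bar>b\<bar>) * exp (- y\<^sup>2))" by (simp only: mult_ac)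
      moreover have "0 \<le> e * w y" using e w0 by simp
      ultimately show ?thesis using split by linarith
    qed
  qed
  also have "\<dots> = e * D + exp C * M * J"
    unfolding J_eq D_eq
    by (subst Bochner_Integration.integral_add) (auto intro!: int0 J_int')
  finally have num: "\<bar>(LINT y|lborel. \<bar>y\<bar> * w y) - b * D\<bar> \<le> e * D + exp C * M * J" .

  have D_lower: "2 * \<rho> * exp (- L * (\<mu> + \<eta>)) \<le> D"
  proof -
    have "2 * \<rho> * exp (- L * (\<mu> + \<eta>)) = (LINT y|lborel. indicator {b - \<rho>..b + \<rho>} y * exp (- L * (\<mu> + \<eta>)))"
      using \<rho> by simp
    also have "\<dots> \<le> D"
      unfolding D_eq
    proof (rule integral_mono)
      show "integrable lborel (\<lambda>y. indicator {b - \<rho>..b + \<rho>} y * exp (- L * (\<mu> + \<eta>)))"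
        by (intro integrable_mult_left) (auto intro!: integrable_real_indicator simp: emeasure_lborel_Icc_eq)
      fix y
      show "indicator {b - \<rho>..b + \<rho>} y * exp (- L * (\<mu> + \<eta>)) \<le> w y"
      proof (cases "y \<in> {b - \<rho>..b + \<rho>}")
        case True
        then have "F y \<le> \<mu> + \<eta>" by (intro near) auto
        then have "L * F y \<le> L * (\<mu> + \<eta>)" using L by (intro mult_left_mono) auto
        then show ?thesis using True by (simp add: w_def)
      qed (simp add: w_def)
    qed (rule int0)
    finally show ?thesis .
  qed
  have "exp C * M * J / D \<le> exp C * M * J / (2 * \<rho> * exp (- L * (\<mu> + \<eta>)))"
    using D_lower J0 \<rho> D by (intro divide_left_mono mult_pos_pos mult_nonneg_nonneg) (auto simp: M_def)
  also have "\<dots> = exp C * J / (2 * \<rho>) * (M / exp (- L * (\<mu> + \<eta>)))" by simp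
  also have "M / exp (- L * (\<mu> + \<eta>)) = exp (\<mu> + 2 * \<eta> - L * \<eta>)"
    unfolding M_def exp_diff[symmetric] by (simp add: algebra_simps)
  finally have tail: "exp C * M * J / D \<le> exp C * J / (2 * \<rho>) * exp (\<mu> + 2 * \<eta> - L * \<eta>)" .
  have "\<bar>(LINT y|lborel. \<bar>y\<bar> * w y) / D - b\<bar> = \<bar>(LINT y|lborel. \<bar>y\<bar> * w y) - b * D\<bar> / D"
    using D by (simp add: field_simps flip: abs_divide) (simp add: abs_mult field_simps)
  also have "\<dots> \<le> (e * D + exp C * M * J) / D" using num D by (intro divide_right_mono) auto
  also have "\<dots> = e + exp C * M * J / D" using D by (simp add: add_divide_distrib)
  finally show ?thesis using tail unfolding N_eq D_def[symmetric] J_def[symmetric] by simp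
qed

text \<open>On a bounded set compactness keeps \<open>g\<close>, hence \<open>F n\<close>, above its minimum by a fixed amount unless \<open>\<bar>y\<bar>\<close> is near
\<open>b\<close>; outside it the quadratic lower bound does. Then \<open>laplace_estimate\<close> applies for every large \<open>n\<close>.\<close>
lemma laplace_concentration:
  fixes F :: "nat \<Rightarrow> real \<Rightarrow> real"
  assumes cont: "\<And>n. continuous_on UNIV (F n)" "continuous_on UNIV g"
    and unif: "\<And>R e. 0 < e \<Longrightarrow> \<forall>\<^sub>F n in sequentially. \<forall>y. \<bar>y\<bar> \<le> R \<longrightarrow> \<bar>F n y - g y\<bar> < e"
    and lower: "\<forall>\<^sub>F n in sequentially. \<forall>y. y\<^sup>2 - C \<le> F n y"
    and min: "\<And>y. \<bar>y\<bar> \<noteq> b \<Longrightarrow> g b < g y" and b: "0 \<le> b"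
    and L: "filterlim L at_top sequentially"
  shows "(\<lambda>n. gibbs_moment 1 (\<lambda>y. L n * F n y) / gibbs_moment 0 (\<lambda>y. L n * F n y)) \<longlonglongrightarrow> b"
proof (rule tendstoI)
  fix \<epsilon> :: real assume \<epsilon>: "0 < \<epsilon>"
  define e where "e = \<epsilon> / 2"
  have e: "0 < e" using \<epsilon> by (simp add: e_def)
  define \<mu> where "\<mu> = g b"
  \<comment> \<open>Outside \<open>[-R, R]\<close> the lower bound exceeds \<open>\<mu> + 2\<close>, hence \<open>\<mu> + 2 * \<eta>\<close> for \<open>\<eta> \<le> 1\<close>.\<close>
  define R where "R = 1 + \<bar>C + \<mu> + 2\<bar>"
  have R: "C + \<mu> + 2 \<le> R\<^sup>2" "0 < R"
  proof -
    show "0 < R" by (simp add: R_def)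
    have "R \<le> R\<^sup>2" by (rule self_le_power) (auto simp: R_def)
    then show "C + \<mu> + 2 \<le> R\<^sup>2" by (simp add: R_def)
  qed
  define S where "S = {y. \<bar>y\<bar> \<le> R} \<inter> {y. e \<le> \<bar>\<bar>y\<bar> - b\<bar>}"
  have "\<exists>\<eta>>0. \<eta> \<le> 1 \<and> (\<forall>y\<in>S. \<mu> + 3 * \<eta> \<le> g y)"
  proof (cases "S = {}")
    case True
    then show ?thesis by (intro exI[of _ 1]) auto
  next
    case False
    have "compact S"
    proof -
      have "compact {- R..R}" "closed {y. e \<le> \<bar>\<bar>y\<bar> - b\<bar>}"
        by (auto intro!: closed_Collect_le continuous_intros)
      moreover have "S = {- R..R} \<inter> {y. e \<le> \<bar>\<bar>y\<bar> - b\<bar>}" by (auto simp: S_def)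
      ultimately show ?thesis using compact_Int_closed by metis
    qed
    then obtain z where z: "z \<in> S" "\<forall>y\<in>S. g z \<le> g y"
      using continuous_attains_inf[OF _ False, of g] continuous_on_subset[OF cont(2)] by blast
    have "\<mu> < g z" unfolding \<mu>_def using z e by (intro min) (auto simp: S_def)
    then show ?thesis using z by (intro exI[of _ "Min {1, (g z - \<mu>) / 3}"]) (auto simp: min_def field_simps)
  qed
  then obtain \<eta> where \<eta>: "0 < \<eta>" "\<eta> \<le> 1" "\<And>y. y \<in> S \<Longrightarrow> \<mu> + 3 * \<eta> \<le> g y" by blast
  have "isCont g b" using cont(2) by (simp add: continuous_on_eq_continuous_at)
  then obtain \<rho>' where \<rho>': "0 < \<rho>'" "\<And>y. dist y b < \<rho>' \<Longrightarrow> dist (g y) (g b) < \<eta> / 2"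
    using \<eta>(1) unfolding continuous_at_eps_delta by (metis half_gt_zero)
  define \<rho> where "\<rho> = \<rho>' / 2"
  have \<rho>: "0 < \<rho>" "\<And>y. \<bar>y - b\<bar> \<le> \<rho> \<Longrightarrow> g y \<le> \<mu> + \<eta> / 2"
  proof -
    show "0 < \<rho>" using \<rho>'(1) by (simp add: \<rho>_def)
    fix y assume "\<bar>y - b\<bar> \<le> \<rho>"
    then have "dist y b < \<rho>'" using \<rho>'(1) by (simp add: \<rho>_def dist_real_def)
    then have "\<bar>g y - g b\<bar> < \<eta> / 2" using \<rho>'(2)[of y] by (simp add: dist_real_def)
    then show "g y \<le> \<mu> + \<eta> / 2" unfolding \<mu>_def by linarith
  qed
  define B where "B = exp C * (gibbs_moment 1 power2 + \<bar>b\<bar> * gibbs_moment 0 power2) / (2 * \<rho>)"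
  have "(\<lambda>n. B * (exp (\<mu> + 2 * \<eta>) * exp (- (L n * \<eta>)))) \<longlonglongrightarrow> B * (exp (\<mu> + 2 * \<eta>) * 0)"
  proof (intro tendsto_mult tendsto_const)
    have "filterlim (\<lambda>n. L n * \<eta>) at_top sequentially"
      using L \<eta>(1) by (intro filterlim_at_top_mult_tendsto_pos[OF tendsto_const]) auto
    then show "(\<lambda>n. exp (- (L n * \<eta>))) \<longlonglongrightarrow> 0"
      by (intro filterlim_compose[OF exp_at_bot] filterlim_uminus_at_bot[THEN iffD2]) simp
  qed
  then have small: "\<forall>\<^sub>F n in sequentially. B * (exp (\<mu> + 2 * \<eta>) * exp (- (L n * \<eta>))) < e"
    using e by (intro order_tendstoD) auto
  have big: "\<forall>\<^sub>F n in sequentially. 1 \<le> L n"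
    using L by (simp add: filterlim_at_top)
  from small big lower unif[of "\<eta> / 2" R, OF half_gt_zero[OF \<eta>(1)]]
    unif[of "\<eta> / 2" "\<bar>b\<bar> + \<rho>", OF half_gt_zero[OF \<eta>(1)]]
  show "\<forall>\<^sub>F n in sequentially. dist (gibbs_moment 1 (\<lambda>y. L n * F n y) / gibbs_moment 0 (\<lambda>y. L n * F n y)) b < \<epsilon>"
  proof eventually_elim
    case (elim n)
    have "\<bar>gibbs_moment 1 (\<lambda>y. L n * F n y) / gibbs_moment 0 (\<lambda>y. L n * F n y) - b\<bar>
       \<le> e + exp C * (gibbs_moment 1 power2 + \<bar>b\<bar> * gibbs_moment 0 power2) / (2 * \<rho>) * exp (\<mu> + 2 * \<eta> - L n * \<eta>)"
    proof (rule laplace_estimate[OF cont(1) _ _ e _ \<rho>(1)])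
      fix y
      show "\<mu> + 2 * \<eta> \<le> F n y" if far: "e \<le> \<bar>\<bar>y\<bar> - b\<bar>"
      proof (cases "\<bar>y\<bar> \<le> R")
        case True
        then have "\<mu> + 3 * \<eta> \<le> g y" using far by (intro \<eta>(3)) (auto simp: S_def)
        moreover have "\<bar>F n y - g y\<bar> < \<eta> / 2" using elim True by blast
        ultimately show ?thesis using \<eta>(1) by linarith
      next
        case False
        then have "R\<^sup>2 \<le> y\<^sup>2" using R by (intro iffD1[OF abs_le_square_iff]) auto
        moreover have "y\<^sup>2 - C \<le> F n y" using elim by blast
        ultimately show ?thesis using R \<eta>(2) by linarith
      qed
      show "F n y \<le> \<mu> + \<eta>" if "\<bar>y - b\<bar> \<le> \<rho>"
      proof -
        have "\<bar>y\<bar> \<le> \<bar>b\<bar> + \<rho>" using that by linarith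
        then have "\<bar>F n y - g y\<bar> < \<eta> / 2" using elim by blast
        then show ?thesis using \<rho>(2)[OF that] by linarith
      qed
    qed (use elim in auto)
    also have "exp (\<mu> + 2 * \<eta> - L n * \<eta>) = exp (\<mu> + 2 * \<eta>) * exp (- (L n * \<eta>))"
      by (simp flip: exp_add)
    finally show ?case using elim(1) unfolding B_def[symmetric] dist_real_def e_def by linarith
  qed
qed

section \<open>Minimizers of the limit polynomial\<close>

lemma g_poly_eq: "g_poly l x = quad_coeff l * x\<^sup>2 - 3 / 4 * x ^ 4 + 9 / 40 * x ^ 6"
  by (simp add: g_poly_def quad_coeff_def c4_def c6_def)

lemma limit_poly_1: "limit_poly l 1 = g_poly l"
  by (simp add: fun_eq_iff limit_poly_def g_poly_eq)

lemma limit_poly_0: "limit_poly l 0 = gt_poly"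
  by (simp add: fun_eq_iff limit_poly_def gt_poly_def c6_def)

text \<open>The constant \<open>l_c\<close> is the value of \<open>l\<close> for which \<open>g_poly l\<close> has its positive minimum at height \<open>0\<close>; in terms of
the quadratic coefficient this threshold is \<open>5 / 8\<close>.\<close>
lemma quad_coeff_bounds:
  shows "case_a l lt \<or> case_b l lt \<or> case_c l lt \<Longrightarrow> quad_coeff l < 5 / 8"
    and "case_d l lt \<Longrightarrow> quad_coeff l = 5 / 8"
proof -
  define D where "D = (deriv ^^ 2) K_curve beta_c"
  have lc: "D - l_c = 5 / (4 * beta_c)" by (simp add: l_c_def D_def)
  have 58: "1 / 2 * beta_c * (5 / (4 * beta_c)) = 5 / 8" using beta_c_pos by simp
  show "quad_coeff l < 5 / 8" if "case_a l lt \<or> case_b l lt \<or> case_c l lt"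
  proof -
    have "0 < D - l_c" unfolding lc using beta_c_pos by simp
    then have "l_c < D" by simp
    then have "D - l < D - l_c" using that by (auto simp: case_a_def case_b_def case_c_def D_def)
    then have "1 / 2 * beta_c * (D - l) < 1 / 2 * beta_c * (5 / (4 * beta_c))"
      unfolding lc using beta_c_pos by (intro mult_strict_left_mono) auto
    then show ?thesis unfolding 58 by (simp add: quad_coeff_def D_def)
  qed
  show "quad_coeff l = 5 / 8" if "case_d l lt"
    using that lc 58 by (simp add: case_d_def quad_coeff_def D_def)
qed

text \<open>As a cubic in \<open>x ^ 2\<close>, \<open>g - g xbar\<close> has a double zero at the larger critical point \<open>u = xbar ^ 2\<close>. By comparison of
coefficients its third zero is \<open>w = 10 / 3 - 2 * u\<close>, and \<open>u \<ge> 5 / 3\<close> is equivalent to the bound on the quadratic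
coefficient.\<close>
lemma g_poly_factorization:
  assumes a: "quad_coeff l \<le> 5 / 8"
  shows "\<exists>w. xbar l > 0 \<and> w \<le> 0 \<and> (quad_coeff l < 5 / 8 \<longrightarrow> w < 0) \<and>
      (\<forall>x. g_poly l x = 9 / 40 * (xbar l) ^ 4 * w + 9 / 40 * (x\<^sup>2 - (xbar l)\<^sup>2)\<^sup>2 * (x\<^sup>2 - w))"
proof -
  define a where "a = quad_coeff l"
  define q where "q = sqrt (9 / 4 - 27 / 10 * a)"
  define u where "u = (3 / 2 + q) / (27 / 20)"
  define w where "w = 10 / 3 - 2 * u"
  define b where "b = sqrt u"
  have q2: "q\<^sup>2 = 9 / 4 - 27 / 10 * a" using assms by (simp add: q_def a_def)
  have "sqrt ((3 / 4)\<^sup>2) \<le> q" unfolding q_def using assms by (intro real_sqrt_le_mono) (simp add: a_def power2_eq_square)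
  then have q34: "3 / 4 \<le> q" by simp
  then have u: "5 / 3 \<le> u" by (simp add: u_def)
  have w: "w \<le> 0" using u by (simp add: w_def)
  have w': "w < 0" if "a < 5 / 8"
  proof -
    have "sqrt ((3 / 4)\<^sup>2) < q" unfolding q_def using that by (intro real_sqrt_less_mono) (simp add: power2_eq_square)
    then have "5 / 3 < u" by (simp add: u_def)
    then show ?thesis by (simp add: w_def)
  qed
  have crit: "a = 3 / 2 * u - 27 / 40 * u\<^sup>2"
    using q2 by (simp add: u_def power2_eq_square field_simps)
  have b: "b > 0" "b\<^sup>2 = u" using u by (auto simp: b_def)
  have fac: "g_poly l x = 9 / 40 * b ^ 4 * w + 9 / 40 * (x\<^sup>2 - b\<^sup>2)\<^sup>2 * (x\<^sup>2 - w)" for x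
  proof -
    define z where "z = x\<^sup>2"
    have "x ^ 4 = z\<^sup>2" "x ^ 6 = z ^ 3" "b ^ 4 = u\<^sup>2" by (simp_all add: z_def b(2)[symmetric] flip: power_mult)
    then show ?thesis
      unfolding g_poly_eq b(2) z_def[symmetric] a_def[symmetric] crit w_def
      by (simp add: field_simps power2_eq_square power3_eq_cube)
  qed
  have gb: "g_poly l b = 9 / 40 * b ^ 4 * w" using fac[of b] by simp
  have min: "g_poly l b \<le> g_poly l x" for x
  proof -
    have "0 \<le> x\<^sup>2 - w" using w zero_le_power2[of x] by linarith
    then have "0 \<le> 9 / 40 * (x\<^sup>2 - b\<^sup>2)\<^sup>2 * (x\<^sup>2 - w)" by (intro mult_nonneg_nonneg) auto
    then show ?thesis unfolding gb using fac[of x] by linarith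
  qed
  have uniq: "x = b" if x: "x > 0" "g_poly l x \<le> g_poly l b" for x
  proof -
    have "0 < x\<^sup>2" using x(1) by simp
    then have "0 < x\<^sup>2 - w" using w by linarith
    moreover have "9 / 40 * (x\<^sup>2 - b\<^sup>2)\<^sup>2 * (x\<^sup>2 - w) \<le> 0" using x(2) fac[of x] gb by linarith
    ultimately have "(x\<^sup>2 - b\<^sup>2)\<^sup>2 \<le> 0" by (simp add: mult_le_0_iff)
    then have "x\<^sup>2 = b\<^sup>2" by simp
    then show ?thesis by (rule power2_eq_imp_eq) (use x(1) b(1) in simp_all)
  qed
  have "xbar l = b"
    unfolding xbar_def global_min_points_def using b min uniq by (intro the_equality) auto
  then show ?thesis using b w w' fac by (intro exI[of _ w]) (simp add: a_def)
qed

section \<open>Limit of the thermodynamic magnetization\<close>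

context tricritical_scaling
begin

abbreviation "\<beta> n \<equiv> beta_c + h n"
abbreviation "K n \<equiv> K_path l lt (h n)"

lemma ev_params_pos: "\<forall>\<^sub>F n in sequentially. 0 < \<beta> n \<and> 0 < K n"
proof -
  have "(\<lambda>n. K n) \<longlonglongrightarrow> K_curve beta_c" using filterlim_compose[OF path_limits(3) h_lim] .
  moreover have "0 < K_curve beta_c" using beta_c_pos by (simp add: K_curve_def)
  ultimately have "\<forall>\<^sub>F n in sequentially. 0 < K n" by (rule order_tendstoD)
  with ev_h show ?thesis by eventually_elim (use beta_c_pos in auto)
qed

lemma Phi_neg_iff: "0 < s n \<Longrightarrow> (\<exists>y. Phi n y < 0) \<longleftrightarrow> (\<exists>z. G_fun (\<beta> n) (K n) z < 0)"
  unfolding Phi_def by (auto simp: mult_less_0_iff intro: exI[of _ "s n * _"])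

text \<open>The rescaled minimum points are bounded, by the quadratic lower bound, and almost minimize \<open>g_poly l\<close>. In the
factorization, \<open>x ^ 2 - w\<close> stays away from \<open>0\<close> along them: because \<open>w < 0\<close>, or because negative values of \<open>Phi\<close> do not
occur near \<open>0\<close>. So the squared factor must tend to \<open>0\<close>.\<close>
lemma magnetization_limit:
  assumes \<tau>: "\<tau> = 1" and a: "quad_coeff l \<le> 5 / 8"
    and neg: "\<forall>\<^sub>F n in sequentially. \<exists>z. G_fun (\<beta> n) (K n) z < 0"
  shows "(\<lambda>n. s n * magnetization (\<beta> n) (K n)) \<longlonglongrightarrow> xbar l"
proof -
  define b where "b = xbar l"
  obtain w where b: "b > 0" and w: "w \<le> 0" "quad_coeff l < 5 / 8 \<Longrightarrow> w < 0"
    and fac: "\<And>x. g_poly l x = 9 / 40 * b ^ 4 * w + 9 / 40 * (x\<^sup>2 - b\<^sup>2)\<^sup>2 * (x\<^sup>2 - w)"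
    using g_poly_factorization[OF a] unfolding b_def by blast
  define y where "y = (\<lambda>n. s n * magnetization (\<beta> n) (K n))"
  have min: "\<forall>\<^sub>F n in sequentially. 0 < y n \<and> Phi n (y n) < 0 \<and> Phi n (y n) \<le> Phi n b"
    using neg ev_s ev_params_pos
  proof eventually_elim
    case (elim n)
    then obtain z where z: "G_fun (\<beta> n) (K n) z < 0" by blast
    note M = M_set_of_negative_value[OF _ _ z]
    have "magnetization (\<beta> n) (K n) \<in> M_set (\<beta> n) (K n)" using M(2) elim by blast
    then have "G_fun (\<beta> n) (K n) (magnetization (\<beta> n) (K n)) \<le> G_fun (\<beta> n) (K n) (b / s n)"
      by (simp add: M_set_def global_min_points_def)
    moreover have "y n / s n = magnetization (\<beta> n) (K n)" using elim by (simp add: y_def)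
    ultimately show ?case using M(1,3) elim
      unfolding Phi_def by (auto simp: y_def mult_less_0_iff intro!: mult_left_mono)
  qed
  obtain C where C: "\<forall>\<^sub>F n in sequentially. \<forall>y. y\<^sup>2 - C \<le> Phi n y" using Phi_lower_bound by blast
  define R where "R = 1 + \<bar>C\<bar>"
  have bounded: "\<forall>\<^sub>F n in sequentially. \<bar>y n\<bar> \<le> R"
    using C min
  proof eventually_elim
    case (elim n)
    have "(y n)\<^sup>2 - C \<le> Phi n (y n)" using elim by blast
    then have "(y n)\<^sup>2 \<le> \<bar>C\<bar>" using elim by linarith
    also have "\<dots> \<le> R" by (simp add: R_def)
    also have "\<dots> \<le> R\<^sup>2" by (rule self_le_power) (auto simp: R_def)
    finally have "\<bar>y n\<bar> \<le> \<bar>R\<bar>" by (rule iffD2[OF abs_le_square_iff])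
    then show ?case by (simp add: R_def)
  qed
  have "\<exists>\<delta>>0. \<forall>\<^sub>F n in sequentially. \<delta> \<le> (y n)\<^sup>2 - w"
  proof (cases "quad_coeff l < 5 / 8")
    case True
    then show ?thesis using w by (intro exI[of _ "- w"]) auto
  next
    case False
    then have "0 < \<tau>\<^sup>2 * quad_coeff l"
      using a \<tau> by simp
    from Phi_nonneg_near_0[OF this] obtain r where r: "r > 0"
      "\<forall>\<^sub>F n in sequentially. \<forall>y. \<bar>y\<bar> \<le> r \<longrightarrow> 0 \<le> Phi n y" by blast
    from r(2) min have "\<forall>\<^sub>F n in sequentially. r\<^sup>2 \<le> (y n)\<^sup>2 - w"
    proof eventually_elim
      case (elim n)
      then have "\<not> \<bar>y n\<bar> \<le> r" by fastforce
      then have "r\<^sup>2 \<le> (y n)\<^sup>2" using r(1) by (intro iffD1[OF abs_le_square_iff]) auto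
      then show ?case using w by simp
    qed
    then show ?thesis using r(1) by (intro exI[of _ "r\<^sup>2"]) auto
  qed
  then obtain \<delta> where \<delta>: "0 < \<delta>" "\<forall>\<^sub>F n in sequentially. \<delta> \<le> (y n)\<^sup>2 - w" by blast
  have "y \<longlonglongrightarrow> b"
  proof (rule tendstoI)
    fix \<epsilon> :: real assume \<epsilon>: "0 < \<epsilon>"
    \<comment> \<open>Chosen so that an excess below \<open>2 * e\<close> over the minimum of \<open>g_poly l\<close> forces
      \<open>\<bar>(y n)\<^sup>2 - b\<^sup>2\<bar> < \<epsilon> * b\<close>.\<close>
    define e where "e = 9 / 40 * (\<epsilon> * b)\<^sup>2 * \<delta> / 2"
    have e: "0 < e" using \<epsilon> b \<delta>(1) by (simp add: e_def)
    from Phi_uniform[OF e, of R] Phi_uniform[OF e, of b] bounded min \<delta>(2)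
    show "\<forall>\<^sub>F n in sequentially. dist (y n) b < \<epsilon>"
    proof eventually_elim
      case (elim n)
      have "\<bar>Phi n (y n) - g_poly l (y n)\<bar> < e" "\<bar>Phi n b - g_poly l b\<bar> < e"
        using elim b unfolding \<tau> limit_poly_1 by auto
      then have "g_poly l (y n) < g_poly l b + 2 * e" using elim by linarith
      then have "9 / 40 * ((y n)\<^sup>2 - b\<^sup>2)\<^sup>2 * ((y n)\<^sup>2 - w) < 9 / 40 * (\<epsilon> * b)\<^sup>2 * \<delta>"
        using fac[of "y n"] fac[of b] by (simp add: e_def mult.commute)
      moreover have "9 / 40 * ((y n)\<^sup>2 - b\<^sup>2)\<^sup>2 * \<delta> \<le> 9 / 40 * ((y n)\<^sup>2 - b\<^sup>2)\<^sup>2 * ((y n)\<^sup>2 - w)"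
        using elim by (intro mult_left_mono) auto
      ultimately have "9 / 40 * ((y n)\<^sup>2 - b\<^sup>2)\<^sup>2 * \<delta> < 9 / 40 * (\<epsilon> * b)\<^sup>2 * \<delta>"
        by (rule le_less_trans[rotated])
      then have "9 / 40 * ((y n)\<^sup>2 - b\<^sup>2)\<^sup>2 < 9 / 40 * (\<epsilon> * b)\<^sup>2"
        by (rule mult_right_less_imp_less) (use \<delta>(1) in simp)
      then have "((y n)\<^sup>2 - b\<^sup>2)\<^sup>2 < (\<epsilon> * b)\<^sup>2" by simp
      then have "\<bar>(y n)\<^sup>2 - b\<^sup>2\<bar>\<^sup>2 < (\<epsilon> * b)\<^sup>2" by simp
      then have "\<bar>(y n)\<^sup>2 - b\<^sup>2\<bar> < \<epsilon> * b"
        by (rule power2_less_imp_less) (use \<epsilon> b in simp)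
      moreover have "(y n)\<^sup>2 - b\<^sup>2 = (y n - b) * (y n + b)" by (simp add: algebra_simps power2_eq_square)
      ultimately have "\<bar>y n - b\<bar> * (y n + b) < \<epsilon> * b" using elim b by (simp add: abs_mult)
      moreover have "\<bar>y n - b\<bar> * b \<le> \<bar>y n - b\<bar> * (y n + b)" using elim by (intro mult_left_mono) auto
      ultimately have "\<bar>y n - b\<bar> * b < \<epsilon> * b" by linarith
      then show "dist (y n) b < \<epsilon>" using b by (simp add: dist_real_def)
    qed
  qed
  then show ?thesis unfolding y_def b_def .
qed

lemma negative_value_of_limit:
  assumes "limit_poly l \<tau> y < 0"
  shows "\<forall>\<^sub>F n in sequentially. \<exists>z. G_fun (\<beta> n) (K n) z < 0"
proof -
  have "\<forall>\<^sub>F n in sequentially. Phi n y < 0" using Phi_pointwise assms by (rule order_tendstoD)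
  with ev_s show ?thesis by eventually_elim (use Phi_neg_iff in blast)
qed

section \<open>Limit of the finite-size expectation\<close>

lemma continuous_Phi: "continuous_on UNIV (Phi n)"
  unfolding Phi_def[abs_def] divide_inverse
  by (intro continuous_intros)

lemma continuous_limit_poly: "continuous_on UNIV (limit_poly l \<tau>)"
  unfolding limit_poly_def[abs_def] by (intro continuous_intros)

lemma limit_poly_lower_bound:
  "\<exists>C. (\<forall>y. y\<^sup>2 - C \<le> limit_poly l \<tau> y) \<and> (\<forall>\<^sub>F n in sequentially. \<forall>y. y\<^sup>2 - C \<le> Phi n y)"
proof -
  obtain C where C: "\<forall>\<^sub>F n in sequentially. \<forall>y. y\<^sup>2 - C \<le> Phi n y" using Phi_lower_bound by blast
  have "y\<^sup>2 - C \<le> limit_poly l \<tau> y" for y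
  proof (rule tendsto_lowerbound[OF Phi_pointwise])
    show "\<forall>\<^sub>F n in sequentially. y\<^sup>2 - C \<le> Phi n y" using C by eventually_elim blast
  qed simp
  with C show ?thesis by blast
qed

lemma rescaled_moment:
  assumes "0 < s n"
  shows "(LINT x|lborel. \<bar>x\<bar> ^ k * exp (- (real n * G_fun (\<beta> n) (K n) x)))
     = gibbs_moment k (\<lambda>y. real n / s n ^ 6 * Phi n y) / s n ^ Suc k"
proof -
  have "(LINT x|lborel. \<bar>x\<bar> ^ k * exp (- (real n * G_fun (\<beta> n) (K n) x)))
     = \<bar>1 / s n\<bar> *\<^sub>R (LINT y|lborel. \<bar>0 + 1 / s n * y\<bar> ^ k * exp (- (real n * G_fun (\<beta> n) (K n) (0 + 1 / s n * y))))"
    using assms by (intro lborel_integral_real_affine) auto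
  also have "\<dots> = 1 / s n * (LINT y|lborel. (1 / s n ^ k) * (\<bar>y\<bar> ^ k * exp (- (real n / s n ^ 6 * Phi n y))))"
    using assms by (simp add: Phi_def abs_mult power_divide)
  also have "\<dots> = gibbs_moment k (\<lambda>y. real n / s n ^ 6 * Phi n y) / s n ^ Suc k"
    unfolding gibbs_moment_def by (subst Bochner_Integration.integral_mult_right_zero) simp
  finally show ?thesis .
qed

abbreviation "E n \<equiv> BC_expectation n (\<beta> n) (K n) (\<lambda>\<omega>. \<bar>spin_sum n \<omega> / real n\<bar>)"

text \<open>The smoothing error is \<open>1 / sqrt (2 \<beta> K n)\<close>, so on the scale \<open>s\<close> it is negligible as soon as \<open>s\<close> is small compared
with \<open>sqrt n\<close>.\<close>
lemma scaled_expectation_limit: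
  assumes s_small: "(\<lambda>n. s n / sqrt (real n)) \<longlonglongrightarrow> 0"
    and lim: "(\<lambda>n. gibbs_moment 1 (\<lambda>y. real n / s n ^ 6 * Phi n y) / gibbs_moment 0 (\<lambda>y. real n / s n ^ 6 * Phi n y)) \<longlonglongrightarrow> c"
  shows "(\<lambda>n. s n * E n) \<longlonglongrightarrow> c"
proof -
  define Q where "Q = (\<lambda>n. gibbs_moment 1 (\<lambda>y. real n / s n ^ 6 * Phi n y) / gibbs_moment 0 (\<lambda>y. real n / s n ^ 6 * Phi n y))"
  have "(\<lambda>n. s n * E n - Q n) \<longlonglongrightarrow> 0"
  proof (rule Lim_null_comparison)
    have "(\<lambda>n. s n / sqrt (real n) * (1 / sqrt (A n))) \<longlonglongrightarrow> 0 * (1 / sqrt 3)"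
      by (intro tendsto_intros s_small A_lim) auto
    then show "(\<lambda>n. s n / sqrt (real n) * (1 / sqrt (A n))) \<longlonglongrightarrow> 0" by simp
    show "\<forall>\<^sub>F n in sequentially. norm (s n * E n - Q n) \<le> s n / sqrt (real n) * (1 / sqrt (A n))"
      using ev_s ev_params_pos eventually_gt_at_top[of 0]
    proof eventually_elim
      case (elim n)
      define r where "r = (LINT x|lborel. \<bar>x\<bar> * exp (- (real n * G_fun (\<beta> n) (K n) x))) / (LINT x|lborel. exp (- (real n * G_fun (\<beta> n) (K n) x)))"
      have r: "s n * r = Q n"
        using rescaled_moment[OF elim(1), of 1] rescaled_moment[OF elim(1), of 0] elim(1)
        by (simp add: r_def Q_def power2_eq_square)
      have "\<bar>E n - r\<bar> \<le> 1 / sqrt (real n * A n)"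
        using BC_expectation_abs_approx[of n "\<beta> n" "K n"] elim by (simp add: r_def path_slope_def)
      then have "s n * \<bar>E n - r\<bar> \<le> s n * (1 / sqrt (real n * A n))" using elim by (intro mult_left_mono) auto
      also have "\<dots> = s n / sqrt (real n) * (1 / sqrt (A n))" by (simp add: real_sqrt_mult)
      also have "s n * \<bar>E n - r\<bar> = \<bar>s n * E n - Q n\<bar>"
        unfolding r[symmetric] right_diff_distrib[symmetric] abs_mult using elim by simp
      finally show ?case by simp
    qed
  qed
  from tendsto_add[OF this lim[folded Q_def]] show ?thesis by simp
qed

text \<open>With \<open>s ^ 6 = n\<close> the exponent converges without concentrating, and the limit is a quotient of two fixed integrals.\<close>
lemma expectation_limit_critical_window:
  assumes s_small: "(\<lambda>n. s n / sqrt (real n)) \<longlonglongrightarrow> 0"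
    and s6: "\<forall>\<^sub>F n in sequentially. s n ^ 6 = real n"
  shows "(\<lambda>n. s n * E n) \<longlonglongrightarrow> gibbs_moment 1 (limit_poly l \<tau>) / gibbs_moment 0 (limit_poly l \<tau>)"
    and "0 < gibbs_moment 1 (limit_poly l \<tau>) / gibbs_moment 0 (limit_poly l \<tau>)"
proof -
  obtain C where C: "\<And>y. y\<^sup>2 - C \<le> limit_poly l \<tau> y" "\<forall>\<^sub>F n in sequentially. \<forall>y. y\<^sup>2 - C \<le> Phi n y"
    using limit_poly_lower_bound by blast
  have pos: "0 < gibbs_moment k (limit_poly l \<tau>)" for k
    by (rule gibbs_moment_pos[OF continuous_limit_poly C(1)])
  then show "0 < gibbs_moment 1 (limit_poly l \<tau>) / gibbs_moment 0 (limit_poly l \<tau>)" by simp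
  have lim: "(\<lambda>n. gibbs_moment k (Phi n)) \<longlonglongrightarrow> gibbs_moment k (limit_poly l \<tau>)" for k
    by (rule gibbs_moment_tendsto[OF continuous_Phi continuous_limit_poly Phi_pointwise C(2)])
  have "(\<lambda>n. gibbs_moment 1 (Phi n) / gibbs_moment 0 (Phi n))
      \<longlonglongrightarrow> gibbs_moment 1 (limit_poly l \<tau>) / gibbs_moment 0 (limit_poly l \<tau>)"
    using pos[of 0] by (intro tendsto_divide lim) simp
  moreover have "\<forall>\<^sub>F n in sequentially. gibbs_moment 1 (Phi n) / gibbs_moment 0 (Phi n)
     = gibbs_moment 1 (\<lambda>y. real n / s n ^ 6 * Phi n y) / gibbs_moment 0 (\<lambda>y. real n / s n ^ 6 * Phi n y)"
    using s6 eventually_gt_at_top[of 0] by eventually_elim simp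
  ultimately have "(\<lambda>n. gibbs_moment 1 (\<lambda>y. real n / s n ^ 6 * Phi n y) / gibbs_moment 0 (\<lambda>y. real n / s n ^ 6 * Phi n y))
      \<longlonglongrightarrow> gibbs_moment 1 (limit_poly l \<tau>) / gibbs_moment 0 (limit_poly l \<tau>)"
    by (rule Lim_transform_eventually)
  then show "(\<lambda>n. s n * E n) \<longlonglongrightarrow> gibbs_moment 1 (limit_poly l \<tau>) / gibbs_moment 0 (limit_poly l \<tau>)"
    by (rule scaled_expectation_limit[OF s_small])
qed

lemma expectation_limit_concentrated:
  assumes s_small: "(\<lambda>n. s n / sqrt (real n)) \<longlonglongrightarrow> 0"
    and s6: "filterlim (\<lambda>n. real n / s n ^ 6) at_top sequentially"
    and b: "0 \<le> b" "\<And>y. \<bar>y\<bar> \<noteq> b \<Longrightarrow> limit_poly l \<tau> b < limit_poly l \<tau> y"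
  shows "(\<lambda>n. s n * E n) \<longlonglongrightarrow> b"
proof -
  obtain C where C: "\<forall>\<^sub>F n in sequentially. \<forall>y. y\<^sup>2 - C \<le> Phi n y" using Phi_lower_bound by blast
  show ?thesis
    by (rule scaled_expectation_limit[OF s_small])
       (rule laplace_concentration[OF continuous_Phi continuous_limit_poly Phi_uniform C b(2) b(1) s6])
qed

end

section \<open>The three regimes of the exponent\<close>

lemma inverse_powr_at_right_0:
  assumes "0 < \<alpha>"
  shows "filterlim (\<lambda>n. 1 / real n powr \<alpha>) (at_right 0) sequentially"
proof -
  have "(\<lambda>n. real n powr (- \<alpha>)) \<longlonglongrightarrow> 0"
    using assms by (intro tendsto_neg_powr filterlim_real_sequentially) auto
  then have "(\<lambda>n. 1 / real n powr \<alpha>) \<longlonglongrightarrow> 0" by (simp add: powr_minus_divide)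
  moreover have "\<forall>\<^sub>F n in sequentially. 1 / real n powr \<alpha> \<in> {0<..} \<and> 1 / real n powr \<alpha> \<noteq> 0"
    using eventually_gt_at_top[of 0] by eventually_elim auto
  ultimately show ?thesis unfolding filterlim_at by blast
qed

lemma powr_at_top_sequentially:
  assumes "0 < p"
  shows "filterlim (\<lambda>n. real n powr p) at_top sequentially"
proof -
  have "filterlim (\<lambda>n. inverse (real n powr (- p))) at_top sequentially"
  proof (rule filterlim_inverse_at_top)
    show "(\<lambda>n. real n powr (- p)) \<longlonglongrightarrow> 0"
      using assms by (intro tendsto_neg_powr filterlim_real_sequentially) auto
    show "\<forall>\<^sub>F n in sequentially. 0 < real n powr (- p)"
      using eventually_gt_at_top[of 0] by eventually_elim simp
  qed
  then show ?thesis by (simp add: powr_minus)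
qed

text \<open>The path and the first-order curve agree to second order at \<open>beta_c\<close> by the two conjectures, and the third-order
coefficient of the path is larger.\<close>
lemma above_first_order_curve:
  assumes \<alpha>: "0 < \<alpha>" and d: "case_d l lt"
    and K1: "K1_three_right_derivs" "conjecture1" "conjecture2"
  shows "\<forall>\<^sub>F n in sequentially. \<exists>z. G_fun (beta_c + 1 / real n powr \<alpha>) (K_path l lt (1 / real n powr \<alpha>)) z < 0"
proof -
  have lim: "filterlim (\<lambda>n. 1 / real n powr \<alpha>) (at_right 0) sequentially"
    using \<alpha> by (rule inverse_powr_at_right_0)
  define r where "r = (\<lambda>h. (K1_curve (beta_c + h) - K_curve beta_c - K1_deriv 1 beta_c * h
       - K1_deriv 2 beta_c / 2 * h\<^sup>2 - K1_deriv 3 beta_c / 6 * h ^ 3) / h ^ 3)"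
  have "\<forall>\<^sub>F h in at_right 0. r h < (lt - K1_deriv 3 beta_c) / 6"
    using K1_curve_taylor[OF K1(1)] d unfolding r_def by (intro order_tendstoD) (auto simp: case_d_def)
  moreover have "\<forall>\<^sub>F h in at_right (0::real). 0 < h" by (rule eventually_at_right_less)
  ultimately have "\<forall>\<^sub>F h in at_right 0. \<exists>z. G_fun (beta_c + h) (K_path l lt h) z < 0"
  proof eventually_elim
    case (elim h)
    have "K_path l lt h - K1_curve (beta_c + h) = ((lt - K1_deriv 3 beta_c) / 6 - r h) * h ^ 3"
      using elim K1 d unfolding r_def K_path_def conjecture1_def conjecture2_def case_d_def
      by (simp add: field_simps)
    also have "\<dots> > 0" using elim by simp
    finally show ?case using elim by (intro negative_value_above_K1) auto
  qed
  then show ?thesis using lim by (rule eventually_compose_filterlim)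
qed

theorem theorem5p4:
  fixes l lt \<alpha> :: real and \<beta> K m E :: "nat \<Rightarrow> real"
  assumes alpha_pos: "\<alpha> > 0"
    and cases: "case_a l lt \<or> case_b l lt \<or> case_c l lt \<or> case_d l lt"
    and conjectures: "case_c l lt \<or> case_d l lt \<Longrightarrow>
           K1_three_right_derivs \<and> conjecture1 \<and> conjecture2"
  defines "\<beta> \<equiv> beta_seq \<alpha>"
    and "K \<equiv> K_seq l lt \<alpha>"
    and "m \<equiv> (\<lambda>n. magnetization (\<beta> n) (K n))"
    and "E \<equiv> (\<lambda>n. BC_expectation n (\<beta> n) (K n) (\<lambda>\<omega>. \<bar>spin_sum n \<omega> / real n\<bar>))"
  shows
    "(\<forall>\<^sub>F n in sequentially. (\<beta> n, K n) \<in> phase_coexistence) \<and>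
     (m \<sim>[sequentially] (\<lambda>n. xbar l / real n powr (\<alpha> / 2)) \<and>
      (\<forall>n\<ge>1. xbar l / real n powr (\<alpha> / 2) = xbar l * (\<beta> n - beta_c) powr (1 / 2))) \<and>
     ((case_a l lt \<or> case_b l lt \<or> case_c l lt) \<and> \<alpha> < 1 / 3 \<longrightarrow>
        E \<sim>[sequentially] (\<lambda>n. xbar l / real n powr (\<alpha> / 2)) \<and>
        (\<lambda>n. xbar l / real n powr (\<alpha> / 2)) \<sim>[sequentially] m) \<and>
     (\<alpha> > 1 / 3 \<longrightarrow>
        E \<sim>[sequentially] (\<lambda>n. ybar / real n powr (1 / 6)) \<and>
        filterlim (\<lambda>n. (ybar / real n powr (1 / 6)) / m n) at_top sequentially) \<and>
     (\<alpha> = 1 / 3 \<longrightarrow>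
        E \<sim>[sequentially] (\<lambda>n. zbar l / real n powr (1 / 6)) \<and>
        (\<lambda>n. zbar l / real n powr (1 / 6)) \<sim>[sequentially] (\<lambda>n. zbar l * m n / xbar l))"
proof -
  define h where "h = (\<lambda>n. 1 / real n powr \<alpha>)"
  have path: "\<beta> = (\<lambda>n. beta_c + h n)" "K = (\<lambda>n. K_path l lt (h n))"
    by (auto simp: fun_eq_iff \<beta>_def K_def h_def beta_seq_def K_seq_eq)
  have h_lim: "filterlim h (at_right 0) sequentially"
    unfolding h_def using alpha_pos by (rule inverse_powr_at_right_0)
  have a_le: "quad_coeff l \<le> 5 / 8"
    and a_less: "\<not> case_d l lt \<Longrightarrow> quad_coeff l < 5 / 8"
    using cases quad_coeff_bounds[of l lt] by auto
  obtain w where xb: "xbar l > 0" and w: "w \<le> 0" "quad_coeff l < 5 / 8 \<Longrightarrow> w < 0"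
    and fac: "\<And>x. g_poly l x = 9 / 40 * xbar l ^ 4 * w + 9 / 40 * (x\<^sup>2 - (xbar l)\<^sup>2)\<^sup>2 * (x\<^sup>2 - w)"
    using g_poly_factorization[OF a_le] by blast
  have s_lim: "filterlim (\<lambda>n. real n powr (\<alpha> / 2)) at_top sequentially"
    using alpha_pos by (intro powr_at_top_sequentially) simp
  have sh: "(real n powr (\<alpha> / 2))\<^sup>2 * h n = 1" if "0 < n" for n
    using that by (simp add: h_def power2_eq_square flip: powr_add)
  have sh_lim: "(\<lambda>n. (real n powr (\<alpha> / 2))\<^sup>2 * h n) \<longlonglongrightarrow> 1"
  proof (rule tendsto_eventually)
    show "\<forall>\<^sub>F n in sequentially. (real n powr (\<alpha> / 2))\<^sup>2 * h n = 1"
      using eventually_gt_at_top[of 0] by eventually_elim (rule sh)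
  qed
  interpret crit: tricritical_scaling l lt 1 h "\<lambda>n. real n powr (\<alpha> / 2)"
    using h_lim s_lim sh_lim by unfold_locales

  have neg: "\<forall>\<^sub>F n in sequentially. \<exists>z. G_fun (\<beta> n) (K n) z < 0"
  proof (cases "case_d l lt")
    case True
    then show ?thesis
      unfolding path h_def using above_first_order_curve[OF alpha_pos True] conjectures by blast
  next
    case False
    have "9 / 40 * xbar l ^ 4 * w < 0" using w(2) a_less[OF False] xb by (intro mult_pos_neg) auto
    then have "g_poly l (xbar l) < 0" using fac[of "xbar l"] by (simp add: mult_ac)
    then show ?thesis
      unfolding path using crit.negative_value_of_limit[of "xbar l"] by (simp add: limit_poly_1)
  qed
  have coex: "\<forall>\<^sub>F n in sequentially. (\<beta> n, K n) \<in> phase_coexistence"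
    using neg crit.ev_params_pos unfolding path
    by eventually_elim (use M_set_of_negative_value(4) in blast)
  have m_lim: "(\<lambda>n. real n powr (\<alpha> / 2) * m n) \<longlonglongrightarrow> xbar l"
    unfolding m_def path by (rule crit.magnetization_limit[OF refl a_le]) (use neg path in simp)
  have equivI: "f \<sim>[sequentially] (\<lambda>n. c / real n powr \<theta>)"
    if "(\<lambda>n. real n powr \<theta> * f n) \<longlonglongrightarrow> c" "0 < c" for f :: "nat \<Rightarrow> real" and c \<theta>
  proof (rule asymp_equivI')
    have "(\<lambda>n. real n powr \<theta> * f n / c) \<longlonglongrightarrow> c / c" using that by (intro tendsto_intros) auto
    then show "(\<lambda>n. f n / (c / real n powr \<theta>)) \<longlonglongrightarrow> 1" using that(2) by (simp add: mult.commute)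
  qed
  have m_equiv: "m \<sim>[sequentially] (\<lambda>n. xbar l / real n powr (\<alpha> / 2))"
    by (rule equivI[OF m_lim xb])
  have sqrt_form: "xbar l / real n powr (\<alpha> / 2) = xbar l * (\<beta> n - beta_c) powr (1 / 2)" if "n \<ge> 1" for n
    using that by (simp add: \<beta>_def beta_seq_def powr_divide powr_powr)
  have small: "(\<lambda>n. real n powr \<theta> / sqrt (real n)) \<longlonglongrightarrow> 0" if "\<theta> < 1 / 2" for \<theta>
  proof -
    have "(\<lambda>n. real n powr (\<theta> - 1 / 2)) \<longlonglongrightarrow> 0"
      using that by (intro tendsto_neg_powr filterlim_real_sequentially) auto
    then show ?thesis by (simp add: powr_diff powr_half_sqrt)
  qed
  have pow6: "(real n powr \<theta>) ^ 6 = real n powr (6 * \<theta>)" for n \<theta>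
    by (simp add: powr_powr mult.commute flip: powr_numeral)

  have low: "E \<sim>[sequentially] (\<lambda>n. xbar l / real n powr (\<alpha> / 2)) \<and>
        (\<lambda>n. xbar l / real n powr (\<alpha> / 2)) \<sim>[sequentially] m"
    if "case_a l lt \<or> case_b l lt \<or> case_c l lt" "\<alpha> < 1 / 3"
  proof -
    have w0: "w < 0" using w(2) quad_coeff_bounds(1)[OF that(1)] by simp
    have "limit_poly l 1 (xbar l) < limit_poly l 1 y" if "\<bar>y\<bar> \<noteq> xbar l" for y
    proof -
      have "y\<^sup>2 \<noteq> (xbar l)\<^sup>2" using that xb by (simp add: power2_eq_iff) linarith
      moreover have "0 < y\<^sup>2 - w" using w0 zero_le_power2[of y] by linarith
      ultimately have "0 < 9 / 40 * (y\<^sup>2 - (xbar l)\<^sup>2)\<^sup>2 * (y\<^sup>2 - w)" by simp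
      moreover have "g_poly l (xbar l) = 9 / 40 * xbar l ^ 4 * w" using fac[of "xbar l"] by simp
      ultimately show ?thesis using fac[of y] unfolding limit_poly_1 by linarith
    qed
    moreover have "filterlim (\<lambda>n. real n / (real n powr (\<alpha> / 2)) ^ 6) at_top sequentially"
    proof -
      have "filterlim (\<lambda>n. real n powr (1 - 6 * (\<alpha> / 2))) at_top sequentially"
        using \<open>\<alpha> < 1 / 3\<close> by (intro powr_at_top_sequentially) simp
      then show ?thesis unfolding pow6 powr_diff by simp
    qed
    ultimately have "(\<lambda>n. real n powr (\<alpha> / 2) * E n) \<longlonglongrightarrow> xbar l"
      unfolding E_def path using small[of "\<alpha> / 2"] \<open>\<alpha> < 1 / 3\<close> xb
      by (intro crit.expectation_limit_concentrated) auto
    then show ?thesis using equivI xb m_equiv asymp_equiv_sym by blast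
  qed

  have high: "E \<sim>[sequentially] (\<lambda>n. ybar / real n powr (1 / 6)) \<and>
        filterlim (\<lambda>n. (ybar / real n powr (1 / 6)) / m n) at_top sequentially"
    if "\<alpha> > 1 / 3"
  proof -
    have sh0: "(\<lambda>n. (real n powr (1 / 6))\<^sup>2 * h n) \<longlonglongrightarrow> 0"
    proof -
      have "(\<lambda>n. real n powr (1 / 3 - \<alpha>)) \<longlonglongrightarrow> 0"
        using that by (intro tendsto_neg_powr filterlim_real_sequentially) auto
      then show ?thesis by (simp add: h_def powr_diff power2_eq_square flip: powr_add)
    qed
    interpret high: tricritical_scaling l lt 0 h "\<lambda>n. real n powr (1 / 6)"
      using h_lim sh0 powr_at_top_sequentially[of "1 / 6"] by unfold_locales auto
    have y: "ybar = gibbs_moment 1 (limit_poly l 0) / gibbs_moment 0 (limit_poly l 0)"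
      by (simp add: ybar_def gibbs_moment_def limit_poly_0)
    have s6: "\<forall>\<^sub>F n in sequentially. (real n powr (1 / 6)) ^ 6 = real n" by (simp add: pow6)
    note E_lim = high.expectation_limit_critical_window[OF small s6, folded y]
    have ypos: "0 < ybar" using E_lim(2) by simp
    have "filterlim (\<lambda>n. ybar / (real n powr (\<alpha> / 2) * m n) * real n powr (\<alpha> / 2 - 1 / 6)) at_top sequentially"
    proof (rule filterlim_tendsto_pos_mult_at_top)
      show "(\<lambda>n. ybar / (real n powr (\<alpha> / 2) * m n)) \<longlonglongrightarrow> ybar / xbar l"
        using xb by (intro tendsto_intros m_lim) auto
      show "filterlim (\<lambda>n. real n powr (\<alpha> / 2 - 1 / 6)) at_top sequentially"
        using that by (intro powr_at_top_sequentially) simp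
    qed (use ypos xb in simp)
    then have "filterlim (\<lambda>n. (ybar / real n powr (1 / 6)) / m n) at_top sequentially"
    proof (rule filterlim_mono_eventually[OF _ order_refl order_refl])
      show "\<forall>\<^sub>F n in sequentially. ybar / (real n powr (\<alpha> / 2) * m n) * real n powr (\<alpha> / 2 - 1 / 6)
         = (ybar / real n powr (1 / 6)) / m n"
        using eventually_gt_at_top[of 0] by eventually_elim (simp add: powr_diff)
    qed
    moreover have "(\<lambda>n. real n powr (1 / 6) * E n) \<longlonglongrightarrow> ybar"
      unfolding E_def path using E_lim(1) by simp
    ultimately show ?thesis using equivI ypos by blast
  qed

  have critical: "E \<sim>[sequentially] (\<lambda>n. zbar l / real n powr (1 / 6)) \<and>
        (\<lambda>n. zbar l / real n powr (1 / 6)) \<sim>[sequentially] (\<lambda>n. zbar l * m n / xbar l)"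
    if \<alpha>: "\<alpha> = 1 / 3"
  proof -
    have z: "zbar l = gibbs_moment 1 (limit_poly l 1) / gibbs_moment 0 (limit_poly l 1)"
      by (simp add: zbar_def gibbs_moment_def limit_poly_1)
    have s6: "\<forall>\<^sub>F n in sequentially. (real n powr (\<alpha> / 2)) ^ 6 = real n" by (simp add: pow6 \<alpha>)
    note E_lim = crit.expectation_limit_critical_window[OF small s6, folded z]
    have zpos: "0 < zbar l" using E_lim(2) \<alpha> by simp
    have "(\<lambda>n. real n powr (1 / 6) * E n) \<longlonglongrightarrow> zbar l"
      unfolding E_def path using E_lim(1) \<alpha> by simp
    moreover have "(\<lambda>n. zbar l / real n powr (1 / 6)) \<sim>[sequentially] (\<lambda>n. zbar l * m n / xbar l)"
    proof (rule asymp_equivI')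
      have "(\<lambda>n. xbar l / (real n powr (\<alpha> / 2) * m n)) \<longlonglongrightarrow> xbar l / xbar l"
        using xb by (intro tendsto_intros m_lim) auto
      then show "(\<lambda>n. zbar l / real n powr (1 / 6) / (zbar l * m n / xbar l)) \<longlonglongrightarrow> 1"
        using xb zpos by (simp add: \<alpha> mult_ac)
    qed
    ultimately show ?thesis using equivI zpos by blast
  qed
  show ?thesis using coex m_equiv sqrt_form low high critical by blast
qed

end
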